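(* Suppose $\Bbbk$ is an algebraically closed field. Every finitely generated semiprime saturated operad of GK-dimension $1$ over $\Bbbk$ is isomorphic to a finite direct sum of operads each of the form $\mathcal{C}om^{\{w\}}$ or $\mathcal{O}pe^{\{2w\}}$ with $w\ge 1$ (where $w$ may depend on the summand).
   Context: "Operad" means a symmetric operad $\mathcal P$ in $\Bbbk$-vector spaces, given by right $\Bbbk\mathbb S_n$-modules $\mathcal P(n)$ ($n\ge 0$), an identity $1_{\mathcal P}\in\mathcal P(1)$ and partial compositions $\circ_i:\mathcal P(m)\otimes\mathcal P(n)\to\mathcal P(m+n-1)$, $1\le i\le m$, satisfying the usual unit, associativity and equivariance axioms. All operads are reduced ($\mathcal P(0)=0$) and locally finite ($\dim_\Bbbk\mathcal P(n)<\infty$). $\mathcal P$ is finitely generated if it is generated by finitely many elements as a symmetric operad. $\operatorname{GKdim}(\mathcal P)=\limsup_{n\to\infty}\log_n\bigl(\sum_{i=0}^n\dim\mathcal P(i)\bigr)$. For subcollections $I,J$ of $\mathcal P$, $I\circ J$ is the $\mathbb S$-submodule generated by all $x\circ_i y$ with $x\in I$, $y\in J$, $1\le i\le$ arity of $x$. $\mathcal P$ is prime if $I\circ J\ne 0$ for all nonzero (two-sided) ideals $I,J$ of $\mathcal P$. An ideal $I$ is prime if $\mathcal P/I$ is a prime operad. $\mathcal P$ is semiprime if the intersection of all prime ideals of $\mathcal P$ is $0$. For $w\ge 2$, $\mathcal P_{\{w\}}$ is the suboperad with $\mathcal P_{\{w\}}(1)=\Bbbk 1_{\mathcal P}$, $\mathcal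 P_{\{w\}}(n)=0$ for $2\le n\le w-1$, $\mathcal P_{\{w\}}(n)=\mathcal P(n)$ for $n\ge w$. Write $\mathcal P_{\ge n}=\bigoplus_{i\ge n}\mathcal P(i)$. $\mathcal P$ is left torsionfree if $\tau^l(\mathcal P)=\{x\in\mathcal P:\mathcal P_{\ge n}\circ(\Bbbk x)=0\text{ for }n\gg 0\}$ is zero. A left torsionfree operad $\mathcal P$ is saturated if for every left torsionfree operad $\mathcal Q$ and every isomorphism $\phi:\mathcal Q_{\{w\}}\to\mathcal P_{\{w\}}$ for some $w\ge 2$, $\phi$ extends to an injective operad homomorphism $\mathcal Q\to\mathcal P$. For $w\ge 1$: $\mathcal{C}om^{\{w\}}(n)=\Bbbk\mu_n$ if $n\ge1$ and $n\equiv 1\pmod w$, and $0$ otherwise, with trivial $\mathbb S_n$-action; $\mathcal{O}pe^{\{2w\}}(n)=\Bbbk\mu_n$ if $n\ge 1$ and $n\equiv 1\pmod{2w}$, and $0$ otherwise, with $\mu_n*\sigma=\operatorname{sgn}(\sigma)\mu_n$. In both cases $\mu_n\circ_i\mu_m=\mu_{n+m-1}$ for $1\le i\le n$. The direct sum of operads is formed arity-wise with componentwise structure. *)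

theory Defs
  imports
    "HOL-Computational_Algebra.Polynomial"
    "HOL-Combinatorics.Permutations"
    "HOL-Library.Function_Algebras"
    "HOL-Library.Extended_Real"
    "HOL-Library.Liminf_Limsup"
    "HOL-Number_Theory.Cong"
    "HOL.Transcendental"
begin

text \<open>
  The components \<open>P(n)\<close> of an operad are subspaces of one ambient vector space (type \<open>'a\<close> with
  scalar multiplication \<open>scl P\<close>), so that the library notions of span and dimension apply. They
  need not be independent or disjoint for different \<open>n\<close>; therefore the operations take the
  arities of their arguments as parameters. Intended meaning:
  \<open>act P n x s\<close> is \<open>x * s\<close> for \<open>x\<close> in \<open>P(n)\<close> and a permutation \<open>s\<close> of \<open>{1..n}\<close>;
  \<open>pcomp P m n i x y\<close> is the partial composition of \<open>x\<close> in \<open>P(m)\<close> with \<open>y\<close> in \<open>P(n)\<close> at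
  position \<open>i\<close>. Values outside these ranges are irrelevant.
\<close>

record ('k, 'a) operad_data =
  scl :: "'k \<Rightarrow> 'a \<Rightarrow> 'a"
  comps :: "nat \<Rightarrow> 'a set"
  act :: "nat \<Rightarrow> 'a \<Rightarrow> (nat \<Rightarrow> nat) \<Rightarrow> 'a"
  pcomp :: "nat \<Rightarrow> nat \<Rightarrow> nat \<Rightarrow> 'a \<Rightarrow> 'a \<Rightarrow> 'a"
  unit :: 'a

text \<open>
  For \<open>x\<close> of arity \<open>m\<close> and \<open>y\<close> of arity \<open>n\<close>, the block of positions \<open>{i..i+n-1}\<close> of the partial
  composition of \<open>x\<close> and \<open>y\<close> at \<open>i\<close> consists of the inputs of \<open>y\<close>. The permutation
  \<open>inner_perm n i t\<close> acts as \<open>t\<close> on that block and trivially elsewhere; \<open>outer_perm n i s\<close> acts as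
  \<open>s\<close> on the positions \<open>{1..m}\<close> with position \<open>i\<close> replaced by the block, which it moves rigidly.
\<close>

definition inner_perm :: "nat \<Rightarrow> nat \<Rightarrow> (nat \<Rightarrow> nat) \<Rightarrow> nat \<Rightarrow> nat" where
  "inner_perm n i t p = (if i \<le> p \<and> p < i + n then i - 1 + t (p - (i - 1)) else p)"

definition outer_perm :: "nat \<Rightarrow> nat \<Rightarrow> (nat \<Rightarrow> nat) \<Rightarrow> nat \<Rightarrow> nat" where
  "outer_perm n i s p =
     (if i \<le> p \<and> p < i + n then s i + (p - i)
      else let b = s (if p < i then p else p + 1 - n) in if b < s i then b else b + n - 1)"

text \<open>
  The product of permutations is composition of functions, so that in the endomorphism operad
  \<open>(f * s)(v\<^sub>1, \<dots>, v\<^sub>n)\<close> is \<open>f\<close> with \<open>v\<^sub>i\<close> inserted into slot \<open>s i\<close>.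
\<close>

locale operad = vector_space "scl P"
  for P :: "('k::field, 'a::ab_group_add) operad_data" +
  assumes subspace_comps: "subspace (comps P n)"
    and act_closed: "\<lbrakk>x \<in> comps P n; s permutes {1..n}\<rbrakk> \<Longrightarrow> act P n x s \<in> comps P n"
    and act_add: "\<lbrakk>x \<in> comps P n; y \<in> comps P n; s permutes {1..n}\<rbrakk>
      \<Longrightarrow> act P n (x + y) s = act P n x s + act P n y s"
    and act_scl: "\<lbrakk>x \<in> comps P n; s permutes {1..n}\<rbrakk> \<Longrightarrow> act P n (scl P c x) s = scl P c (act P n x s)"
    and act_id: "x \<in> comps P n \<Longrightarrow> act P n x id = x"
    and act_comp: "\<lbrakk>x \<in> comps P n; s permutes {1..n}; t permutes {1..n}\<rbrakk>
      \<Longrightarrow> act P n x (s \<circ> t) = act P n (act P n x s) t"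
    and pcomp_closed: "\<lbrakk>x \<in> comps P m; y \<in> comps P n; 1 \<le> i; i \<le> m\<rbrakk>
      \<Longrightarrow> pcomp P m n i x y \<in> comps P (m + n - 1)"
    and pcomp_add_left: "\<lbrakk>x \<in> comps P m; x' \<in> comps P m; y \<in> comps P n; 1 \<le> i; i \<le> m\<rbrakk>
      \<Longrightarrow> pcomp P m n i (x + x') y = pcomp P m n i x y + pcomp P m n i x' y"
    and pcomp_add_right: "\<lbrakk>x \<in> comps P m; y \<in> comps P n; y' \<in> comps P n; 1 \<le> i; i \<le> m\<rbrakk>
      \<Longrightarrow> pcomp P m n i x (y + y') = pcomp P m n i x y + pcomp P m n i x y'"
    and pcomp_scl_left: "\<lbrakk>x \<in> comps P m; y \<in> comps P n; 1 \<le> i; i \<le> m\<rbrakk>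
      \<Longrightarrow> pcomp P m n i (scl P c x) y = scl P c (pcomp P m n i x y)"
    and pcomp_scl_right: "\<lbrakk>x \<in> comps P m; y \<in> comps P n; 1 \<le> i; i \<le> m\<rbrakk>
      \<Longrightarrow> pcomp P m n i x (scl P c y) = scl P c (pcomp P m n i x y)"
    and unit_closed: "unit P \<in> comps P 1"
    and unit_left: "x \<in> comps P n \<Longrightarrow> pcomp P 1 n 1 (unit P) x = x"
    and unit_right: "\<lbrakk>x \<in> comps P n; 1 \<le> i; i \<le> n\<rbrakk> \<Longrightarrow> pcomp P n 1 i x (unit P) = x"
    and assoc_sequential:
      "\<lbrakk>x \<in> comps P l; y \<in> comps P m; z \<in> comps P n; 1 \<le> i; i \<le> l; 1 \<le> j; j \<le> m\<rbrakk>
      \<Longrightarrow> pcomp P (l + m - 1) n (i - 1 + j) (pcomp P l m i x y) z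
        = pcomp P l (m + n - 1) i x (pcomp P m n j y z)"
    and assoc_parallel:
      "\<lbrakk>x \<in> comps P l; y \<in> comps P m; z \<in> comps P n; 1 \<le> i; i < k; k \<le> l\<rbrakk>
      \<Longrightarrow> pcomp P (l + m - 1) n (k - 1 + m) (pcomp P l m i x y) z
        = pcomp P (l + n - 1) m i (pcomp P l n k x z) y"
    and equivariance_right:
      "\<lbrakk>x \<in> comps P m; y \<in> comps P n; 1 \<le> i; i \<le> m; t permutes {1..n}\<rbrakk>
      \<Longrightarrow> pcomp P m n i x (act P n y t)
        = act P (m + n - 1) (pcomp P m n i x y) (inner_perm n i t)"
    and equivariance_left:
      "\<lbrakk>x \<in> comps P m; y \<in> comps P n; 1 \<le> i; i \<le> m; s permutes {1..m}\<rbrakk>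
      \<Longrightarrow> pcomp P m n i (act P m x s) y
        = act P (m + n - 1) (pcomp P m n (s i) x y) (outer_perm n i s)"

locale reduced_lf_operad = operad +
  assumes reduced: "comps P 0 = {0}"
    and locally_finite: "\<exists>B. finite B \<and> comps P n = span B"

definition operad_hom ::
    "('k::field, 'a::ab_group_add) operad_data \<Rightarrow> ('k, 'b::ab_group_add) operad_data
      \<Rightarrow> (nat \<Rightarrow> 'a \<Rightarrow> 'b) \<Rightarrow> bool" where
  "operad_hom P Q f \<longleftrightarrow>
     (\<forall>n. \<forall>x\<in>comps P n. f n x \<in> comps Q n) \<and>
     (\<forall>n. \<forall>x\<in>comps P n. \<forall>y\<in>comps P n. f n (x + y) = f n x + f n y) \<and>
     (\<forall>n c. \<forall>x\<in>comps P n. f n (scl P c x) = scl Q c (f n x)) \<and>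
     (\<forall>n s. \<forall>x\<in>comps P n. s permutes {1..n} \<longrightarrow> f n (act P n x s) = act Q n (f n x) s) \<and>
     (\<forall>m n i. \<forall>x\<in>comps P m. \<forall>y\<in>comps P n. 1 \<le> i \<and> i \<le> m \<longrightarrow>
        f (m + n - 1) (pcomp P m n i x y) = pcomp Q m n i (f m x) (f n y)) \<and>
     f 1 (unit P) = unit Q"

definition operad_inj_hom where
  "operad_inj_hom P Q f \<longleftrightarrow> operad_hom P Q f \<and> (\<forall>n. inj_on (f n) (comps P n))"

definition operad_iso where
  "operad_iso P Q f \<longleftrightarrow> operad_hom P Q f \<and> (\<forall>n. bij_betw (f n) (comps P n) (comps Q n))"

definition isomorphic_operads where
  "isomorphic_operads P Q \<longleftrightarrow> (\<exists>f. operad_iso P Q f)"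

definition S_submodule ::
    "('k::field, 'a::ab_group_add) operad_data \<Rightarrow> (nat \<Rightarrow> 'a set) \<Rightarrow> bool" where
  "S_submodule P A \<longleftrightarrow>
     (\<forall>n. module.subspace (scl P) (A n) \<and> A n \<subseteq> comps P n \<and>
        (\<forall>x\<in>A n. \<forall>s. s permutes {1..n} \<longrightarrow> act P n x s \<in> A n))"

definition S_submodule_generated ::
    "('k::field, 'a::ab_group_add) operad_data \<Rightarrow> (nat \<Rightarrow> 'a set) \<Rightarrow> nat \<Rightarrow> 'a set" where
  "S_submodule_generated P X n = \<Inter> {A n | A. S_submodule P A \<and> (\<forall>k. X k \<subseteq> A k)}"

definition suboperad ::
    "('k::field, 'a::ab_group_add) operad_data \<Rightarrow> (nat \<Rightarrow> 'a set) \<Rightarrow> bool" where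
  "suboperad P A \<longleftrightarrow> S_submodule P A \<and> unit P \<in> A 1 \<and>
     (\<forall>m n i. \<forall>x\<in>A m. \<forall>y\<in>A n. 1 \<le> i \<and> i \<le> m \<longrightarrow> pcomp P m n i x y \<in> A (m + n - 1))"

text \<open>Generators are pairs of an arity and an element of that arity.\<close>

definition finitely_generated_operad ::
    "('k::field, 'a::ab_group_add) operad_data \<Rightarrow> bool" where
  "finitely_generated_operad P \<longleftrightarrow>
     (\<exists>G. finite G \<and> (\<forall>(n, x)\<in>G. x \<in> comps P n) \<and>
        (\<forall>A. suboperad P A \<and> (\<forall>(n, x)\<in>G. x \<in> A n) \<longrightarrow> A = comps P))"

definition GKdim :: "('k::field, 'a::ab_group_add) operad_data \<Rightarrow> ereal" where
  "GKdim P = limsup (\<lambda>n. let d = \<Sum>i=0..n. vector_space.dim (scl P) (comps P i)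
     in if d = 0 then -\<infinity> else ereal (log (real n) (real d)))"

abbreviation zero_coll :: "nat \<Rightarrow> 'a::zero set" where
  "zero_coll \<equiv> (\<lambda>n. {0})"

definition coll_comp :: "('k::field, 'a::ab_group_add) operad_data
    \<Rightarrow> (nat \<Rightarrow> 'a set) \<Rightarrow> (nat \<Rightarrow> 'a set) \<Rightarrow> nat \<Rightarrow> 'a set" where
  "coll_comp P I J = S_submodule_generated P
     (\<lambda>N. {pcomp P m n i x y | m n i x y.
        x \<in> I m \<and> y \<in> J n \<and> 1 \<le> i \<and> i \<le> m \<and> N = m + n - 1})"

definition operad_ideal ::
    "('k::field, 'a::ab_group_add) operad_data \<Rightarrow> (nat \<Rightarrow> 'a set) \<Rightarrow> bool" where
  "operad_ideal P I \<longleftrightarrow> S_submodule P I \<and>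
     (\<forall>m n i. \<forall>x\<in>comps P m. \<forall>y\<in>comps P n. 1 \<le> i \<and> i \<le> m \<and> (x \<in> I m \<or> y \<in> I n) \<longrightarrow>
        pcomp P m n i x y \<in> I (m + n - 1))"

definition prime_operad :: "('k::field, 'a::ab_group_add) operad_data \<Rightarrow> bool" where
  "prime_operad P \<longleftrightarrow> (\<forall>I J. operad_ideal P I \<and> operad_ideal P J \<and> I \<noteq> zero_coll \<and> J \<noteq> zero_coll
     \<longrightarrow> coll_comp P I J \<noteq> zero_coll)"

text \<open>
  The cosets of a subspace \<open>S\<close> are represented in the ambient space itself, by the values of a fixed
  linear map \<open>coset_rep sc S\<close> with kernel \<open>S\<close> that maps each vector into its own coset (the
  projection along \<open>S\<close> onto some complement). The quotient operad consists of the representatives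
  of the cosets of \<open>I(n)\<close> in \<open>P(n)\<close>, with the operations computed on representatives.
\<close>

definition coset_rep :: "('k::field \<Rightarrow> 'a::ab_group_add \<Rightarrow> 'a) \<Rightarrow> 'a set \<Rightarrow> 'a \<Rightarrow> 'a" where
  "coset_rep sc S = (SOME p. Vector_Spaces.linear sc sc p \<and> (\<forall>x\<in>S. p x = 0) \<and> (\<forall>x. x - p x \<in> S))"

lemma coset_rep:
  fixes sc :: "'k::field \<Rightarrow> 'a::ab_group_add \<Rightarrow> 'a"
  assumes "vector_space sc" "module.subspace sc S"
  shows "Vector_Spaces.linear sc sc (coset_rep sc S)"
    and "x - coset_rep sc S x \<in> S"
    and "coset_rep sc S x = coset_rep sc S y \<longleftrightarrow> x - y \<in> S"
proof -
  interpret vector_space sc by fact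
  interpret vp: vector_space_pair sc sc by unfold_locales
  obtain B where B: "B \<subseteq> S" "independent B" "S \<subseteq> span B"
    by (rule basis_exists[of S])
  have span_B: "span B = S"
    by (rule subset_antisym[OF span_minimal[OF B(1) assms(2)] B(3)])
  obtain C where C: "B \<subseteq> C" "independent C" "UNIV \<subseteq> span C"
    by (rule maximal_independent_subset_extend[OF subset_UNIV B(2)])
  obtain p where p: "Vector_Spaces.linear sc sc p" "\<forall>b\<in>C. p b = (if b \<in> B then 0 else b)"
    using vp.linear_independent_extend[OF C(2), of "\<lambda>b. if b \<in> B then 0 else b"] by (elim exE conjE)
  interpret p: Vector_Spaces.linear sc sc p by fact
  have "p x = 0" if "x \<in> S" for x
  proof -
    have "x \<in> span B" using that span_B by simp
    then show ?thesis
    proof (induction rule: span_induct_alt)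
      case base
      show ?case by (rule p.zero)
    next
      case (step c b y)
      have "p b = 0" using p(2) C(1) step(1) by auto
      then show ?case using step by (simp add: p.add p.scale)
    qed
  qed
  moreover have "x - p x \<in> S" for x
  proof -
    have "x \<in> span C" using C(3) by auto
    then show ?thesis
    proof (induction rule: span_induct_alt)
      case base
      show ?case using subspace_0[OF assms(2)] by (simp add: p.zero)
    next
      case (step c b y)
      have "p b = (if b \<in> B then 0 else b)" using p(2) step(1) by simp
      then have b: "b - p b \<in> S"
        using B(1) subspace_0[OF assms(2)] by auto
      have eq: "sc c b + y - p (sc c b + y) = sc c (b - p b) + (y - p y)"
        by (simp add: p.add p.scale scale_right_diff_distrib)
      show ?case
        unfolding eq by (rule subspace_add[OF assms(2) subspace_scale[OF assms(2) b] step(2)])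
    qed
  qed
  ultimately have ex: "\<exists>p. Vector_Spaces.linear sc sc p \<and> (\<forall>x\<in>S. p x = 0) \<and> (\<forall>x. x - p x \<in> S)"
    using p(1) by (intro exI[of _ p] conjI ballI allI)
  let ?r = "coset_rep sc S"
  have r_all: "Vector_Spaces.linear sc sc ?r \<and> (\<forall>x\<in>S. ?r x = 0) \<and> (\<forall>x. x - ?r x \<in> S)"
    unfolding coset_rep_def by (rule someI_ex[OF ex])
  then have r: "Vector_Spaces.linear sc sc ?r" "\<forall>x\<in>S. ?r x = 0" "\<And>x. x - ?r x \<in> S"
    by simp_all
  interpret r: Vector_Spaces.linear sc sc ?r by fact
  show "Vector_Spaces.linear sc sc ?r" and "x - ?r x \<in> S" by fact+
  have "x - y \<in> S" if "?r x = ?r y"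
  proof -
    have eq: "x - y = (x - ?r x) - (y - ?r y)" using that by simp
    show ?thesis unfolding eq by (rule subspace_diff[OF assms(2) r(3) r(3)])
  qed
  moreover have "?r x = ?r y" if "x - y \<in> S"
  proof -
    have "?r x - ?r y = 0" using r(2) that r.diff[of x y] by simp
    then show ?thesis by simp
  qed
  ultimately show "?r x = ?r y \<longleftrightarrow> x - y \<in> S" by blast
qed

definition quotient_operad :: "('k::field, 'a::ab_group_add) operad_data
    \<Rightarrow> (nat \<Rightarrow> 'a set) \<Rightarrow> ('k, 'a) operad_data" where
  "quotient_operad P I =
     (let r = (\<lambda>n. coset_rep (scl P) (I n)) in
      \<lparr>scl = scl P,
       comps = (\<lambda>n. r n ` comps P n),
       act = (\<lambda>n x s. r n (act P n x s)),
       pcomp = (\<lambda>m n i x y. r (m + n - 1) (pcomp P m n i x y)),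
       unit = r 1 (unit P)\<rparr>)"

text \<open>
  The improper ideal counts as prime here (the zero operad is vacuously prime); this does not
  affect the intersection of all prime ideals.
\<close>

definition prime_ideal_operad ::
    "('k::field, 'a::ab_group_add) operad_data \<Rightarrow> (nat \<Rightarrow> 'a set) \<Rightarrow> bool" where
  "prime_ideal_operad P I \<longleftrightarrow> operad_ideal P I \<and> prime_operad (quotient_operad P I)"

definition semiprime_operad :: "('k::field, 'a::ab_group_add) operad_data \<Rightarrow> bool" where
  "semiprime_operad P \<longleftrightarrow> (\<forall>n. \<Inter> {I n | I. prime_ideal_operad P I} = {0})"

definition truncated_operad ::
    "nat \<Rightarrow> ('k::field, 'a::ab_group_add) operad_data \<Rightarrow> ('k, 'a) operad_data" where
  "truncated_operad w P = P\<lparr>comps := (\<lambda>n.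
     if n = 1 then module.span (scl P) {unit P} else if n < w then {0} else comps P n)\<rparr>"

definition left_torsion ::
    "('k::field, 'a::ab_group_add) operad_data \<Rightarrow> nat \<Rightarrow> 'a set" where
  "left_torsion P m = {x \<in> comps P m. \<forall>\<^sub>F n in sequentially.
     coll_comp P (\<lambda>k. if k \<ge> n then comps P k else {0})
       (\<lambda>k. if k = m then module.span (scl P) {x} else {0}) = zero_coll}"

definition left_torsionfree :: "('k::field, 'a::ab_group_add) operad_data \<Rightarrow> bool" where
  "left_torsionfree P \<longleftrightarrow> left_torsion P = zero_coll"

text \<open>
  The operads \<open>Q\<close> range over all operads with components in (a vector space structure on) the type
  \<open>nat \<Rightarrow> 'k\<close>. Up to isomorphism these are all locally finite operads: with pointwise operations,
  \<open>nat \<Rightarrow> 'k\<close> contains subspaces of every finite dimension, and the components of an operad may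
  overlap.
\<close>

definition saturated_operad :: "('k::field, 'a::ab_group_add) operad_data \<Rightarrow> bool" where
  "saturated_operad P \<longleftrightarrow> left_torsionfree P \<and>
     (\<forall>(Q :: ('k, nat \<Rightarrow> 'k) operad_data) w f.
        reduced_lf_operad Q \<and> left_torsionfree Q \<and> w \<ge> 2 \<and>
        operad_iso (truncated_operad w Q) (truncated_operad w P) f \<longrightarrow>
        (\<exists>g. operad_inj_hom Q P g \<and> (\<forall>n. \<forall>x\<in>comps (truncated_operad w Q) n. g n x = f n x)))"

text \<open>The generator \<open>\<mu>\<^sub>n\<close> is \<open>1\<close> in the one-dimensional space \<open>'k\<close>.\<close>

definition Com_operad :: "nat \<Rightarrow> ('k::field, 'k) operad_data" where
  "Com_operad w =
     \<lparr>scl = (*),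
      comps = (\<lambda>n. if n \<ge> 1 \<and> [n = 1] (mod w) then UNIV else {0}),
      act = (\<lambda>n x s. x),
      pcomp = (\<lambda>m n i x y. x * y),
      unit = 1\<rparr>"

text \<open>This satisfies the operad axioms only for even \<open>v\<close> (or in characteristic \<open>2\<close>).\<close>

definition Ope_operad :: "nat \<Rightarrow> ('k::field, 'k) operad_data" where
  "Ope_operad v =
     \<lparr>scl = (*),
      comps = (\<lambda>n. if n \<ge> 1 \<and> [n = 1] (mod v) then UNIV else {0}),
      act = (\<lambda>n x s. of_int (sign s) * x),
      pcomp = (\<lambda>m n i x y. x * y),
      unit = 1\<rparr>"

text \<open>Families are extended by \<open>0\<close> outside the index set.\<close>

definition direct_sum_operad ::
    "'i set \<Rightarrow> ('i \<Rightarrow> ('k::field, 'a::ab_group_add) operad_data) \<Rightarrow> ('k, 'i \<Rightarrow> 'a) operad_data" where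
  "direct_sum_operad I Q =
     \<lparr>scl = (\<lambda>c x i. scl (Q i) c (x i)),
      comps = (\<lambda>n. {x. (\<forall>i\<in>I. x i \<in> comps (Q i) n) \<and> (\<forall>i. i \<notin> I \<longrightarrow> x i = 0)}),
      act = (\<lambda>n x s i. if i \<in> I then act (Q i) n (x i) s else 0),
      pcomp = (\<lambda>m n j x y i. if i \<in> I then pcomp (Q i) m n j (x i) (y i) else 0),
      unit = (\<lambda>i. if i \<in> I then unit (Q i) else 0)\<rparr>"

end

theory Submission
  imports Defs
begin

text \<open>
  Growth below \<open>n\<^bsup>3/2\<^esup>\<close> forces the alternating groups to act trivially: a representation of \<open>S\<^sub>n\<close> on which they act
  nontrivially has dimension at least of order \<open>n\<^bsup>1/2\<^esup>\<close>, and by finite generation and torsionfreeness the arities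
  where this happens would have bounded gaps. Then all partial compositions agree up to sign with \<open>\<circ>\<^sub>1\<close>, and
  since the operad is semiprime and torsionfree, \<open>\<circ>\<^sub>1\<close> is a commutative product on \<open>P\<close>, graded by arity minus one.
  A graded prime quotient has at most one-dimensional components: otherwise two independent elements
  of the same degree satisfy a vanishing binary form, which splits into linear factors over an algebraically
  closed field. So the primes give multiplicative functionals, of which there are finitely many up to
  scaling. They embed \<open>P\<close> into a direct sum of operads of the asserted form, with equality in large arities,
  and saturation makes the embedding surjective.
\<close>

section \<open>Signs of block permutations\<close>

text \<open>Two obstacles shape the argument. All transpositions of one arity act by one involution
  \<open>twist\<close>, which need not be a scalar, as summands of both signs occur together.
  Moreover, the sign identities are visible only in arities with enough free inputs. They are proved
  there and brought down to small degrees by composing from the left with all elements of large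
  degree, which torsionfreeness allows to cancel. Semiprimeness makes \<open>twist\<close> trivial
  in odd degrees; this yields commutativity and also the even period of the antisymmetric summands.

  Growth enters twice, through the exponent 5/4: it is below 3/2 for the alternating groups and
  below 2 for the vanishing forms.

  A prime quotient may be concentrated in degree 0 and then yields no admissible functional;
  torsionfreeness again supplies enough primes of the other kind. Functionals that differ by a
  rescaling \<open>l ^ d\<close> have the same kernel, so kernels are counted. They are pairwise
  incomparable, which gives elements on which a single functional survives, and hence surjectivity
  in large arities.\<close>

lemma inner_perm_id: "inner_perm n i id = id"
  by (auto simp: inner_perm_def fun_eq_iff)

lemma inner_perm_transpose:
  assumes "a \<in> {1..n}" "b \<in> {1..n}" "i \<ge> 1"
  shows "inner_perm n i (transpose a b) = transpose (i - 1 + a) (i - 1 + b)"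
proof
  fix p
  show "inner_perm n i (transpose a b) p = transpose (i - 1 + a) (i - 1 + b) p"
  proof (cases "i \<le> p \<and> p < i + n")
    case True
    define q where "q = p - (i - 1)"
    have p: "p = i - 1 + q" using True assms by (simp add: q_def)
    show ?thesis unfolding inner_perm_def q_def[symmetric] using True by (simp add: p transpose_def)
  next
    case False
    then have "p \<noteq> i - 1 + a" "p \<noteq> i - 1 + b" using assms by auto
    then show ?thesis unfolding inner_perm_def if_not_P[OF False] by simp
  qed
qed

lemma inner_perm_compose:
  assumes "t permutes {1..n}" "i \<ge> 1"
  shows "inner_perm n i (s \<circ> t) = inner_perm n i s \<circ> inner_perm n i t"
proof
  fix p
  have "1 \<le> t (p - (i - 1)) \<and> t (p - (i - 1)) \<le> n" if "i \<le> p" "p < i + n"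
  proof -
    have "p - (i - 1) \<in> {1..n}" using that assms(2) by auto
    then show ?thesis by (rule permutes_in_seg[OF assms(1)])
  qed
  then show "inner_perm n i (s \<circ> t) p = (inner_perm n i s \<circ> inner_perm n i t) p"
    using assms(2) unfolding inner_perm_def by auto
qed

lemma inner_perm_permutes_sign:
  assumes "t permutes {1..n}" "1 \<le> i" "i \<le> m"
  shows "inner_perm n i t permutes {1..m + n - 1} \<and> sign (inner_perm n i t) = sign t"
  using assms(1) finite_atLeastAtMost[of 1 n]
proof (induction t rule: permutes_induct)
  case id
  show ?case by (simp only: inner_perm_id permutes_id sign_id)
next
  case (swap a b p)
  have t: "inner_perm n i (transpose a b \<circ> p) = transpose (i - 1 + a) (i - 1 + b) \<circ> inner_perm n i p"
    using swap assms(2) by (simp add: inner_perm_compose inner_perm_transpose)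
  have tp: "transpose (i - 1 + a) (i - 1 + b) permutes {1..m + n - 1}"
    by (rule permutes_swap_id) (use swap assms in auto)
  have pp: "permutation (inner_perm n i p)" "permutation p"
    using swap by (auto intro: permutes_imp_permutation)
  have "sign (inner_perm n i (transpose a b \<circ> p)) = sign (transpose a b \<circ> p)"
    unfolding t sign_compose[OF permutation_swap_id pp(1)] sign_compose[OF permutation_swap_id pp(2)]
    using swap by (simp add: sign_swap_id)
  then show ?case
    using permutes_compose[OF _ tp, of "inner_perm n i p"] swap unfolding t by blast
qed

lemmas inner_perm_permutes = inner_perm_permutes_sign[THEN conjunct1]
lemmas sign_inner_perm = inner_perm_permutes_sign[THEN conjunct2]

text \<open>The cycle that carries the additional position \<open>m + 1\<close> to the place just
  behind \<open>i\<close>, so that \<open>i\<close> and the new input form a block of length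
  2.\<close>

definition insertion_cycle :: "nat \<Rightarrow> nat \<Rightarrow> nat \<Rightarrow> nat" where
  "insertion_cycle m i p = (if p \<le> i \<or> p > m + 1 then p else if p = m + 1 then i + 1 else p + 1)"

lemma insertion_cycle_permutes_sign:
  assumes "i \<le> m"
  shows "insertion_cycle m i permutes {1..m + 1} \<and> sign (insertion_cycle m i) = (-1) ^ (m - i)"
  using assms
proof (induction i rule: inc_induct)
  case base
  have "insertion_cycle m m = id" by (auto simp: insertion_cycle_def fun_eq_iff)
  then show ?case by (simp only: permutes_id sign_id) simp
next
  case (step i)
  have eq: "insertion_cycle m i = transpose (i + 1) (i + 2) \<circ> insertion_cycle m (Suc i)"
    using step(2) by (auto simp: insertion_cycle_def fun_eq_iff transpose_def)
  have t: "transpose (i + 1) (i + 2) permutes {1..m + 1}"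
    by (rule permutes_swap_id) (use step in auto)
  have p: "permutation (insertion_cycle m (Suc i))"
    using step by (auto intro: permutes_imp_permutation)
  have "m - i = Suc (m - Suc i)" using step by simp
  then have "sign (insertion_cycle m i) = (-1) ^ (m - i)"
    unfolding eq sign_compose[OF permutation_swap_id p] using step by (simp add: sign_swap_id)
  then show ?case
    using permutes_compose[OF _ t, of "insertion_cycle m (Suc i)"] step unfolding eq by blast
qed

text \<open>Up to the insertion cycles at \<open>i\<close> and at \<open>s i\<close>, doubling input
  \<open>i\<close> is the extension of \<open>s\<close> that fixes \<open>m + 1\<close>. The sign is
  thus reduced to the signs of the two cycles.\<close>

lemma outer_perm_2:
  assumes "s permutes {1..m}" "1 \<le> i" "i \<le> m"
  shows "outer_perm 2 i s \<circ> insertion_cycle m i = insertion_cycle m (s i) \<circ> s"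
proof
  fix p
  have si: "1 \<le> s i" "s i \<le> m" using permutes_in_seg[OF assms(1)] assms by auto
  have inj: "s q = s i \<longleftrightarrow> q = i" for q using permutes_inj[OF assms(1)] by (auto dest: injD)
  have out: "s q = q" if "q > m" for q using permutes_not_in[OF assms(1)] that by auto
  have out0: "s 0 = 0" using permutes_not_in[OF assms(1)] by auto
  have inn: "s q \<le> m" if "q \<le> m" for q
    using permutes_in_seg[OF assms(1), of q] that out0 by (cases "q = 0") auto
  consider "p < i" | "p = i" | "i < p" "p \<le> m" | "p = m + 1" | "p > m + 1" by linarith
  then show "(outer_perm 2 i s \<circ> insertion_cycle m i) p = (insertion_cycle m (s i) \<circ> s) p"
  proof cases
    case 1
    then have "s p \<noteq> s i" "s p \<le> m" using inj inn assms by auto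
    then show ?thesis using 1 si assms by (auto simp: outer_perm_def insertion_cycle_def Let_def)
  next
    case 2
    then show ?thesis using si assms by (auto simp: outer_perm_def insertion_cycle_def)
  next
    case 3
    then have "s p \<noteq> s i" "s p \<le> m" using inj inn assms by auto
    then show ?thesis using 3 si assms by (auto simp: outer_perm_def insertion_cycle_def Let_def)
  next
    case 4
    then show ?thesis using si assms out by (auto simp: outer_perm_def insertion_cycle_def)
  next
    case 5
    then show ?thesis using si assms out by (auto simp: outer_perm_def insertion_cycle_def Let_def)
  qed
qed

lemma outer_perm_1: "outer_perm 1 i s = s"
proof
  fix p
  show "outer_perm 1 i s p = s p"
    by (cases "p = i") (auto simp: outer_perm_def Let_def)
qed

text \<open>Doubling the first input of a block of length \<open>n\<close> lengthens the block by
  one, so signs for all block lengths follow by induction from length 2.\<close>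

lemma outer_perm_Suc:
  assumes "n \<ge> 1"
  shows "outer_perm 2 i (outer_perm n i s) = outer_perm (Suc n) i s"
proof
  fix p
  have si: "outer_perm n i s i = s i" using assms by (simp add: outer_perm_def)
  consider "p < i" | "p = i" | "i < p" "p < i + Suc n" | "p \<ge> i + Suc n" by linarith
  then show "outer_perm 2 i (outer_perm n i s) p = outer_perm (Suc n) i s p"
  proof cases
    case 1
    then have "outer_perm n i s p = (if s p < s i then s p else s p + n - 1)"
      by (simp add: outer_perm_def Let_def)
    moreover have "s p + n - 1 < s i \<Longrightarrow> s p < s i" using assms by linarith
    ultimately show ?thesis using 1 si assms by (simp add: outer_perm_def[of 2] outer_perm_def[of "Suc n"] Let_def)
  next
    case 2
    then show ?thesis using assms by (simp add: outer_perm_def)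
  next
    case 3
    then have p: "i \<le> p - 1" "p - 1 < i + n" "p + 1 - 2 = p - 1" by auto
    then have eq: "outer_perm n i s (p - 1) = s i + (p - 1 - i)" by (simp add: outer_perm_def)
    have rhs: "outer_perm (Suc n) i s p = s i + (p - i)" using 3 by (simp add: outer_perm_def)
    show ?thesis
    proof (cases "p = i + 1")
      case True
      then show ?thesis using rhs si by (simp add: outer_perm_def[of 2])
    next
      case False
      then have "\<not> (i \<le> p \<and> p < i + 2)" "\<not> p < i" "\<not> s i + (p - 1 - i) < s i"
        "s i + (p - 1 - i) + 2 - 1 = s i + (p - i)" using 3 by auto
      then show ?thesis unfolding rhs outer_perm_def[of 2] Let_def si by (simp only: p eq if_False simp_thms)
    qed
  next
    case 4
    have p: "p + 1 - 2 = p - 1" "p - 1 + 1 - n = p - n" "p + 1 - Suc n = p - n" using 4 assms by auto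
    have cond: "\<not> (i \<le> p \<and> p < i + m)" "\<not> p < i" if "m \<le> Suc n" for m using 4 that by auto
    have cond': "\<not> (i \<le> p - 1 \<and> p - 1 < i + n)" "\<not> p - 1 < i" using 4 assms by linarith+
    have "outer_perm n i s (p - 1) = (if s (p - n) < s i then s (p - n) else s (p - n) + n - 1)"
      unfolding outer_perm_def if_not_P[OF cond'(1)] if_not_P[OF cond'(2)] Let_def p ..
    moreover have "outer_perm (Suc n) i s p = (if s (p - n) < s i then s (p - n) else s (p - n) + Suc n - 1)"
      unfolding outer_perm_def if_not_P[OF cond(1)[OF order_refl]] if_not_P[OF cond(2)[OF order_refl]] Let_def p ..
    moreover have "outer_perm 2 i (outer_perm n i s) p = (if outer_perm n i s (p - 1) < s i
        then outer_perm n i s (p - 1) else outer_perm n i s (p - 1) + 2 - 1)"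
      using cond[of 2] assms si unfolding outer_perm_def[of 2] Let_def p by auto
    moreover have "s (p - n) + n - 1 < s i \<Longrightarrow> s (p - n) < s i" using assms by linarith
    ultimately show ?thesis using assms by auto
  qed
qed

lemma outer_perm_2_permutes_sign:
  assumes "s permutes {1..m}" "1 \<le> i" "i \<le> m"
  shows "outer_perm 2 i s permutes {1..m + 1} \<and> sign (outer_perm 2 i s) = sign s * (-1) ^ (i + s i)"
proof -
  let ?c = "insertion_cycle m"
  have si: "1 \<le> s i" "s i \<le> m" using permutes_in_seg[OF assms(1)] assms by auto
  have ci: "?c i permutes {1..m + 1}" "sign (?c i) = (-1) ^ (m - i)"
    and csi: "?c (s i) permutes {1..m + 1}" "sign (?c (s i)) = (-1) ^ (m - s i)"
    using insertion_cycle_permutes_sign assms si by auto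
  have s: "s permutes {1..m + 1}" by (rule permutes_subset[OF assms(1)]) auto
  have eq: "outer_perm 2 i s = ?c (s i) \<circ> s \<circ> inv (?c i)"
    using outer_perm_2[OF assms] permutes_inv_o(1)[OF ci(1)] by (metis comp_assoc comp_id)
  have perm: "permutation s" "permutation (?c i)" "permutation (?c (s i))" "permutation (inv (?c i))"
    using s ci csi permutes_imp_permutation permutes_inv by blast+
  have "sign (outer_perm 2 i s) = (-1) ^ (m - s i) * sign s * (-1) ^ (m - i)"
    unfolding eq using perm by (simp add: sign_compose permutation_compose sign_inverse ci csi)
  also have "\<dots> = sign s * (-1) ^ ((m - s i) + (m - i))" by (simp add: power_add)
  also have "(-1::int) ^ ((m - s i) + (m - i)) = (-1) ^ (i + s i)"
    using assms si by (simp add: minus_one_power_iff even_add)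
  finally have "sign (outer_perm 2 i s) = sign s * (-1) ^ (i + s i)" .
  moreover have "outer_perm 2 i s permutes {1..m + 1}"
    unfolding eq by (rule permutes_compose[OF permutes_inv[OF ci(1)] permutes_compose[OF s csi(1)]])
  ultimately show ?thesis by blast
qed

lemma outer_perm_permutes_sign:
  assumes "s permutes {1..m}" "1 \<le> i" "i \<le> m"
  shows "outer_perm (Suc b) i s permutes {1..m + b} \<and>
    sign (outer_perm (Suc b) i s) = sign s * (-1) ^ (b * (i + s i))"
proof (induction b)
  case 0
  show ?case using outer_perm_1[of i s] assms(1) by simp
next
  case (Suc b)
  let ?s = "outer_perm (Suc b) i s"
  have si: "?s i = s i" by (simp add: outer_perm_def)
  have s2: "outer_perm (Suc (Suc b)) i s = outer_perm 2 i ?s"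
    using outer_perm_Suc[of "Suc b"] by simp
  have "outer_perm 2 i ?s permutes {1..m + b + 1} \<and> sign (outer_perm 2 i ?s) = sign ?s * (-1) ^ (i + ?s i)"
    by (rule outer_perm_2_permutes_sign) (use Suc assms in auto)
  then show ?case unfolding s2 si using Suc by (simp add: power_add)
qed

lemmas outer_perm_permutes = outer_perm_permutes_sign[THEN conjunct1]
lemmas sign_outer_perm = outer_perm_permutes_sign[THEN conjunct2]

section \<open>Torsion and linear dependence\<close>

lemma (in vector_space) finite_family_dependent:
  fixes f :: "nat \<Rightarrow> 'b"
  assumes "finite B" "f ` {..<k} \<subseteq> span B" "card B < k"
  shows "\<exists>c. (\<exists>i<k. c i \<noteq> 0) \<and> (\<Sum>i<k. scale (c i) (f i)) = 0"
proof (cases "inj_on f {..<k}")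
  case True
  then have "card (f ` {..<k}) = k" by (simp add: card_image)
  then have "dependent (f ` {..<k})"
    using independent_span_bound[OF assms(1) _ assms(2)] assms(3) by fastforce
  then obtain u where u: "\<exists>v\<in>f ` {..<k}. u v \<noteq> 0" "(\<Sum>v\<in>f ` {..<k}. scale (u v) v) = 0"
    using dependent_finite[of "f ` {..<k}"] by auto
  show ?thesis
    using u by (intro exI[of _ "u \<circ> f"]) (auto simp: sum.reindex[OF True])
next
  case False
  then obtain i j where ij: "i < k" "j < k" "i \<noteq> j" "f i = f j"
    by (auto simp: inj_on_def)
  define c :: "nat \<Rightarrow> 'a" where "c l = (if l = i then 1 else if l = j then - 1 else 0)" for l
  have "(\<Sum>l<k. scale (c l) (f l)) = (\<Sum>l\<in>{i, j}. scale (c l) (f l))"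
    using ij by (intro sum.mono_neutral_right) (auto simp: c_def)
  also have "\<dots> = 0" using ij by (simp add: c_def)
  finally show ?thesis using ij by (intro exI[of _ c]) (auto simp: c_def intro!: exI[of _ i])
qed

lemma S_submodule_generated_zero:
  assumes "vector_space (scl P)" "S_submodule P zero_coll" "\<And>n. X n \<subseteq> {0}"
  shows "S_submodule_generated P X = zero_coll"
proof
  fix n
  interpret vector_space "scl P" by fact
  have "0 \<in> A n" if "S_submodule P A" for A
    using that unfolding S_submodule_def by (auto dest: subspace_0)
  then show "S_submodule_generated P X n = {0}"
    unfolding S_submodule_generated_def using assms(2,3) by blast
qed

context operad
begin

lemma act_zero: "s permutes {1..n} \<Longrightarrow> act P n 0 s = 0"
  using act_scl[of 0 n s 0] subspace_0[OF subspace_comps] by simp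

lemma act_minus: "\<lbrakk>x \<in> comps P n; s permutes {1..n}\<rbrakk> \<Longrightarrow> act P n (- x) s = - act P n x s"
  using act_scl[of x n s "-1"] by simp

lemma act_diff:
  "\<lbrakk>x \<in> comps P n; y \<in> comps P n; s permutes {1..n}\<rbrakk> \<Longrightarrow> act P n (x - y) s = act P n x s - act P n y s"
  using act_add[of x n "- y" s] subspace_neg[OF subspace_comps] by (simp add: act_minus)

lemma act_sum:
  assumes "\<And>i. i \<in> I \<Longrightarrow> f i \<in> comps P n" "s permutes {1..n}"
  shows "act P n (sum f I) s = (\<Sum>i\<in>I. act P n (f i) s)"
  using assms
proof (induction I rule: infinite_finite_induct)
  case (insert i I)
  then show ?case by (simp add: act_add subspace_sum[OF subspace_comps])
qed (simp_all add: act_zero)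

lemma pcomp_zero_left: "\<lbrakk>y \<in> comps P n; 1 \<le> i; i \<le> m\<rbrakk> \<Longrightarrow> pcomp P m n i 0 y = 0"
  using pcomp_scl_left[of 0 m y n i 0] subspace_0[OF subspace_comps] by simp

lemma pcomp_zero_right: "\<lbrakk>x \<in> comps P m; 1 \<le> i; i \<le> m\<rbrakk> \<Longrightarrow> pcomp P m n i x 0 = 0"
  using pcomp_scl_right[of x m 0 n i 0] subspace_0[OF subspace_comps] by simp

lemma pcomp_diff_right:
  assumes "x \<in> comps P m" "y \<in> comps P n" "z \<in> comps P n" "1 \<le> i" "i \<le> m"
  shows "pcomp P m n i x (y - z) = pcomp P m n i x y - pcomp P m n i x z"
proof -
  have "pcomp P m n i x (- z) = - pcomp P m n i x z"
    using pcomp_scl_right[of x m z n i "-1"] assms by simp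
  then show ?thesis
    using pcomp_add_right[of x m y n "- z" i] assms subspace_neg[OF subspace_comps, of z n] by simp
qed

lemma S_submodule_zero: "S_submodule P zero_coll"
  unfolding S_submodule_def by (auto simp: act_zero subspace_0[OF subspace_comps])

text \<open>Torsion is defined by a generated submodule and the line spanned by \<open>x\<close>; by
  bilinearity everything vanishes once the compositions with \<open>x\<close> itself do.\<close>

lemma left_torsionfreeD:
  assumes "left_torsionfree P" "x \<in> comps P m"
    and ann: "\<And>k p i. \<lbrakk>k \<ge> K; p \<in> comps P k; 1 \<le> i; i \<le> k\<rbrakk> \<Longrightarrow> pcomp P k m i p x = 0"
  shows "x = 0"
proof -
  have "coll_comp P (\<lambda>k. if k \<ge> n then comps P k else {0})
      (\<lambda>k. if k = m then span {x} else {0}) = zero_coll" if "n \<ge> K" for n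
    unfolding coll_comp_def
  proof (rule S_submodule_generated_zero[OF vector_space_axioms S_submodule_zero], rule subsetI, elim CollectE exE conjE)
    fix N z m' n' i p y
    assume z: "z = pcomp P m' n' i p y" and p: "p \<in> (if n \<le> m' then comps P m' else {0})"
      and y: "y \<in> (if n' = m then span {x} else {0})" and i: "1 \<le> i" "i \<le> m'"
    have p': "p \<in> comps P m'" using p subspace_0[OF subspace_comps] by (auto split: if_splits)
    have span: "span {x} \<subseteq> comps P m" using assms(2) by (intro span_minimal subspace_comps) auto
    then have y': "y \<in> comps P n'" using y subspace_0[OF subspace_comps] by (auto split: if_splits)
    have "pcomp P m' n' i p y = 0"
    proof (cases "n' = m \<and> n \<le> m'")
      case True
      then obtain c where "y = scl P c x" using y by (auto simp: span_singleton)
      then show ?thesis using True p' assms(2) i ann[of m' p i] that by (simp add: pcomp_scl_right)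
    next
      case False
      then have "p = 0 \<or> y = 0" using p y by (auto split: if_splits)
      then show ?thesis using p' y' i by (auto simp: pcomp_zero_left pcomp_zero_right)
    qed
    then show "z \<in> {0}" using z by simp
  qed
  then have "x \<in> left_torsion P m"
    unfolding left_torsion_def eventually_sequentially using assms(2) by blast
  then show ?thesis using assms(1) unfolding left_torsionfree_def by auto
qed

end

section \<open>Propagation of a nontrivial alternating action to larger arities\<close>

context reduced_lf_operad
begin

text \<open>The product of two transpositions sharing one letter is a 3-cycle, so this says that
  3-cycles, hence the alternating group, act trivially. It is vacuous for
  \<open>n \<le> 2\<close>.\<close>

definition adjacent_transpositions_agree :: "nat \<Rightarrow> bool" where
  "adjacent_transpositions_agree n \<longleftrightarrow> (\<forall>x\<in>comps P n. \<forall>a\<in>{1..n}. \<forall>b\<in>{1..n}. \<forall>c\<in>{1..n}. distinct [a, b, c] \<longrightarrow>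
     act P n x (transpose a b) = act P n x (transpose b c))"

text \<open>Annihilating \<open>x\<close> passes from small arities to all compositions. Unary
  elements have to be excluded, since the unit never annihilates a nonzero \<open>x\<close>; this is
  what complicates the induction.\<close>

lemma pcomp_zero_of_generators:
  assumes y: "\<And>q i a. \<lbrakk>2 \<le> a; a \<le> g; q \<in> comps P a; 1 \<le> i; i \<le> a\<rbrakk> \<Longrightarrow> pcomp P a N i q x = 0"
    and x: "x \<in> comps P N" "N \<ge> 1"
    and gen: "\<And>n y. (n, y) \<in> G \<Longrightarrow> n \<le> g \<and> y \<in> comps P n"
      "\<And>A. suboperad P A \<Longrightarrow> (\<forall>(n, y)\<in>G. y \<in> A n) \<Longrightarrow> A = comps P"
    and p: "p \<in> comps P k" "k \<ge> 2" "1 \<le> i" "i \<le> k"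
  shows "pcomp P k N i p x = 0"
proof -
  \<comment> \<open>Quantifying over unary \<open>q\<close> makes \<open>A\<close> closed under
    composition: when the inner factor of a composition is unary, it is absorbed into
    \<open>q\<close>.\<close>
  define A where "A n = {p \<in> comps P n. n \<ge> 2 \<longrightarrow> (\<forall>q\<in>comps P 1. \<forall>i\<in>{1..n}. pcomp P n N i p (pcomp P 1 N 1 q x) = 0)}" for n
  have x1: "pcomp P 1 N 1 q x \<in> comps P N" if "q \<in> comps P 1" for q
    using pcomp_closed[OF that x(1), of 1] by simp
  have A: "p \<in> A n \<Longrightarrow> p \<in> comps P n" for p n by (simp add: A_def)
  have AD: "\<lbrakk>p \<in> A n; n \<ge> 2; q \<in> comps P 1; 1 \<le> i; i \<le> n\<rbrakk> \<Longrightarrow> pcomp P n N i p (pcomp P 1 N 1 q x) = 0" for p n q i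
    by (simp add: A_def)
  have "suboperad P A"
    unfolding suboperad_def S_submodule_def
  proof (intro conjI allI ballI impI)
    fix n
    show "subspace (A n)"
      unfolding A_def using subspace_comps[of n]
      by (auto simp: subspace_def pcomp_zero_left pcomp_add_left pcomp_scl_left x1 simp del: One_nat_def)
    show "A n \<subseteq> comps P n" by (auto simp: A_def)
    show "act P n p s \<in> A n" if p: "p \<in> A n" and s: "s permutes {1..n}" for p s
    proof -
      have "pcomp P n N i (act P n p s) (pcomp P 1 N 1 q x) = 0"
        if n: "n \<ge> 2" and q: "q \<in> comps P 1" and i: "i \<in> {1..n}" for q i
      proof -
        obtain b where b: "N = Suc b" using x(2) by (cases N) auto
        have i': "1 \<le> i" "i \<le> n" using i by auto
        have si: "1 \<le> s i" "s i \<le> n" using permutes_in_seg[OF s i] by auto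
        have "outer_perm N i s permutes {1..n + N - 1}"
          using outer_perm_permutes[OF s i', of b] b by simp
        then show ?thesis
          using equivariance_left[OF A[OF p] x1[OF q] i' s] AD[OF p n q si] by (simp add: act_zero)
      qed
      then show ?thesis unfolding A_def using act_closed[OF A[OF p] s] by auto
    qed
  next
    show "unit P \<in> A 1" using unit_closed by (simp add: A_def)
  next
    fix m n i p q
    assume p: "p \<in> A m" and q: "q \<in> A n" and i: "1 \<le> i \<and> i \<le> m"
    have pq: "pcomp P m n i p q \<in> comps P (m + n - 1)"
      using pcomp_closed[OF A[OF p] A[OF q]] i by auto
    show "pcomp P m n i p q \<in> A (m + n - 1)"
    proof (cases "n = 0")
      case True
      then have "q = 0" using A[OF q] reduced by auto
      then have "pcomp P m n i p q = 0" using A[OF p] i by (simp add: pcomp_zero_right)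
      moreover have "0 \<in> A (m + n - 1)"
        using subspace_0[OF subspace_comps] x1 by (auto simp: A_def pcomp_zero_left simp del: One_nat_def)
      ultimately show ?thesis by simp
    next
      case n: False
      have "pcomp P (m + n - 1) N k (pcomp P m n i p q) (pcomp P 1 N 1 r x) = 0"
        if mn: "m + n - 1 \<ge> 2" and r: "r \<in> comps P 1" and k: "1 \<le> k" "k \<le> m + n - 1" for r k
      proof -
        let ?x = "pcomp P 1 N 1 r x"
        consider "k < i" | "i \<le> k" "k < i + n" | "k \<ge> i + n" by linarith
        then show ?thesis
        proof cases
          case 1
          have "pcomp P m N k p ?x = 0" using AD[OF p _ r, of k] 1 i k by auto
          then show ?thesis
            using assoc_parallel[OF A[OF p] x1[OF r] A[OF q] k(1) 1] i A[OF q] k mn x(2) 1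
            by (simp add: pcomp_zero_left)
        next
          case 3
          define k' where "k' = k - n + 1"
          have k': "i < k'" "k' \<le> m" "k' - 1 + n = k" using 3 k n i by (auto simp: k'_def)
          have "pcomp P m N k' p ?x = 0" using AD[OF p _ r, of k'] k' i by auto
          then show ?thesis
            using assoc_parallel[OF A[OF p] A[OF q] x1[OF r] _ k'(1,2)] i A[OF q] k' x(2)
            by (simp add: pcomp_zero_left)
        next
          case 2
          define j where "j = k - (i - 1)"
          have j: "1 \<le> j" "j \<le> n" "i - 1 + j = k" using 2 i by (auto simp: j_def)
          have eq: "pcomp P (m + n - 1) N k (pcomp P m n i p q) ?x = pcomp P m (n + N - 1) i p (pcomp P n N j q ?x)"
            using assoc_sequential[OF A[OF p] A[OF q] x1[OF r] _ _ j(1,2)] i j(3) by auto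
          show ?thesis
          proof (cases "n \<ge> 2")
            case True
            then show ?thesis unfolding eq using AD[OF q True r j(1,2)] A[OF p] i by (simp add: pcomp_zero_right)
          next
            case False
            then have n1: "n = 1" "j = 1" using n j by auto
            have qr: "pcomp P 1 1 1 q r \<in> comps P 1" using pcomp_closed[of q 1 r 1 1] A[OF q] r n1 by simp
            have "pcomp P n N j q ?x = pcomp P 1 N 1 (pcomp P 1 1 1 q r) x"
              using assoc_sequential[of q 1 r 1 x N 1 1] A[OF q] r x(1) n1 by simp
            then show ?thesis unfolding eq using AD[OF p _ qr] i mn n1 by simp
          qed
        qed
      qed
      then show ?thesis unfolding A_def using pq by auto
    qed
  qed
  moreover have "y \<in> A n" if "(n, y) \<in> G" for n y
  proof -
    have n: "n \<le> g" "y \<in> comps P n" using gen(1)[OF that] by auto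
    have "pcomp P n N i y (pcomp P 1 N 1 q x) = 0" if "n \<ge> 2" "q \<in> comps P 1" "1 \<le> i" "i \<le> n" for q i
    proof -
      \<comment> \<open>Here \<open>q\<close> is absorbed into the generator, whose arity does not
        change. This is why annihilation is assumed for whole components up to \<open>g\<close> and
        not only for the generators.\<close>
      have "pcomp P n 1 i y q \<in> comps P n" using pcomp_closed[OF n(2) that(2,3,4)] by simp
      then have "pcomp P n N i (pcomp P n 1 i y q) x = 0" using y[of n] that n by simp
      then show ?thesis using assoc_sequential[OF n(2) that(2) x(1) that(3,4), of 1] that by simp
    qed
    then show ?thesis using n by (auto simp: A_def)
  qed
  ultimately have "A = comps P" by (intro gen(2)) auto
  then have "p \<in> A k" using p by simp
  then have "pcomp P k N i p (pcomp P 1 N 1 (unit P) x) = 0" using AD unit_closed p by blast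
  then show ?thesis using unit_left[OF x(1)] by simp
qed

text \<open>The difference of the two translates of \<open>z\<close> is not torsion, so composing it
  into some element of arity between 2 and \<open>g\<close> leaves it nonzero. By equivariance the
  result is a difference of the same kind in a larger arity.\<close>

lemma next_disagreement:
  assumes tf: "left_torsionfree P"
    and gen: "\<And>n y. (n, y) \<in> G \<Longrightarrow> n \<le> g \<and> y \<in> comps P n"
      "\<And>A. suboperad P A \<Longrightarrow> (\<forall>(n, y)\<in>G. y \<in> A n) \<Longrightarrow> A = comps P"
    and bad: "\<not> adjacent_transpositions_agree N"
  shows "\<exists>N'>N. N' < N + g \<and> \<not> adjacent_transpositions_agree N'"
proof -
  obtain z a b c where z: "z \<in> comps P N" and abc: "a \<in> {1..N}" "b \<in> {1..N}" "c \<in> {1..N}" "distinct [a, b, c]"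
    and ne: "act P N z (transpose a b) \<noteq> act P N z (transpose b c)"
    using bad unfolding adjacent_transpositions_agree_def by blast
  define x where "x = act P N z (transpose a b) - act P N z (transpose b c)"
  have tr: "transpose a b permutes {1..N}" "transpose b c permutes {1..N}"
    using abc by (auto intro!: permutes_swap_id)
  have x: "x \<in> comps P N" "x \<noteq> 0" "N \<ge> 1"
    using ne abc by (auto simp: x_def intro!: subspace_diff[OF subspace_comps] act_closed z tr)
  have "\<exists>m q i. 2 \<le> m \<and> m \<le> g \<and> q \<in> comps P m \<and> 1 \<le> i \<and> i \<le> m \<and> pcomp P m N i q x \<noteq> 0"
  proof (rule ccontr)
    assume "\<not> ?thesis"
    then have ann: "pcomp P a N i q x = 0" if "2 \<le> a" "a \<le> g" "q \<in> comps P a" "1 \<le> i" "i \<le> a" for q i a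
      using that by blast
    have "x = 0"
    proof (rule left_torsionfreeD[OF tf x(1)])
      fix k p i
      assume "2 \<le> k" "p \<in> comps P k" "1 \<le> i" "i \<le> k"
      then show "pcomp P k N i p x = 0"
        using pcomp_zero_of_generators[OF ann x(1,3) gen] by blast
    qed
    then show False using x by simp
  qed
  then obtain m q i where q: "2 \<le> m" "m \<le> g" "q \<in> comps P m" and i: "1 \<le> i" "i \<le> m"
    and nz: "pcomp P m N i q x \<noteq> 0" by blast
  have eq: "pcomp P m N i q (act P N z (transpose r s)) =
      act P (m + N - 1) (pcomp P m N i q z) (transpose (i - 1 + r) (i - 1 + s))"
    if "r \<in> {1..N}" "s \<in> {1..N}" for r s
    using equivariance_right[OF q(3) z i permutes_swap_id[OF that]] inner_perm_transpose[OF that i(1)] by simp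
  have "pcomp P m N i q x = pcomp P m N i q (act P N z (transpose a b)) - pcomp P m N i q (act P N z (transpose b c))"
    unfolding x_def using pcomp_diff_right[OF q(3) act_closed[OF z tr(1)] act_closed[OF z tr(2)] i] .
  then have ne': "act P (m + N - 1) (pcomp P m N i q z) (transpose (i - 1 + a) (i - 1 + b)) \<noteq>
      act P (m + N - 1) (pcomp P m N i q z) (transpose (i - 1 + b) (i - 1 + c))"
    using nz eq[OF abc(1,2)] eq[OF abc(2,3)] by simp
  have "i - 1 + a \<in> {1..m + N - 1}" "i - 1 + b \<in> {1..m + N - 1}" "i - 1 + c \<in> {1..m + N - 1}"
    "distinct [i - 1 + a, i - 1 + b, i - 1 + c]" using abc i by auto
  then have "\<not> adjacent_transpositions_agree (m + N - 1)"
    unfolding adjacent_transpositions_agree_def using ne' pcomp_closed[OF q(3) z i] by blast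
  then show ?thesis using q by (intro exI[of _ "m + N - 1"]) auto
qed

end

section \<open>Alternating groups act trivially\<close>

declare One_nat_def [simp del]

lemma sum_fun_apply: "(\<Sum>i\<in>I. f i) x = (\<Sum>i\<in>I. f i x)"
  by (induction I rule: infinite_finite_induct) auto

lemma conj_transpose:
  assumes "bij f"
  shows "f \<circ> transpose a b \<circ> inv f = transpose (f a) (f b)"
proof -
  have "transpose (f a) (f b) \<circ> f = f \<circ> transpose a b"
    using transpose_comp_eq[OF assms, of "f a" "f b"] bij_is_inj[OF assms] by simp
  then show ?thesis using assms by (metis bij_is_surj comp_assoc comp_id surj_iff)
qed

lemma permutes_triple:
  fixes a b c :: 'a
  assumes "{a, b, c} \<subseteq> S" "{a', b', c'} \<subseteq> S" "distinct [a, b, c]" "distinct [a', b', c']"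
  shows "\<exists>p. p permutes S \<and> p a = a' \<and> p b = b' \<and> p c = c'"
proof -
  define p1 where "p1 = transpose a a'"
  define p2 where "p2 = transpose (p1 b) b'"
  define p3 where "p3 = transpose (p2 (p1 c)) c'"
  have p1: "p1 permutes S" "p1 a = a'" using assms by (auto simp: p1_def intro: permutes_swap_id)
  have ne1: "p1 b \<noteq> a'" "p1 c \<noteq> a'" "p1 b \<noteq> p1 c"
    using assms(3) p1(2) inj_eq[OF permutes_inj[OF p1(1)], of b a] inj_eq[OF permutes_inj[OF p1(1)], of c a]
      inj_eq[OF permutes_inj[OF p1(1)], of b c] by auto
  have p2: "p2 permutes S" "p2 (p1 b) = b'" "p2 a' = a'"
    using assms(1,2,4) ne1 permutes_in_image[OF p1(1)] by (simp_all add: p2_def permutes_swap_id)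
  have ne2: "p2 (p1 c) \<noteq> a'" "p2 (p1 c) \<noteq> b'"
    using ne1 p2(2,3) inj_eq[OF permutes_inj[OF p2(1)], of "p1 c" a']
      inj_eq[OF permutes_inj[OF p2(1)], of "p1 c" "p1 b"] by auto
  have p3: "p3 permutes S" "p3 (p2 (p1 c)) = c'" "p3 a' = a'" "p3 b' = b'"
    using assms(1,2,4) ne2 permutes_in_image[OF p1(1)] permutes_in_image[OF p2(1)]
    by (simp_all add: p3_def permutes_swap_id)
  show ?thesis
    using permutes_compose[OF permutes_compose[OF p1(1) p2(1)] p3(1)] p1 p2 p3
    by (intro exI[of _ "p3 \<circ> (p2 \<circ> p1)"]) auto
qed

context reduced_lf_operad
begin

text \<open>
  A nontrivial linear relation between commuting \<open>3\<close>-cycles with disjoint supports, conjugated by a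
  transposition inside one of the supports, shows that this \<open>3\<close>-cycle acts like its inverse, hence trivially.
\<close>

lemma adjacent_transpositions_agree_if_dim_small:
  assumes small: "(dim (comps P n))\<^sup>2 < n div 3"
  shows "adjacent_transpositions_agree n"
proof -
  let ?V = "comps P n" and ?k = "n div 3"
  let ?p = "\<lambda>i::nat. 3 * i + 1" and ?q = "\<lambda>i::nat. 3 * i + 2" and ?r = "\<lambda>i::nat. 3 * i + 3"
  define cyc where "cyc i = transpose (?p i) (?q i) \<circ> transpose (?q i) (?r i)" for i
  have in_range: "?p i \<in> {1..n}" "?q i \<in> {1..n}" "?r i \<in> {1..n}" if "i < ?k" for i
    using that by auto
  have cyc: "cyc i permutes {1..n}" if "i < ?k" for i
    unfolding cyc_def using in_range[OF that] by (intro permutes_compose permutes_swap_id)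
  obtain B where B: "B \<subseteq> ?V" "independent B" "?V \<subseteq> span B" "card B = dim ?V"
    by (rule basis_exists)
  obtain B' where "finite B'" "?V = span B'" using locally_finite by blast
  then have finB: "finite B" using independent_span_bound[of B' B] B by auto
  \<comment> \<open>An endomorphism of \<open>?V\<close> is encoded by its values on the basis
    \<open>B\<close>, as a function vanishing elsewhere. The matrix units \<open>e b v\<close> with
    \<open>b\<close> and \<open>v\<close> in \<open>B\<close> number at most
    \<open>(dim ?V)\<^sup>2\<close>, so the actions of the \<open>?k\<close> cycles are linearly
    dependent.\<close>
  interpret F: vector_space "\<lambda>c (f :: 'b \<Rightarrow> 'b) x. scl P c (f x)"
    by unfold_locales (auto simp: fun_eq_iff scale_right_distrib scale_left_distrib)
  define e :: "'b \<Rightarrow> 'b \<Rightarrow> 'b \<Rightarrow> 'b" where "e b v = (\<lambda>x. if x = b then v else 0)" for b v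
  have e_span: "e b v \<in> F.span ((\<lambda>(b, v). e b v) ` (B \<times> B))" if "b \<in> B" "v \<in> span B" for b v
    using that(2)
  proof (induction rule: span_induct_alt)
    case base
    have "e b 0 = 0" by (auto simp: e_def fun_eq_iff)
    show ?case unfolding \<open>e b 0 = 0\<close> by (rule F.span_zero)
  next
    case (step c x y)
    have eq: "e b (scl P c x + y) = (\<lambda>z. scl P c (e b x z)) + e b y" by (auto simp: e_def fun_eq_iff)
    have "e b x \<in> F.span ((\<lambda>(b, v). e b v) ` (B \<times> B))"
      using step that(1) by (intro F.span_base) auto
    then show ?case unfolding eq by (intro F.span_add F.span_scale step)
  qed
  define f where "f i = (\<Sum>b\<in>B. e b (act P n b (cyc i)))" for i
  have "f ` {..<?k} \<subseteq> F.span ((\<lambda>(b, v). e b v) ` (B \<times> B))"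
  proof clarify
    fix i assume i: "i < ?k"
    have "act P n b (cyc i) \<in> span B" if "b \<in> B" for b
      using B(1,3) act_closed[OF _ cyc[OF i], of b] that by blast
    then show "f i \<in> F.span ((\<lambda>(b, v). e b v) ` (B \<times> B))"
      unfolding f_def by (intro F.span_sum e_span)
  qed
  moreover have "card ((\<lambda>(b, v). e b v) ` (B \<times> B)) < ?k"
    using card_image_le[of "B \<times> B" "\<lambda>(b, v). e b v"] finB small B(4)
    by (simp add: card_cartesian_product power2_eq_square)
  ultimately obtain c where c: "\<exists>i<?k. c i \<noteq> 0" "(\<Sum>i<?k. (\<lambda>x. scl P (c i) (f i x))) = 0"
    using F.finite_family_dependent[of "(\<lambda>(b, v). e b v) ` (B \<times> B)" f ?k] finB by auto
  have f_eq: "f i b = act P n b (cyc i)" if "b \<in> B" for i b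
    using finB that by (simp add: f_def e_def sum_fun_apply)
  have rel_B: "(\<Sum>i<?k. scl P (c i) (act P n b (cyc i))) = 0" if "b \<in> B" for b
    using fun_cong[OF c(2), of b] by (simp add: sum_fun_apply f_eq[OF that])
  have rel: "v \<in> ?V \<and> (\<Sum>i<?k. scl P (c i) (act P n v (cyc i))) = 0" if "v \<in> span B" for v
    using that
  proof (induction rule: span_induct_alt)
    case base
    show ?case
      by (intro conjI sum.neutral) (simp_all add: act_zero cyc subspace_0[OF subspace_comps])
  next
    case (step a x y)
    have x: "x \<in> ?V" using step B by auto
    have "(\<Sum>i<?k. scl P (c i) (act P n (scl P a x + y) (cyc i))) =
        scl P a (\<Sum>i<?k. scl P (c i) (act P n x (cyc i))) + (\<Sum>i<?k. scl P (c i) (act P n y (cyc i)))"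
      unfolding scale_sum_right sum.distrib[symmetric]
      using x step by (intro sum.cong refl)
        (simp add: act_add act_scl cyc subspace_scale[OF subspace_comps] scale_right_distrib mult.commute)
    then show ?case
      using step x rel_B[OF step(1)] by (simp add: subspace_add[OF subspace_comps] subspace_scale[OF subspace_comps])
  qed
  obtain j where j: "j < ?k" "c j \<noteq> 0" using c by auto
  define s where "s = transpose (?p j) (?q j)"
  have s: "s permutes {1..n}" unfolding s_def using in_range[OF j(1)] by (intro permutes_swap_id)
  have ss: "s \<circ> s = id" by (simp add: s_def)
  have conj_other: "s \<circ> cyc i \<circ> s = cyc i" if "i \<noteq> j" for i
  proof -
    have ne: "?p j \<noteq> ?p i" "?p j \<noteq> ?q i" "?p j \<noteq> ?r i" "?q j \<noteq> ?p i" "?q j \<noteq> ?q i" "?q j \<noteq> ?r i"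
      using that by presburger+
    have "s (transpose (?p i) (?q i) x) = transpose (?p i) (?q i) (s x)"
      "s (transpose (?q i) (?r i) x) = transpose (?q i) (?r i) (s x)" for x
      using fun_cong[OF swap_id_independent[OF ne(1,2,4,5)], of x]
        fun_cong[OF swap_id_independent[OF ne(2,3,5,6)], of x]
      by (simp_all only: s_def o_apply)
    moreover have "s (s x) = x" for x by (simp add: s_def)
    ultimately show ?thesis by (simp add: cyc_def fun_eq_iff)
  qed
  have conj_j: "s \<circ> cyc j \<circ> s = transpose (?q j) (?r j) \<circ> s"
    by (simp add: cyc_def s_def fun_eq_iff)
  have inverse: "act P n v (cyc j) = act P n v (transpose (?q j) (?r j) \<circ> s)" if v: "v \<in> ?V" for v
  proof -
    have vs: "act P n v s \<in> ?V" by (rule act_closed[OF v s])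
    have "0 = act P n (\<Sum>i<?k. scl P (c i) (act P n (act P n v s) (cyc i))) s"
      using rel[of "act P n v s"] vs B(3) s by (simp add: act_zero subset_iff)
    also have "\<dots> = (\<Sum>i<?k. scl P (c i) (act P n v (s \<circ> cyc i \<circ> s)))"
      using v vs s cyc
      by (subst act_sum) (auto simp: act_scl act_comp act_closed permutes_compose
          intro!: subspace_scale[OF subspace_comps] sum.cong)
    also have "\<dots> = (\<Sum>i<?k. scl P (c i) (act P n v (cyc i))
        + (if i = j then scl P (c j) (act P n v (s \<circ> cyc j \<circ> s) - act P n v (cyc j)) else 0))"
      by (intro sum.cong refl) (auto simp: conj_other scale_right_diff_distrib)
    also have "\<dots> = scl P (c j) (act P n v (s \<circ> cyc j \<circ> s) - act P n v (cyc j))"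
      using rel[of v] v B(3) j by (simp add: sum.distrib subset_iff)
    finally show ?thesis using j(2) by (simp add: conj_j)
  qed
  \<comment> \<open>The transposition \<open>?t\<close> is \<open>s \<circ> cyc j\<close>. Replacing
    \<open>cyc j\<close> by its inverse \<open>?t \<circ> s\<close> turns it into the conjugate of
    \<open>?t\<close> by \<open>s\<close>.\<close>
  have agree_j: "act P n v (transpose (?p j) (?r j)) = act P n v (transpose (?q j) (?r j))" if v: "v \<in> ?V" for v
  proof -
    let ?t = "transpose (?q j) (?r j)"
    have t: "?t permutes {1..n}" using in_range[OF j(1)] by (intro permutes_swap_id)
    have "s \<circ> cyc j = ?t" unfolding cyc_def s_def comp_assoc[symmetric] by simp
    then have "act P n v ?t = act P n (act P n v s) (cyc j)"
      using act_comp[OF v s cyc[OF j(1)]] by simp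
    also have "\<dots> = act P n (act P n v s) (?t \<circ> s)" by (rule inverse[OF act_closed[OF v s]])
    also have "\<dots> = act P n v (s \<circ> (?t \<circ> s))" using act_comp[OF v s permutes_compose[OF s t]] by simp
    also have "s \<circ> (?t \<circ> s) = transpose (s (?q j)) (s (?r j))"
      using conj_transpose[of s "?q j" "?r j"] by (simp add: s_def comp_assoc)
    also have "\<dots> = transpose (?p j) (?r j)" by (simp add: s_def)
    finally show ?thesis ..
  qed
  show ?thesis
    unfolding adjacent_transpositions_agree_def
  proof (intro ballI impI)
    fix x a b d
    assume x: "x \<in> ?V" and abd: "a \<in> {1..n}" "b \<in> {1..n}" "d \<in> {1..n}" "distinct [a, b, d]"
    \<comment> \<open>One triple suffices, because any two triples of distinct letters are
      conjugate.\<close>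
    obtain \<pi> where pi: "\<pi> permutes {1..n}" "\<pi> (?p j) = a" "\<pi> (?r j) = b" "\<pi> (?q j) = d"
      using permutes_triple[of "?p j" "?r j" "?q j" "{1..n}" a b d] in_range[OF j(1)] abd by auto
    have conj: "act P n (act P n (act P n x \<pi>) (transpose u v)) (inv \<pi>) = act P n x (transpose (\<pi> u) (\<pi> v))"
      if "u \<in> {1..n}" "v \<in> {1..n}" for u v
      using conj_transpose[OF permutes_bij[OF pi(1)], of u v] x pi(1) permutes_inv[OF pi(1)] permutes_swap_id[OF that]
      by (simp add: act_comp[symmetric] act_closed permutes_compose)
    have "act P n x (transpose a b) = act P n (act P n (act P n x \<pi>) (transpose (?p j) (?r j))) (inv \<pi>)"
      using conj[of "?p j" "?r j"] in_range[OF j(1)] pi by simp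
    also have "\<dots> = act P n (act P n (act P n x \<pi>) (transpose (?q j) (?r j))) (inv \<pi>)"
      using agree_j[OF act_closed[OF x pi(1)]] by simp
    also have "\<dots> = act P n x (transpose d b)"
      using conj[of "?q j" "?r j"] in_range[OF j(1)] pi by simp
    finally show "act P n x (transpose a b) = act P n x (transpose b d)" by (simp add: transpose_commute)
  qed
qed

text \<open>Growth of order at most \<open>n powr (5 / 4)\<close>, written with a fourth and a fifth
  power so that the later estimates stay within the natural numbers.\<close>

lemma GKdim_one_growth:
  assumes "GKdim P = 1"
  shows "\<exists>K. \<forall>n\<ge>K. (\<Sum>i\<le>n. dim (comps P i)) ^ 4 \<le> n ^ 5"
proof -
  define d where "d n = (\<Sum>i\<le>n. dim (comps P i))" for n
  define f where "f n = (if d n = 0 then -\<infinity> else ereal (log (real n) (real (d n))))" for n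
  have "limsup f = 1"
    using assms unfolding GKdim_def f_def d_def Let_def atLeast0AtMost by simp
  then have "\<forall>\<^sub>F n in sequentially. f n < ereal (5 / 4)" by (intro Limsup_lessD) simp
  then obtain K where K: "\<And>n. n \<ge> K \<Longrightarrow> f n < ereal (5 / 4)" unfolding eventually_sequentially by blast
  have "d n ^ 4 \<le> n ^ 5" if n: "n \<ge> max K 2" for n
  proof (cases "d n = 0")
    case False
    then have "log (real n) (real (d n)) < 5 / 4" using K[of n] n by (simp add: f_def)
    then have "real (d n) < real n powr (5 / 4)" using False n by (subst (asm) log_less_iff) auto
    then have "real (d n) ^ 4 \<le> (real n powr (5 / 4)) ^ 4" by (intro power_mono) auto
    also have "\<dots> = real n powr 5" using n by (simp add: powr_power)
    also have "\<dots> = real n ^ 5" using n by (simp add: powr_numeral)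
    finally show ?thesis by (metis of_nat_le_iff of_nat_power)
  qed simp
  then show ?thesis unfolding d_def by blast
qed

text \<open>One bad arity starts a chain \<open>b\<close> of bad arities with gaps below
  \<open>g\<close>, whose member of index \<open>j\<close> has dimension at least of order the
  square root of \<open>j\<close>. The indices from \<open>3 * M\<^sup>2\<close> to
  \<open>6 * M\<^sup>2\<close> then contribute \<open>3 * M ^ 3\<close> dimensions in arities of
  order \<open>M\<^sup>2\<close>, against a bound of order \<open>M powr (5 / 2)\<close>.\<close>

lemma adjacent_transpositions_agree:
  assumes "GKdim P = 1" "left_torsionfree P" "finitely_generated_operad P"
  shows "adjacent_transpositions_agree n"
proof (rule ccontr)
  assume bad: "\<not> ?thesis"
  obtain G where G: "finite G" "\<forall>(n, x)\<in>G. x \<in> comps P n"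
    "\<And>A. suboperad P A \<Longrightarrow> (\<forall>(n, x)\<in>G. x \<in> A n) \<Longrightarrow> A = comps P"
    using assms(3) unfolding finitely_generated_operad_def by blast
  define g where "g = Max (insert 1 (fst ` G))"
  have g: "m \<le> g" if "(m, y) \<in> G" for m y
    unfolding g_def using that G(1) by (intro Max_ge) force+
  define nxt where "nxt N = (SOME N'. N' > N \<and> N' < N + g \<and> \<not> adjacent_transpositions_agree N')" for N
  have nxt: "nxt N > N \<and> nxt N < N + g \<and> \<not> adjacent_transpositions_agree (nxt N)"
    if "\<not> adjacent_transpositions_agree N" for N
    unfolding nxt_def
  proof (rule someI_ex)
    show "\<exists>N'>N. N' < N + g \<and> \<not> adjacent_transpositions_agree N'"
    proof (rule next_disagreement[OF assms(2) _ _ that])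
      show "m \<le> g \<and> y \<in> comps P m" if "(m, y) \<in> G" for m y using g[OF that] G(2) that by auto
      show "A = comps P" if "suboperad P A" "\<forall>(m, y)\<in>G. y \<in> A m" for A using G(3) that .
    qed
  qed
  define b where "b j = (nxt ^^ j) n" for j
  have b: "\<not> adjacent_transpositions_agree (b j) \<and> j \<le> b j \<and> b j \<le> n + g * j" for j
  proof (induction j)
    case 0
    then show ?case using bad by (simp add: b_def)
  next
    case (Suc j)
    have "b (Suc j) = nxt (b j)" by (simp add: b_def)
    then show ?case using nxt[of "b j"] Suc by simp
  qed
  have mono: "strict_mono b"
    unfolding strict_mono_Suc_iff using nxt b by (simp add: b_def)
  have dim_b: "M \<le> dim (comps P (b j))" if "3 * M\<^sup>2 \<le> j" for M j
  proof -
    have "M\<^sup>2 \<le> b j div 3" using that b[of j] by linarith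
    also have "\<dots> \<le> (dim (comps P (b j)))\<^sup>2"
      using adjacent_transpositions_agree_if_dim_small[of "b j"] b[of j] by linarith
    finally show ?thesis by (rule power2_le_imp_le) simp
  qed
  obtain K where K: "\<And>m. m \<ge> K \<Longrightarrow> (\<Sum>i\<le>m. dim (comps P i)) ^ 4 \<le> m ^ 5"
    using GKdim_one_growth[OF assms(1)] by blast
  \<comment> \<open>Dominates the start \<open>n\<close> and the threshold \<open>K\<close>, and
    exceeds \<open>(1 + 6 * g) ^ 5\<close>, which contradicts the inequality left after cancelling
    \<open>M ^ 10\<close>.\<close>
  define M where "M = n + K + (1 + 6 * g) ^ 5 + 1"
  define m where "m = n + g * (6 * M\<^sup>2) + M\<^sup>2"
  have MM: "M \<le> M\<^sup>2" by (simp add: power2_eq_square)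
  have "3 * M\<^sup>2 * M = (\<Sum>j\<in>{3 * M\<^sup>2..<6 * M\<^sup>2}. M)" by simp
  also have "\<dots> \<le> (\<Sum>j\<in>{3 * M\<^sup>2..<6 * M\<^sup>2}. dim (comps P (b j)))" by (intro sum_mono dim_b) simp
  also have "\<dots> = (\<Sum>i\<in>b ` {3 * M\<^sup>2..<6 * M\<^sup>2}. dim (comps P i))"
    using strict_mono_imp_inj_on[OF mono] by (subst sum.reindex) (auto intro: inj_on_subset)
  also have "\<dots> \<le> (\<Sum>i\<le>m. dim (comps P i))"
  proof (intro sum_mono2)
    show "b ` {3 * M\<^sup>2..<6 * M\<^sup>2} \<subseteq> {..m}"
    proof clarsimp
      fix j assume "j < 6 * M\<^sup>2"
      then have "g * j \<le> g * (6 * M\<^sup>2)" by (intro mult_left_mono) auto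
      then show "b j \<le> m" using b[of j] unfolding m_def by linarith
    qed
  qed auto
  finally have "(3 * M\<^sup>2 * M) ^ 4 \<le> (\<Sum>i\<le>m. dim (comps P i)) ^ 4" by (rule power_mono) simp
  also have "\<dots> \<le> m ^ 5" using MM by (intro K) (simp add: m_def M_def)
  also have "\<dots> \<le> ((2 + 6 * g) * M\<^sup>2) ^ 5"
    using MM by (intro power_mono) (auto simp: m_def M_def algebra_simps)
  also have "\<dots> = (2 + 6 * g) ^ 5 * M ^ 10" unfolding power_mult_distrib by (simp flip: power_mult)
  also have "(3 * M\<^sup>2 * M) ^ 4 = 81 * M\<^sup>2 * M ^ 10"
  proof -
    have "3 * M\<^sup>2 * M = 3 * M ^ 3" by (simp add: power2_eq_square power3_eq_cube)
    then have "(3 * M\<^sup>2 * M) ^ 4 = 81 * M ^ 12" by (simp add: power_mult_distrib flip: power_mult)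
    also have "M ^ 12 = M\<^sup>2 * M ^ 10" by (simp flip: power_add)
    finally show ?thesis by simp
  qed
  finally have "81 * M\<^sup>2 * M ^ 10 \<le> (2 + 6 * g) ^ 5 * M ^ 10" .
  moreover have "M > 0" by (simp add: M_def)
  ultimately have "81 * M ^ 2 \<le> (2 + 6 * g) ^ 5" by simp
  also have "\<dots> \<le> (2 * (1 + 6 * g)) ^ 5" by (intro power_mono) auto
  also have "\<dots> = 32 * (1 + 6 * g) ^ 5" unfolding power_mult_distrib by simp
  also have "\<dots> < 81 * M" by (simp add: M_def)
  finally show False using MM by simp
qed

end

section \<open>The graded algebra of an operad\<close>

locale sign_operad = reduced_lf_operad +
  assumes torsionfree: "left_torsionfree P"
    and agree: "adjacent_transpositions_agree n"
begin

text \<open>Elements are graded by arity minus one, so that degrees add under composition.\<close>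

abbreviation deg :: "nat \<Rightarrow> 'b set" where
  "deg d \<equiv> comps P (Suc d)"

abbreviation pc :: "nat \<Rightarrow> nat \<Rightarrow> nat \<Rightarrow> 'b \<Rightarrow> 'b \<Rightarrow> 'b" where
  "pc a b \<equiv> pcomp P (Suc a) (Suc b)"

definition mul :: "nat \<Rightarrow> nat \<Rightarrow> 'b \<Rightarrow> 'b \<Rightarrow> 'b" where
  "mul a b = pc a b 1"

text \<open>The common action of all transpositions. In degree 0 there are none and the identity is
  a default, so the rules for moving \<open>twist\<close> through a product require a positive
  degree.\<close>

definition twist :: "nat \<Rightarrow> 'b \<Rightarrow> 'b" where
  "twist d x = (if d = 0 then x else act P (Suc d) x (transpose 1 2))"

lemma act_transpose:
  assumes "x \<in> deg d" "a \<in> {1..Suc d}" "b \<in> {1..Suc d}" "a \<noteq> b"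
  shows "act P (Suc d) x (transpose a b) = twist d x"
proof -
  have ag: "act P (Suc d) x (transpose u v) = act P (Suc d) x (transpose v w)"
    if "u \<in> {1..Suc d}" "v \<in> {1..Suc d}" "w \<in> {1..Suc d}" "distinct [u, v, w]" for u v w
    using agree[of "Suc d"] assms(1) that unfolding adjacent_transpositions_agree_def by blast
  have d: "d \<noteq> 0" using assms by auto
  have one: "act P (Suc d) x (transpose 1 v) = twist d x" if "v \<in> {1..Suc d}" "v \<noteq> 1" for v
    using ag[of 2 1 v] that d by (cases "v = 2") (auto simp: twist_def transpose_commute)
  show ?thesis
  proof (cases "a = 1 \<or> b = 1")
    case True
    then show ?thesis using one[of a] one[of b] assms by (auto simp: transpose_commute)
  next
    case False
    then show ?thesis using ag[of a b 1] one[of b] assms by (auto simp: transpose_commute)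
  qed
qed

lemma transpose_12_permutes: "d \<noteq> 0 \<Longrightarrow> transpose 1 2 permutes {1..Suc d}"
  by (rule permutes_swap_id) auto

lemma twist_closed: "x \<in> deg d \<Longrightarrow> twist d x \<in> deg d"
  by (cases "d = 0") (simp_all add: twist_def act_closed transpose_12_permutes)

lemma twist_twist: "x \<in> deg d \<Longrightarrow> twist d (twist d x) = x"
  by (simp add: twist_def transpose_12_permutes act_comp[symmetric] act_id)

lemma act_eq_twist:
  assumes "s permutes {1..Suc d}" "x \<in> deg d"
  shows "act P (Suc d) x s = (if sign s = 1 then x else twist d x)"
  using assms(1) finite_atLeastAtMost[of 1 "Suc d"] assms(2)
proof (induction s arbitrary: x rule: permutes_induct)
  case id
  show ?case unfolding act_id[OF id] by simp
next
  case (swap a b p)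
  have t: "transpose a b permutes {1..Suc d}" using swap by (intro permutes_swap_id)
  have p: "permutation p" using swap by (intro permutes_imp_permutation[of "{1..Suc d}"]) auto
  have sgn: "sign (transpose a b \<circ> p) = - sign p"
    using swap p by (simp add: sign_compose permutation_swap_id sign_swap_id)
  have act: "act P (Suc d) x (transpose a b \<circ> p) = act P (Suc d) (twist d x) p"
    using act_comp[OF swap.prems t swap.hyps(4)] act_transpose[OF swap.prems swap.hyps(1-3)] by simp
  have "sign p = 1 \<or> sign p = - 1" by (cases p rule: sign_cases) auto
  then show ?case
    unfolding sgn act using swap.IH[OF twist_closed[OF swap.prems]] twist_twist[OF swap.prems] by (elim disjE) simp_all
qed

lemma pc_closed: "\<lbrakk>x \<in> deg a; y \<in> deg b; 1 \<le> i; i \<le> Suc a\<rbrakk> \<Longrightarrow> pc a b i x y \<in> deg (a + b)"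
  using pcomp_closed[of x "Suc a" y "Suc b" i] by simp

lemma mul_closed: "\<lbrakk>x \<in> deg a; y \<in> deg b\<rbrakk> \<Longrightarrow> mul a b x y \<in> deg (a + b)"
  unfolding mul_def by (rule pc_closed) auto

lemma mul_add_left: "\<lbrakk>x \<in> deg a; x' \<in> deg a; y \<in> deg b\<rbrakk> \<Longrightarrow> mul a b (x + x') y = mul a b x y + mul a b x' y"
  by (simp add: mul_def pcomp_add_left)

lemma mul_add_right: "\<lbrakk>x \<in> deg a; y \<in> deg b; y' \<in> deg b\<rbrakk> \<Longrightarrow> mul a b x (y + y') = mul a b x y + mul a b x y'"
  by (simp add: mul_def pcomp_add_right)

lemma mul_scl_left: "\<lbrakk>x \<in> deg a; y \<in> deg b\<rbrakk> \<Longrightarrow> mul a b (scl P c x) y = scl P c (mul a b x y)"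
  by (simp add: mul_def pcomp_scl_left)

lemma mul_scl_right: "\<lbrakk>x \<in> deg a; y \<in> deg b\<rbrakk> \<Longrightarrow> mul a b x (scl P c y) = scl P c (mul a b x y)"
  by (simp add: mul_def pcomp_scl_right)

lemma mul_diff_right: "\<lbrakk>x \<in> deg a; y \<in> deg b; y' \<in> deg b\<rbrakk> \<Longrightarrow> mul a b x (y - y') = mul a b x y - mul a b x y'"
  by (simp add: mul_def pcomp_diff_right)

lemma mul_zero_left: "y \<in> deg b \<Longrightarrow> mul a b 0 y = 0"
  by (simp add: mul_def pcomp_zero_left)

lemma mul_zero_right: "x \<in> deg a \<Longrightarrow> mul a b x 0 = 0"
  by (simp add: mul_def pcomp_zero_right)

lemma mul_unit_left: "x \<in> deg a \<Longrightarrow> mul 0 a (unit P) x = x"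
  using unit_left[of x "Suc a"] by (simp add: mul_def flip: One_nat_def)

lemma unit_deg: "unit P \<in> deg 0"
  using unit_closed by (simp add: One_nat_def)

text \<open>Multiplying by \<open>p\<close> raises the degree of \<open>x\<close> without disturbing
  the composition at \<open>i\<close>. This reduces statements about small arities to large
  ones.\<close>

lemma mul_pc:
  assumes "p \<in> deg k" "x \<in> deg a" "y \<in> deg b" "1 \<le> i" "i \<le> Suc a"
  shows "mul k (a + b) p (pc a b i x y) = pc (k + a) b i (mul k a p x) y"
  using assoc_sequential[OF assms(1-3) _ _ assms(4,5), of 1] by (simp add: mul_def)

lemma mul_assoc:
  assumes "x \<in> deg a" "y \<in> deg b" "z \<in> deg c"
  shows "mul (a + b) c (mul a b x y) z = mul a (b + c) x (mul b c y z)"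
  using mul_pc[OF assms, of 1] by (simp add: mul_def)

lemma act_eq_zero:
  assumes "x \<in> comps P n" "s permutes {1..n}" "act P n x s = 0"
  shows "x = 0"
proof -
  have "x = act P n (act P n x s) (inv s)"
    using act_comp[OF assms(1,2) permutes_inv[OF assms(2)]] permutes_inv_o(1)[OF assms(2)]
    by (simp add: act_id assms(1))
  then show ?thesis using assms(2,3) act_zero permutes_inv by metis
qed

text \<open>Torsion involves all positions, but equivariance moves each of them to the first one at
  the price of permuting the inputs of \<open>p\<close>.\<close>

lemma left_cancel_zero:
  assumes x: "x \<in> deg d" and ann: "\<And>k p. \<lbrakk>k \<ge> K; p \<in> deg k\<rbrakk> \<Longrightarrow> mul k d p x = 0"
  shows "x = 0"
proof (rule left_torsionfreeD[OF torsionfree x])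
  fix k p i
  assume k: "Suc K \<le> k" and p: "p \<in> comps P k" and i: "1 \<le> i" "i \<le> k"
  obtain k' where k': "k = Suc k'" using k by (cases k) auto
  let ?s = "transpose 1 i"
  have s: "?s permutes {1..k}" by (rule permutes_swap_id) (use i in auto)
  have "mul k' d (act P k p ?s) x = 0" using ann[of k' "act P k p ?s"] act_closed[OF p s] k k' by simp
  then have "act P (k + Suc d - 1) (pcomp P k (Suc d) i p x) (outer_perm (Suc d) 1 ?s) = 0"
    using equivariance_left[OF p x _ _ s, of 1] k' by (simp add: mul_def)
  moreover have "outer_perm (Suc d) 1 ?s permutes {1..k + Suc d - 1}"
    using outer_perm_permutes[OF s, of 1 d] k' by simp
  ultimately show "pcomp P k (Suc d) i p x = 0"
    using act_eq_zero pcomp_closed[OF p x i] by blast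
qed

lemma left_cancel:
  assumes "x \<in> deg d" "y \<in> deg d" "\<And>k p. \<lbrakk>k \<ge> K; p \<in> deg k\<rbrakk> \<Longrightarrow> mul k d p x = mul k d p y"
  shows "x = y"
  using left_cancel_zero[of "x - y" d K] assms by (simp add: mul_diff_right subspace_diff[OF subspace_comps])

lemma pc_twist_right:
  assumes "x \<in> deg a" "y \<in> deg b" "1 \<le> i" "i \<le> Suc a" "b \<ge> 1"
  shows "pc a b i x (twist b y) = twist (a + b) (pc a b i x y)"
proof -
  let ?t = "transpose 1 (2 :: nat)"
  have t: "?t permutes {1..Suc b}" using assms by (intro transpose_12_permutes) auto
  have "pc a b i x (twist b y) = act P (Suc (a + b)) (pc a b i x y) (inner_perm (Suc b) i ?t)"
    using equivariance_right[OF assms(1-4) t] assms(5) by (simp add: twist_def)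
  moreover have "inner_perm (Suc b) i ?t permutes {1..Suc (a + b)}" "sign (inner_perm (Suc b) i ?t) = - 1"
    using inner_perm_permutes[OF t assms(3,4)] sign_inner_perm[OF t assms(3,4)] by (simp_all add: sign_swap_id)
  ultimately show ?thesis using act_eq_twist pc_closed[OF assms(1-4)] by simp
qed

lemma pc_act_left:
  assumes "x \<in> deg a" "y \<in> deg b" "1 \<le> i" "i \<le> Suc a" "s permutes {1..Suc a}"
  shows "pc a b i (act P (Suc a) x s) y =
    (if sign s * (- 1) ^ (b * (i + s i)) = 1 then pc a b (s i) x y else twist (a + b) (pc a b (s i) x y))"
proof -
  have si: "1 \<le> s i" "s i \<le> Suc a" using permutes_in_seg[OF assms(5), of i] assms by auto
  have "outer_perm (Suc b) i s permutes {1..Suc (a + b)}"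
    using outer_perm_permutes[OF assms(5,3,4), of b] by simp
  then have "act P (Suc (a + b)) (pc a b (s i) x y) (outer_perm (Suc b) i s) =
      (if sign s * (- 1) ^ (b * (i + s i)) = 1 then pc a b (s i) x y else twist (a + b) (pc a b (s i) x y))"
    using act_eq_twist pc_closed[OF assms(1,2) si] sign_outer_perm[OF assms(5,3,4), of b] by simp
  then show ?thesis
    using equivariance_left[OF assms(1-5)] by simp
qed

text \<open>If \<open>x\<close> has at least three inputs, a transposition of two inputs other than
  \<open>i\<close> fixes \<open>i\<close>, and its block permutation is again odd. A binary
  \<open>x\<close> has no such pair; it is first multiplied by elements of large degree, which are
  cancelled afterwards.\<close>

lemma pc_twist_left:
  assumes "x \<in> deg a" "y \<in> deg b" "1 \<le> i" "i \<le> Suc a" "a \<ge> 1"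
  shows "pc a b i (twist a x) y = twist (a + b) (pc a b i x y)"
proof -
  have big: "pc a b i (twist a x) y = twist (a + b) (pc a b i x y)"
    if "x \<in> deg a" "1 \<le> i" "i \<le> Suc a" "a \<ge> 2" for a i x
  proof -
    have "1 \<in> {1..Suc a}" "2 \<in> {1..Suc a}" "3 \<in> {1..Suc a}" using that by auto
    moreover have ne: "(1::nat) \<noteq> 2" "(1::nat) \<noteq> 3" "(2::nat) \<noteq> 3" by auto
    ultimately have "\<exists>u\<in>{1..Suc a}. \<exists>v\<in>{1..Suc a}. u \<noteq> v \<and> u \<noteq> i \<and> v \<noteq> i"
      using ne by metis
    then obtain u v where uv: "u \<in> {1..Suc a}" "v \<in> {1..Suc a}" "u \<noteq> v" "u \<noteq> i" "v \<noteq> i"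
      by blast
    let ?s = "transpose u v"
    have s: "?s permutes {1..Suc a}" using uv by (intro permutes_swap_id)
    show ?thesis
      using pc_act_left[OF that(1) assms(2) that(2,3) s] act_transpose[OF that(1) uv(1-3)] uv
      by (simp add: sign_swap_id)
  qed
  show ?thesis
  proof (rule left_cancel[where K = 2])
    show "pc a b i (twist a x) y \<in> deg (a + b)" "twist (a + b) (pc a b i x y) \<in> deg (a + b)"
      using assms by (auto intro!: pc_closed twist_closed)
    fix k p assume k: "2 \<le> k" and p: "p \<in> deg k"
    have px: "mul k a p x \<in> deg (k + a)" using p assms by (intro mul_closed)
    have "mul k (a + b) p (pc a b i (twist a x) y) = pc (k + a) b i (mul k a p (twist a x)) y"
      using p assms by (intro mul_pc twist_closed)
    also have "mul k a p (twist a x) = twist (k + a) (mul k a p x)"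
      unfolding mul_def using p assms by (intro pc_twist_right) auto
    also have "pc (k + a) b i \<dots> y = twist (k + a + b) (pc (k + a) b i (mul k a p x) y)"
      using px assms k by (intro big) auto
    also have "pc (k + a) b i (mul k a p x) y = mul k (a + b) p (pc a b i x y)"
      using p assms by (simp add: mul_pc)
    also have "twist (k + a + b) \<dots> = mul k (a + b) p (twist (a + b) (pc a b i x y))"
      unfolding mul_def using p assms by (subst pc_twist_right) (auto intro!: pc_closed simp: add.assoc)
    finally show "mul k (a + b) p (pc a b i (twist a x) y) = mul k (a + b) p (twist (a + b) (pc a b i x y))" .
  qed
qed

lemma twist_inj: "\<lbrakk>twist d x = twist d y; x \<in> deg d; y \<in> deg d\<rbrakk> \<Longrightarrow> x = y"
  by (metis twist_twist)

text \<open>The transposition of inputs 1 and \<open>i\<close> moves the composition to position 1.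
  Its own sign is absorbed by \<open>pc_twist_left\<close>, and moving the block leaves the factor
  \<open>(-1) ^ (b * (i + 1))\<close>. The case of large degree is again transferred to all degrees
  by cancellation.\<close>

lemma pc_eq_mul_twist:
  assumes "x \<in> deg a" "y \<in> deg b" "1 \<le> i" "i \<le> Suc a"
  shows "pc a b i x y = (if even (b * (i + 1)) then mul a b x y else twist (a + b) (mul a b x y))"
proof -
  have big: "pc a b i x y = (if even (b * (i + 1)) then mul a b x y else twist (a + b) (mul a b x y))"
    if "x \<in> deg a" "1 \<le> i" "i \<le> Suc a" "a \<ge> 2" for a i x
  proof (cases "i = 1")
    case True
    then show ?thesis by (simp add: mul_def)
  next
    case False
    let ?s = "transpose 1 i"
    have s: "?s permutes {1..Suc a}" using that by (intro permutes_swap_id) auto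
    have "twist (a + b) (pc a b 1 x y) = pc a b 1 (act P (Suc a) x ?s) y"
      using pc_twist_left[OF that(1) assms(2), of 1] act_transpose[OF that(1), of 1 i] that False by simp
    also have "\<dots> = (if even (b * (i + 1)) then twist (a + b) (pc a b i x y) else pc a b i x y)"
      using pc_act_left[OF that(1) assms(2) _ _ s, of 1] False that
      by (simp add: sign_swap_id minus_one_power_iff add.commute)
    finally show ?thesis
      using twist_inj[of "a + b" "pc a b 1 x y" "pc a b i x y"] pc_closed[OF that(1) assms(2)] that
      by (auto simp: mul_def split: if_splits)
  qed
  let ?tw = "\<lambda>d z. if even (b * (i + 1)) then z else twist d z"
  have xy: "mul a b x y \<in> deg (a + b)" using assms by (intro mul_closed)
  show ?thesis
  proof (rule left_cancel[where K = 2])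
    show "pc a b i x y \<in> deg (a + b)" "?tw (a + b) (mul a b x y) \<in> deg (a + b)"
      using assms xy by (auto intro!: pc_closed twist_closed)
    fix k p assume k: "2 \<le> k" and p: "p \<in> deg k"
    have px: "mul k a p x \<in> deg (k + a)" using p assms by (intro mul_closed)
    have "mul k (a + b) p (pc a b i x y) = pc (k + a) b i (mul k a p x) y"
      using p assms by (intro mul_pc)
    also have "\<dots> = ?tw (k + a + b) (mul (k + a) b (mul k a p x) y)"
      using px assms k by (intro big) auto
    also have "\<dots> = ?tw (k + (a + b)) (mul k (a + b) p (mul a b x y))"
      using mul_assoc[OF p assms(1,2)] by (simp add: add.assoc)
    also have "\<dots> = mul k (a + b) p (?tw (a + b) (mul a b x y))"
    proof (cases "even (b * (i + 1))")
      case False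
      then have "a + b \<ge> 1" by (cases b) auto
      then show ?thesis using False pc_twist_right[OF p xy, of 1] by (simp add: mul_def)
    qed simp
    finally show "mul k (a + b) p (pc a b i x y) = mul k (a + b) p (?tw (a + b) (mul a b x y))" .
  qed
qed

lemma mul_twist_right:
  "\<lbrakk>x \<in> deg a; y \<in> deg b; b \<ge> 1\<rbrakk> \<Longrightarrow> mul a b x (twist b y) = twist (a + b) (mul a b x y)"
  unfolding mul_def by (rule pc_twist_right) auto

lemma mul_twist_left:
  "\<lbrakk>x \<in> deg a; y \<in> deg b; a \<ge> 1\<rbrakk> \<Longrightarrow> mul a b (twist a x) y = twist (a + b) (mul a b x y)"
  unfolding mul_def by (rule pc_twist_left) auto

text \<open>Parallel associativity: \<open>y\<close> and \<open>z\<close> can be inserted into the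
  first two inputs of \<open>p\<close> in either order. Moving both compositions to position 1
  produces twists that differ by the parity of \<open>b * c\<close>; then \<open>p\<close> is
  cancelled.\<close>

lemma mul_commute_twist:
  assumes y: "y \<in> deg b" and z: "z \<in> deg c"
  shows "mul b c y z = (if odd b \<and> odd c then twist (c + b) (mul c b z y) else mul c b z y)"
proof (rule left_cancel[where K = 2])
  let ?tw = "\<lambda>d u. if odd b \<and> odd c then twist d u else u"
  have zy: "mul c b z y \<in> deg (c + b)" using assms by (intro mul_closed)
  show "mul b c y z \<in> deg (b + c)" using assms by (intro mul_closed)
  show "?tw (c + b) (mul c b z y) \<in> deg (b + c)"
    using twist_closed[OF zy] zy by (simp add: add.commute)
  fix k p assume k: "2 \<le> k" and p: "p \<in> deg k"
  have py: "mul k b p y \<in> deg (k + b)" and pz: "mul k c p z \<in> deg (k + c)"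
    using p assms by (auto intro: mul_closed)
  have pyz: "mul (k + b) c (mul k b p y) z \<in> deg (k + b + c)" "mul (k + c) b (mul k c p z) y \<in> deg (k + c + b)"
    using py pz assms by (auto intro: mul_closed)
  \<comment> \<open>The second input of \<open>p\<close> has number \<open>b + 2\<close> once the
    \<open>b + 1\<close> inputs of \<open>y\<close> replace the first.\<close>
  have "pc (k + b) c (b + 2) (mul k b p y) z = pc (k + c) b 1 (pc k c 2 p z) y"
    using assoc_parallel[OF p y z, of 1 2] k by (simp add: mul_def)
  also have "pc k c 2 p z = (if even c then mul k c p z else twist (k + c) (mul k c p z))"
    using pc_eq_mul_twist[OF p z, of 2] k by simp
  also have "pc (k + c) b 1 \<dots> y = (if even c then mul (k + c) b (mul k c p z) y
      else twist (k + c + b) (mul (k + c) b (mul k c p z) y))"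
    using mul_twist_left[OF pz y] k by (auto simp: mul_def)
  finally have eq: "pc (k + b) c (b + 2) (mul k b p y) z =
      (if even c then mul (k + c) b (mul k c p z) y else twist (k + c + b) (mul (k + c) b (mul k c p z) y))" .
  define D X Y where "D = k + b + c" and "X = mul (k + b) c (mul k b p y) z"
    and "Y = mul (k + c) b (mul k c p z) y"
  have D: "k + c + b = D" by (simp add: D_def)
  have XY: "X \<in> deg D" "Y \<in> deg D" using pyz unfolding D X_def Y_def D_def by auto
  have "pc (k + b) c (b + 2) (mul k b p y) z = (if even (c * (b + 2 + 1)) then X else twist D X)"
    unfolding X_def D_def by (rule pc_eq_mul_twist[OF py z]) (use k in auto)
  then have "(if even (c * (b + 2 + 1)) then X else twist D X) = (if even c then Y else twist D Y)"
    using eq unfolding D Y_def by simp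
  then have "X = ?tw D Y"
    using twist_inj[OF _ XY] by (cases "even c"; cases "even b") auto
  then have "mul (k + b) c (mul k b p y) z = ?tw (k + b + c) (mul (k + c) b (mul k c p z) y)"
    unfolding D_def X_def Y_def .
  then have "mul k (b + c) p (mul b c y z) = ?tw (k + (c + b)) (mul k (c + b) p (mul c b z y))"
    using mul_assoc[OF p y z] mul_assoc[OF p z y] by (simp add: add.assoc add.commute[of b c])
  also have "\<dots> = mul k (c + b) p (?tw (c + b) (mul c b z y))"
    using mul_twist_right[OF p zy] by (cases c) auto
  finally show "mul k (b + c) p (mul b c y z) = mul k (b + c) p (?tw (c + b) (mul c b z y))"
    by (simp add: add.commute)
qed

end

section \<open>Prime ideals\<close>

text \<open>The images of both ideals under the coset representatives are ideals of the quotient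
  operad whose composition is zero, so one of the images vanishes.\<close>

lemma (in operad) prime_ideal_product:
  assumes J: "prime_ideal_operad P J" and I1: "operad_ideal P I1" and I2: "operad_ideal P I2"
    and prod: "\<And>m n i x y. \<lbrakk>x \<in> I1 m; y \<in> I2 n; 1 \<le> i; i \<le> m\<rbrakk> \<Longrightarrow> pcomp P m n i x y \<in> J (m + n - 1)"
  shows "(\<forall>n. I1 n \<subseteq> J n) \<or> (\<forall>n. I2 n \<subseteq> J n)"
proof -
  let ?Q = "quotient_operad P J"
  define r where "r n = coset_rep (scl P) (J n)" for n
  have idJ: "operad_ideal P J" and primeQ: "prime_operad ?Q"
    using J by (auto simp: prime_ideal_operad_def)
  have J_sub: "subspace (J n)" "J n \<subseteq> comps P n" for n
    using idJ by (auto simp: operad_ideal_def S_submodule_def)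
  have J_act: "act P n x s \<in> J n" if "x \<in> J n" "s permutes {1..n}" for n x s
    using idJ that by (auto simp: operad_ideal_def S_submodule_def)
  have J_pcomp: "pcomp P m n i x y \<in> J (m + n - 1)"
    if "x \<in> comps P m" "y \<in> comps P n" "1 \<le> i" "i \<le> m" "x \<in> J m \<or> y \<in> J n" for m n i x y
    using idJ that by (auto simp: operad_ideal_def)
  have r_lin: "Vector_Spaces.linear (scl P) (scl P) (r n)" for n
    unfolding r_def by (rule coset_rep(1)[OF vector_space_axioms J_sub(1)])
  have r_diff: "x - r n x \<in> J n" for n x
    unfolding r_def by (rule coset_rep(2)[OF vector_space_axioms J_sub(1)])
  have r_eq: "r n x = r n y \<longleftrightarrow> x - y \<in> J n" for n x y
    unfolding r_def by (rule coset_rep(3)[OF vector_space_axioms J_sub(1)])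
  have r0: "r n 0 = 0" for n
    using module_hom.zero[OF r_lin[unfolded linear_iff_module_hom]] .
  have r_zero: "r n x = 0 \<longleftrightarrow> x \<in> J n" for n x
    using r_eq[of n x 0] r0 by simp
  have r_closed: "r n x \<in> comps P n" if "x \<in> comps P n" for n x
    using subspace_diff[OF subspace_comps that, of "x - r n x"] r_diff J_sub(2) by auto
  have r_act: "r n (act P n (r n x) s) = r n (act P n x s)" if "x \<in> comps P n" "s permutes {1..n}" for n x s
  proof -
    have "act P n (x - r n x) s \<in> J n" by (rule J_act[OF r_diff that(2)])
    then show ?thesis
      using act_diff[OF that(1) r_closed[OF that(1)] that(2)] by (metis r_eq)
  qed
  have r_pcomp: "r (m + n - 1) (pcomp P m n i (r m x) (r n y)) = r (m + n - 1) (pcomp P m n i x y)"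
    if x: "x \<in> comps P m" and y: "y \<in> comps P n" and i: "1 \<le> i" "i \<le> m" for m n i x y
  proof -
    have rx: "r m x \<in> comps P m" and ry: "r n y \<in> comps P n" using r_closed x y by auto
    have dx: "x - r m x \<in> comps P m" and dy: "y - r n y \<in> comps P n" using r_diff J_sub(2) by auto
    have "pcomp P m n i x y = pcomp P m n i (r m x) y + pcomp P m n i (x - r m x) y"
      using pcomp_add_left[OF rx dx y i] by simp
    moreover have "pcomp P m n i (r m x) (y - r n y) = pcomp P m n i (r m x) y - pcomp P m n i (r m x) (r n y)"
      by (rule pcomp_diff_right[OF rx y ry i])
    ultimately have "pcomp P m n i x y - pcomp P m n i (r m x) (r n y) =
        pcomp P m n i (r m x) (y - r n y) + pcomp P m n i (x - r m x) y" by simp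
    moreover have "pcomp P m n i (r m x) (y - r n y) \<in> J (m + n - 1)"
      "pcomp P m n i (x - r m x) y \<in> J (m + n - 1)"
      using J_pcomp[OF rx dy i] J_pcomp[OF dx y i] r_diff by auto
    ultimately have "pcomp P m n i x y - pcomp P m n i (r m x) (r n y) \<in> J (m + n - 1)"
      by (simp add: subspace_add[OF J_sub(1)])
    then show ?thesis using r_eq by metis
  qed
  have Q: "scl ?Q = scl P" "comps ?Q n = r n ` comps P n" "act ?Q n x s = r n (act P n x s)"
    "pcomp ?Q m n i x y = r (m + n - 1) (pcomp P m n i x y)" for m n i x y s
    by (simp_all add: quotient_operad_def r_def Let_def)
  have image_ideal: "operad_ideal ?Q (\<lambda>n. r n ` I n)" if I: "operad_ideal P I" for I
    unfolding operad_ideal_def S_submodule_def Q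
  proof (intro conjI allI ballI impI)
    have I_sub: "subspace (I n)" "I n \<subseteq> comps P n" for n
      using I by (auto simp: operad_ideal_def S_submodule_def)
    have I_act: "act P n x s \<in> I n" if "x \<in> I n" "s permutes {1..n}" for n x s
      using I that by (auto simp: operad_ideal_def S_submodule_def)
    have I_pcomp: "pcomp P m n i x y \<in> I (m + n - 1)"
      if "x \<in> comps P m" "y \<in> comps P n" "1 \<le> i" "i \<le> m" "x \<in> I m \<or> y \<in> I n" for m n i x y
      using I that by (auto simp: operad_ideal_def)
    fix n
    show "subspace (r n ` I n)"
      by (rule module_hom.subspace_image[OF r_lin[unfolded linear_iff_module_hom] I_sub(1)])
    show "r n ` I n \<subseteq> r n ` comps P n" using I_sub(2) by blast
    show "r n (act P n u s) \<in> r n ` I n" if "u \<in> r n ` I n" "s permutes {1..n}" for u s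
      using that r_act[of _ n s] I_act[of _ n s] I_sub(2) by blast
    fix m i u v
    assume "u \<in> r m ` comps P m" "v \<in> r n ` comps P n" "1 \<le> i \<and> i \<le> m \<and> (u \<in> r m ` I m \<or> v \<in> r n ` I n)"
    then obtain x y where xy: "x \<in> comps P m" "y \<in> comps P n" "u = r m x" "v = r n y" "x \<in> I m \<or> y \<in> I n"
      and i: "1 \<le> i" "i \<le> m"
      using I_sub(2) by blast
    show "r (m + n - 1) (pcomp P m n i u v) \<in> r (m + n - 1) ` I (m + n - 1)"
      using r_pcomp[OF xy(1,2) i] I_pcomp[OF xy(1,2) i xy(5)] xy(3,4) by auto
  qed
  have I_comps: "I1 n \<subseteq> comps P n" "I2 n \<subseteq> comps P n" for n
    using I1 I2 by (auto simp: operad_ideal_def S_submodule_def)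
  have "S_submodule ?Q zero_coll"
    unfolding S_submodule_def Q
    using r0 subspace_0[OF subspace_comps] by (auto simp: act_zero image_iff intro!: bexI[of _ 0])
  moreover have "{pcomp ?Q m n i u v | m n i u v.
      u \<in> r m ` I1 m \<and> v \<in> r n ` I2 n \<and> 1 \<le> i \<and> i \<le> m \<and> N = m + n - 1} \<subseteq> {0}" for N
  proof (rule subsetI, elim CollectE exE conjE)
    fix z m n i u v
    assume z: "z = pcomp ?Q m n i u v" and u: "u \<in> r m ` I1 m" and v: "v \<in> r n ` I2 n" and i: "1 \<le> i" "i \<le> m"
    obtain x y where x: "x \<in> I1 m" "u = r m x" and y: "y \<in> I2 n" "v = r n y" using u v by blast
    have "z = r (m + n - 1) (pcomp P m n i x y)"
      unfolding z Q x y using x y I_comps by (intro r_pcomp i) auto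
    then show "z \<in> {0}" using r_zero prod[OF x(1) y(1) i] by simp
  qed
  ultimately have "coll_comp ?Q (\<lambda>n. r n ` I1 n) (\<lambda>n. r n ` I2 n) = zero_coll"
    unfolding coll_comp_def using vector_space_axioms Q(1)
    by (intro S_submodule_generated_zero) auto
  then have "(\<lambda>n. r n ` I1 n) = zero_coll \<or> (\<lambda>n. r n ` I2 n) = zero_coll"
    using primeQ image_ideal[OF I1] image_ideal[OF I2] unfolding prime_operad_def by blast
  moreover have "I n \<subseteq> J n" if "(\<lambda>n. r n ` I n) = zero_coll" for I n
  proof
    fix x assume "x \<in> I n"
    then have "r n x \<in> {0}" using fun_cong[OF that, of n] by blast
    then show "x \<in> J n" using r_zero by simp
  qed
  ultimately show ?thesis by blast
qed

section \<open>Operad ideals as ideals of the graded algebra\<close>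

context sign_operad
begin

lemma twist_0: "twist 0 x = x"
  by (simp add: twist_def)

definition graded_ideal :: "(nat \<Rightarrow> 'b set) \<Rightarrow> bool" where
  "graded_ideal I \<longleftrightarrow> (\<forall>d. subspace (I d) \<and> I d \<subseteq> deg d \<and> (\<forall>x\<in>I d. twist d x \<in> I d)) \<and>
    (\<forall>a b. \<forall>x\<in>I a. \<forall>y\<in>deg b. mul a b x y \<in> I (a + b) \<and> mul b a y x \<in> I (b + a))"

text \<open>Primeness in the strong sense, for elements instead of ideals. As for
  \<open>prime_ideal_operad\<close>, the improper ideal is included, so properness appears
  separately as \<open>unit P \<notin> I 0\<close>.\<close>

definition graded_prime :: "(nat \<Rightarrow> 'b set) \<Rightarrow> bool" where
  "graded_prime I \<longleftrightarrow> graded_ideal I \<and>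
    (\<forall>a b. \<forall>x\<in>deg a. \<forall>y\<in>deg b. mul a b x y \<in> I (a + b) \<longrightarrow> x \<in> I a \<or> y \<in> I b)"

lemma graded_idealD:
  assumes "graded_ideal I"
  shows "subspace (I d)" "x \<in> I d \<Longrightarrow> x \<in> deg d" "x \<in> I d \<Longrightarrow> twist d x \<in> I d"
    "\<lbrakk>x \<in> I a; y \<in> deg b\<rbrakk> \<Longrightarrow> mul a b x y \<in> I (a + b)"
    "\<lbrakk>x \<in> deg a; y \<in> I b\<rbrakk> \<Longrightarrow> mul a b x y \<in> I (a + b)"
  using assms unfolding graded_ideal_def by blast+

lemma operad_ideal_of_graded_ideal:
  assumes "graded_ideal I"
  shows "operad_ideal P (\<lambda>n. case n of 0 \<Rightarrow> {0} | Suc d \<Rightarrow> I d)"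
  unfolding operad_ideal_def S_submodule_def
proof (intro conjI allI ballI impI)
  let ?I = "\<lambda>n. case n of 0 \<Rightarrow> {0} | Suc d \<Rightarrow> I d"
  note I = graded_idealD[OF assms]
  fix n
  show sub: "subspace (?I n)" for n using I(1) by (cases n) auto
  show "?I n \<subseteq> comps P n" using I(2) reduced by (cases n) auto
  show "act P n x s \<in> ?I n" if x: "x \<in> ?I n" and s: "s permutes {1..n}" for x s
  proof (cases n)
    case 0
    then show ?thesis using x s act_zero[of s 0] by simp
  next
    case (Suc d)
    then show ?thesis using act_eq_twist[of s d x] I(2,3)[of x d] x s by auto
  qed
  fix m i x y
  assume x: "x \<in> comps P m" and y: "y \<in> comps P n" and i: "1 \<le> i \<and> i \<le> m \<and> (x \<in> ?I m \<or> y \<in> ?I n)"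
  show "pcomp P m n i x y \<in> ?I (m + n - 1)"
  proof (cases n)
    case 0
    then have "y = 0" using y reduced by simp
    then have "pcomp P m n i x y = 0" using x i by (simp add: pcomp_zero_right)
    then show ?thesis using subspace_0[OF sub] by simp
  next
    case (Suc b)
    obtain a where a: "m = Suc a" using i by (cases m) auto
    have "mul a b x y \<in> I (a + b)" using i I(4,5) x y Suc a by auto
    then show ?thesis using pc_eq_mul_twist[of x a y b i] I(3) x y i Suc a by auto
  qed
qed

lemma graded_ideal_of_operad_ideal:
  assumes "operad_ideal P J"
  shows "graded_ideal (\<lambda>d. J (Suc d))"
  unfolding graded_ideal_def
proof (intro conjI allI ballI)
  have J: "subspace (J n)" "J n \<subseteq> comps P n" "\<And>x s. x \<in> J n \<Longrightarrow> s permutes {1..n} \<Longrightarrow> act P n x s \<in> J n"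
    "\<And>m i x y. \<lbrakk>x \<in> comps P m; y \<in> comps P n; 1 \<le> i; i \<le> m; x \<in> J m \<or> y \<in> J n\<rbrakk> \<Longrightarrow> pcomp P m n i x y \<in> J (m + n - 1)" for n
    using assms unfolding operad_ideal_def S_submodule_def by blast+
  fix d
  show "subspace (J (Suc d))" "J (Suc d) \<subseteq> deg d" by (rule J)+
  show "twist d x \<in> J (Suc d)" if "x \<in> J (Suc d)" for x
    using J(3)[OF that transpose_12_permutes] that by (cases "d = 0") (auto simp: twist_def)
  fix b x y assume x: "x \<in> J (Suc d)" and y: "y \<in> deg b"
  have xd: "x \<in> deg d" using x J(2) by blast
  show "mul d b x y \<in> J (Suc (d + b))"
    using J(4)[OF xd y, of 1] x by (simp add: mul_def)
  show "mul b d y x \<in> J (Suc (b + d))"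
    using J(4)[OF y xd, of 1] x by (simp add: mul_def)
qed

lemma mul_mem_ideal_commute:
  assumes "graded_ideal I" "y \<in> deg b" "z \<in> deg c" "mul c b z y \<in> I (c + b)"
  shows "mul b c y z \<in> I (b + c)"
proof -
  have "(if odd b \<and> odd c then twist (c + b) (mul c b z y) else mul c b z y) \<in> I (c + b)"
    using assms(4) graded_idealD(3)[OF assms(1)] by auto
  then show ?thesis using mul_commute_twist[OF assms(2,3)] by (simp add: add.commute)
qed

lemma subspace_left_factor:
  assumes "graded_ideal I" "y \<in> deg b"
  shows "subspace {x \<in> deg a. mul a b x y \<in> I (a + b)}"
  unfolding subspace_def
  using graded_idealD(1)[OF assms(1), of "a + b"] assms(2) subspace_comps[of "Suc a"]
  by (auto simp: mul_zero_left mul_add_left mul_scl_left subspace_def)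

lemma subspace_right_factor:
  assumes "graded_ideal I" "x \<in> deg a"
  shows "subspace {y \<in> deg b. mul a b x y \<in> I (a + b)}"
  unfolding subspace_def
  using graded_idealD(1)[OF assms(1), of "a + b"] assms(2) subspace_comps[of "Suc b"]
  by (auto simp: mul_zero_right mul_add_right mul_scl_right subspace_def)

text \<open>The colon ideal of \<open>I\<close> by \<open>y\<close>. It is two-sided because the
  product is commutative up to \<open>twist\<close>, under which ideals are stable.\<close>

lemma graded_ideal_quotient:
  assumes I: "graded_ideal I" and y: "y \<in> deg b"
  shows "graded_ideal (\<lambda>a. {x \<in> deg a. mul a b x y \<in> I (a + b)})"
  unfolding graded_ideal_def
proof (intro conjI allI ballI)
  note ID = graded_idealD[OF I]
  fix d
  show "subspace {x \<in> deg d. mul d b x y \<in> I (d + b)}" by (rule subspace_left_factor[OF assms])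
  show "{x \<in> deg d. mul d b x y \<in> I (d + b)} \<subseteq> deg d" by blast
  show "twist d x \<in> {x \<in> deg d. mul d b x y \<in> I (d + b)}" if "x \<in> {x \<in> deg d. mul d b x y \<in> I (d + b)}" for x
    using that mul_twist_left[OF _ y, of x d] ID(3) twist_closed[of x d] by (cases "d = 0") (auto simp: twist_0)
  fix c x z assume x: "x \<in> {x \<in> deg d. mul d b x y \<in> I (d + b)}" and z: "z \<in> deg c"
  then have xd: "x \<in> deg d" and xy: "mul d b x y \<in> I (d + b)" by auto
  have "mul (b + d) c (mul b d y x) z \<in> I (b + d + c)"
    by (rule ID(4)[OF mul_mem_ideal_commute[OF I y xd xy] z])
  then have "mul (d + c) b (mul d c x z) y \<in> I (d + c + b)"
    using mul_mem_ideal_commute[OF I mul_closed[OF xd z] y] mul_assoc[OF y xd z] by (simp add: add.assoc)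
  then show "mul d c x z \<in> {x \<in> deg (d + c). mul (d + c) b x y \<in> I (d + c + b)}"
    using mul_closed[OF xd z] by blast
  have "mul c (d + b) z (mul d b x y) \<in> I (c + (d + b))" by (rule ID(5)[OF z xy])
  then show "mul c d z x \<in> {x \<in> deg (c + d). mul (c + d) b x y \<in> I (c + d + b)}"
    using mul_closed[OF z xd] mul_assoc[OF z xd y] by (simp add: add.assoc)
qed

lemma graded_ideal_right_annihilator:
  assumes I: "graded_ideal I" and K: "graded_ideal K"
  shows "graded_ideal (\<lambda>b. {y \<in> deg b. \<forall>a. \<forall>x\<in>K a. mul a b x y \<in> I (a + b)})"
  unfolding graded_ideal_def
proof (intro conjI allI ballI)
  let ?L = "\<lambda>b. {y \<in> deg b. \<forall>a. \<forall>x\<in>K a. mul a b x y \<in> I (a + b)}"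
  note ID = graded_idealD[OF I] and KD = graded_idealD[OF K]
  fix d
  have "?L d = \<Inter> (insert (deg d) {{y \<in> deg d. mul a d x y \<in> I (a + d)} | a x. x \<in> K a})" by blast
  also have "subspace \<dots>"
    using subspace_right_factor[OF I KD(2)] subspace_comps by (intro subspace_Inter) auto
  finally show "subspace (?L d)" .
  show "?L d \<subseteq> deg d" by blast
  show "twist d y \<in> ?L d" if "y \<in> ?L d" for y
    using that mul_twist_right[of _ _ y d] KD(2) ID(3) twist_closed[of y d]
    by (cases "d = 0") (auto simp: twist_0)
  fix c y z assume "y \<in> ?L d" and z: "z \<in> deg c"
  then have y: "y \<in> deg d" and Ky: "\<And>a x. x \<in> K a \<Longrightarrow> mul a d x y \<in> I (a + d)" by auto
  have "mul a (d + c) x (mul d c y z) \<in> I (a + (d + c))" if x: "x \<in> K a" for a x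
    using ID(4)[OF Ky[OF x] z] mul_assoc[OF KD(2)[OF x] y z] by (simp add: add.assoc)
  then show "mul d c y z \<in> ?L (d + c)" using mul_closed[OF y z] by blast
  have "mul a (c + d) x (mul c d z y) \<in> I (a + (c + d))" if x: "x \<in> K a" for a x
    using Ky[OF KD(4)[OF x z]] mul_assoc[OF KD(2)[OF x] z y] by (simp add: add.assoc)
  then show "mul c d z y \<in> ?L (c + d)" using mul_closed[OF z y] by blast
qed

text \<open>Passage from ideals to elements: \<open>?K\<close> is the colon ideal of
  \<open>J\<close> by \<open>y\<close> and contains \<open>x\<close>, while \<open>?L\<close>
  collects everything that \<open>?K\<close> multiplies into \<open>J\<close> and contains
  \<open>y\<close>. Their composition lies in \<open>J\<close>, so one of them does.\<close>

lemma graded_prime_of_prime_ideal: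
  assumes "prime_ideal_operad P J"
  shows "graded_prime (\<lambda>d. J (Suc d))"
  unfolding graded_prime_def
proof (intro conjI allI ballI impI)
  show id: "graded_ideal (\<lambda>d. J (Suc d))"
    using assms graded_ideal_of_operad_ideal by (simp add: prime_ideal_operad_def)
  fix a b x y
  assume x: "x \<in> deg a" and y: "y \<in> deg b" and xy: "mul a b x y \<in> J (Suc (a + b))"
  let ?K = "\<lambda>d. {x \<in> deg d. mul d b x y \<in> J (Suc (d + b))}"
  let ?L = "\<lambda>d. {y \<in> deg d. \<forall>a. \<forall>x\<in>?K a. mul a d x y \<in> J (Suc (a + d))}"
  have K: "graded_ideal ?K" by (rule graded_ideal_quotient[OF id y])
  have L: "graded_ideal ?L" by (rule graded_ideal_right_annihilator[OF id K])
  let ?lift = "\<lambda>I n. case n of 0 \<Rightarrow> {0} | Suc d \<Rightarrow> I d"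
  have "(\<forall>n. ?lift ?K n \<subseteq> J n) \<or> (\<forall>n. ?lift ?L n \<subseteq> J n)"
  proof (rule prime_ideal_product[OF assms operad_ideal_of_graded_ideal[OF K] operad_ideal_of_graded_ideal[OF L]])
    fix m n i u v
    assume u: "u \<in> ?lift ?K m" and v: "v \<in> ?lift ?L n" and i: "1 \<le> i" "i \<le> m"
    obtain c where c: "m = Suc c" using i by (cases m) auto
    have u': "u \<in> ?K c" using u c by simp
    show "pcomp P m n i u v \<in> J (m + n - 1)"
    proof (cases n)
      case 0
      then have "v = 0" using v by simp
      then have "pcomp P m n i u v = 0" using u' c i by (simp add: pcomp_zero_right)
      moreover have "0 \<in> J (m + n - 1)"
        using assms subspace_0 unfolding prime_ideal_operad_def operad_ideal_def S_submodule_def by blast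
      ultimately show ?thesis by simp
    next
      case (Suc d)
      then have v': "v \<in> ?L d" using v by simp
      have "mul c d u v \<in> J (Suc (c + d))" using u' v' by blast
      then show ?thesis
        using pc_eq_mul_twist[of u c v d i] graded_idealD(3)[OF id] u' v' i Suc c by auto
    qed
  qed
  then show "x \<in> J (Suc a) \<or> y \<in> J (Suc b)"
  proof (elim disjE)
    assume "\<forall>n. ?lift ?K n \<subseteq> J n"
    then have "?lift ?K (Suc a) \<subseteq> J (Suc a)" by (rule spec)
    moreover have "x \<in> ?lift ?K (Suc a)" using x xy by simp
    ultimately show ?thesis by blast
  next
    assume "\<forall>n. ?lift ?L n \<subseteq> J n"
    then have "?lift ?L (Suc b) \<subseteq> J (Suc b)" by (rule spec)
    moreover have "y \<in> ?lift ?L (Suc b)" using y by simp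
    ultimately show ?thesis by blast
  qed
qed

end

section \<open>Removal of the signs by semiprimeness\<close>

locale semiprime_sign_operad = sign_operad +
  assumes semiprime: "semiprime_operad P"
begin

lemma graded_prime_separates:
  assumes "x \<in> deg d" "x \<noteq> 0"
  shows "\<exists>I. graded_prime I \<and> x \<notin> I d"
proof -
  have "\<Inter> {J (Suc d) | J. prime_ideal_operad P J} = {0}"
    using semiprime unfolding semiprime_operad_def by blast
  then obtain J where "prime_ideal_operad P J" "x \<notin> J (Suc d)" using assms by blast
  then show ?thesis using graded_prime_of_prime_ideal by (intro exI[of _ "\<lambda>d. J (Suc d)"]) auto
qed

text \<open>In odd degree the square of \<open>y\<close> equals its own twist, hence
  \<open>y\<close> times \<open>twist b y - y\<close> is 0. A prime containing either factor
  contains the second one, and the primes intersect in 0.\<close>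

lemma twist_odd:
  assumes y: "y \<in> deg b" and b: "odd b"
  shows "twist b y = y"
proof -
  let ?u = "twist b y - y"
  have u: "?u \<in> deg b" using twist_closed[OF y] y by (intro subspace_diff[OF subspace_comps])
  have "mul b b y y = twist (b + b) (mul b b y y)" using mul_commute_twist[OF y y] b by simp
  then have yu: "mul b b y ?u = 0"
    using mul_diff_right[OF y twist_closed[OF y] y] mul_twist_right[OF y y] b by (cases b) auto
  have "?u \<in> I b" if I: "graded_prime I" for I
  proof -
    have id: "graded_ideal I" using I by (simp add: graded_prime_def)
    have "mul b b y ?u \<in> I (b + b)" using yu subspace_0[OF graded_idealD(1)[OF id]] by simp
    then have "y \<in> I b \<or> ?u \<in> I b" using I y u unfolding graded_prime_def by blast
    then show ?thesis using graded_idealD(3)[OF id] subspace_diff[OF graded_idealD(1)[OF id]] by blast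
  qed
  then have "?u = 0" using graded_prime_separates[OF u] by blast
  then show ?thesis by simp
qed

lemma mul_commute:
  assumes "y \<in> deg b" "z \<in> deg c"
  shows "mul b c y z = mul c b z y"
proof (cases "odd b \<and> odd c")
  case True
  then have "b \<ge> 1" by (cases b) auto
  then show ?thesis
    using mul_commute_twist[OF assms] True mul_twist_right[OF assms(2,1)] twist_odd[OF assms(1)] by simp
qed (use mul_commute_twist[OF assms] in auto)

text \<open>The correction in \<open>pc_eq_mul_twist\<close> occurs only for odd \<open>b\<close>;
  there it can be moved onto \<open>y\<close>, where it is trivial.\<close>

lemma pc_eq_mul:
  assumes "x \<in> deg a" "y \<in> deg b" "1 \<le> i" "i \<le> Suc a"
  shows "pc a b i x y = mul a b x y"
proof (cases "even (b * (i + 1))")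
  case False
  then have "odd b" "b \<ge> 1" by (auto elim: oddE)
  then show ?thesis
    using pc_eq_mul_twist[OF assms] mul_twist_right[OF assms(1,2)] twist_odd[OF assms(2)] by auto
qed (use pc_eq_mul_twist[OF assms] in simp)

end

section \<open>Binary forms\<close>

locale gk_one_operad = semiprime_sign_operad P
  for P :: "('k::alg_closed_field, 'a::ab_group_add) operad_data" +
  assumes gk_one: "GKdim P = 1"
    and finitely_generated: "finitely_generated_operad P"
begin

lemma mul_left_commute:
  assumes "x \<in> deg a" "y \<in> deg b" "z \<in> deg c"
  shows "mul a (b + c) x (mul b c y z) = mul b (a + c) y (mul a c x z)"
proof -
  have "mul a (b + c) x (mul b c y z) = mul (a + b) c (mul a b x y) z" by (rule mul_assoc[OF assms, symmetric])
  also have "mul a b x y = mul b a y x" by (rule mul_commute[OF assms(1,2)])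
  also have "mul (a + b) c \<dots> z = mul b (a + c) y (mul a c x z)"
    using mul_assoc[OF assms(2,1,3)] by (simp add: add.commute)
  finally show ?thesis .
qed

lemma mul_swap:
  assumes "x \<in> deg a" "y \<in> deg b" "z \<in> deg c" "u \<in> deg e"
  shows "mul (a + b) (c + e) (mul a b x y) (mul c e z u) = mul (a + c) (b + e) (mul a c x z) (mul b e y u)"
proof -
  have "mul (a + b) (c + e) (mul a b x y) (mul c e z u) = mul a (b + (c + e)) x (mul b (c + e) y (mul c e z u))"
    using assms by (intro mul_assoc mul_closed)
  also have "mul b (c + e) y (mul c e z u) = mul c (b + e) z (mul b e y u)"
    using assms by (intro mul_left_commute)
  also have "mul a (b + (c + e)) x \<dots> = mul a (c + (b + e)) x \<dots>" by (simp add: ac_simps)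
  also have "\<dots> = mul (a + c) (b + e) (mul a c x z) (mul b e y u)"
    using assms by (intro mul_assoc[symmetric] mul_closed)
  finally show ?thesis .
qed

primrec pw :: "nat \<Rightarrow> 'a \<Rightarrow> nat \<Rightarrow> 'a" where
  "pw d x 0 = unit P"
| "pw d x (Suc N) = mul d (N * d) x (pw d x N)"

lemma pw_closed: "x \<in> deg d \<Longrightarrow> pw d x N \<in> deg (N * d)"
proof (induction N)
  case (Suc N)
  then show ?case using mul_closed[of x d "pw d x N" "N * d"] by simp
qed (simp add: unit_deg)

lemma pw_add: "x \<in> deg d \<Longrightarrow> mul (m * d) (n * d) (pw d x m) (pw d x n) = pw d x (m + n)"
proof (induction m)
  case 0
  then show ?case using mul_unit_left[OF pw_closed[of x d n]] by simp
next
  case (Suc m)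
  have "mul (Suc m * d) (n * d) (pw d x (Suc m)) (pw d x n) =
      mul d (m * d + n * d) x (mul (m * d) (n * d) (pw d x m) (pw d x n))"
    using mul_assoc[OF Suc.prems pw_closed[OF Suc.prems] pw_closed[OF Suc.prems], of m n] by simp
  then show ?case using Suc by (simp add: distrib_right)
qed

lemma pw_notin_prime:
  assumes "graded_prime I" "unit P \<notin> I 0" "x \<in> deg d" "x \<notin> I d"
  shows "pw d x N \<notin> I (N * d)"
proof (induction N)
  case (Suc N)
  then show ?case using assms pw_closed[OF assms(3)] unfolding graded_prime_def by fastforce
qed (use assms in simp)

lemma unit_notin_proper_ideal:
  assumes "graded_ideal I" "x \<in> deg d" "x \<notin> I d"
  shows "unit P \<notin> I 0"
  using graded_idealD(4)[OF assms(1), of "unit P" 0 x d] assms mul_unit_left by auto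

text \<open>The binary form with coefficients \<open>c\<close>, evaluated at \<open>(x, y)\<close>: the sum of \<open>c i x\<^sup>i y\<^bsup>N - i\<^esup>\<close>.\<close>

primrec form :: "nat \<Rightarrow> 'a \<Rightarrow> 'a \<Rightarrow> nat \<Rightarrow> (nat \<Rightarrow> 'k) \<Rightarrow> 'a" where
  "form d x y 0 c = scl P (c 0) (unit P)"
| "form d x y (Suc N) c = scl P (c 0) (pw d y (Suc N)) + mul d (N * d) x (form d x y N (\<lambda>i. c (Suc i)))"

context
  fixes d x y
  assumes x: "x \<in> deg d" and y: "y \<in> deg d"
begin

lemma form_closed: "form d x y N c \<in> deg (N * d)"
proof (induction N arbitrary: c)
  case (Suc N)
  have "mul d (N * d) x (form d x y N (\<lambda>i. c (Suc i))) \<in> deg (d + N * d)" by (rule mul_closed[OF x Suc])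
  then show ?case
    using pw_closed[OF y, of "Suc N"] by (simp add: subspace_add[OF subspace_comps] subspace_scale[OF subspace_comps])
qed (simp add: unit_deg subspace_scale[OF subspace_comps])

lemma form_add: "form d x y N (\<lambda>i. c i + c' i) = form d x y N c + form d x y N c'"
proof (induction N arbitrary: c c')
  case (Suc N)
  show ?case by (simp add: Suc scale_left_distrib mul_add_right[OF x form_closed form_closed])
qed (simp add: scale_left_distrib)

lemma form_scl: "form d x y N (\<lambda>i. r * c i) = scl P r (form d x y N c)"
proof (induction N arbitrary: c)
  case (Suc N)
  show ?case by (simp add: Suc scale_right_distrib mul_scl_right[OF x form_closed])
qed simp

lemma form_cong: "(\<And>i. i \<le> N \<Longrightarrow> c i = c' i) \<Longrightarrow> form d x y N c = form d x y N c'"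
proof (induction N arbitrary: c c')
  case (Suc N)
  have "form d x y N (\<lambda>i. c (Suc i)) = form d x y N (\<lambda>i. c' (Suc i))" by (rule Suc.IH) (simp add: Suc.prems)
  then show ?case using Suc.prems[of 0] by simp
qed simp

lemma form_zero: "form d x y N (\<lambda>i. 0) = 0"
  using form_scl[of N 0 "\<lambda>i. 0"] by simp

lemma form_sum: "finite S \<Longrightarrow> form d x y N (\<lambda>i. \<Sum>j\<in>S. c j i) = (\<Sum>j\<in>S. form d x y N (c j))"
  by (induction S rule: finite_induct) (simp_all add: form_zero form_add)

lemma form_eq_sum:
  "form d x y N c = (\<Sum>j<Suc N. scl P (c j) (form d x y N (\<lambda>i. if i = j then 1 else 0)))"
proof -
  have "form d x y N c = form d x y N (\<lambda>i. \<Sum>j<Suc N. c j * (if i = j then 1 else 0))"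
    by (rule form_cong) (simp add: if_distrib[of "(*) _"] del: sum.lessThan_Suc cong: if_cong)
  also have "\<dots> = (\<Sum>j<Suc N. form d x y N (\<lambda>i. c j * (if i = j then 1 else 0)))" by (rule form_sum) simp
  also have "\<dots> = (\<Sum>j<Suc N. scl P (c j) (form d x y N (\<lambda>i. if i = j then 1 else 0)))"
    by (simp only: form_scl)
  finally show ?thesis .
qed

text \<open>A form without the top power of \<open>x\<close> is divisible by \<open>y\<close>. This
  treats the root at infinity.\<close>

lemma form_mul_y: "c (Suc N) = 0 \<Longrightarrow> form d x y (Suc N) c = mul d (N * d) y (form d x y N c)"
proof (induction N arbitrary: c)
  case 0
  then show ?case using y unit_deg by (simp add: mul_scl_right mul_zero_right x)
next
  case (Suc N)
  let ?c = "\<lambda>i. c (Suc i)"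
  have f: "form d x y N ?c \<in> deg (N * d)" by (rule form_closed)
  have "form d x y (Suc (Suc N)) c = scl P (c 0) (pw d y (Suc (Suc N)))
      + mul d (d + N * d) x (mul d (N * d) y (form d x y N ?c))"
    using Suc.IH[of ?c] Suc.prems by simp
  also have "mul d (d + N * d) x (mul d (N * d) y (form d x y N ?c)) = mul d (d + N * d) y (mul d (N * d) x (form d x y N ?c))"
    by (rule mul_left_commute[OF x y f])
  also have "scl P (c 0) (pw d y (Suc (Suc N))) = mul d (d + N * d) y (scl P (c 0) (pw d y (Suc N)))"
    using pw_closed[OF y, of "Suc N"] y by (simp add: mul_scl_right)
  finally show ?case
    using mul_add_right[OF y, of "scl P (c 0) (pw d y (Suc N))" "d + N * d" "mul d (N * d) x (form d x y N ?c)"]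
      mul_closed[OF x f] pw_closed[OF y, of "Suc N"] by (simp add: subspace_scale[OF subspace_comps])
qed

text \<open>Over an algebraically closed field a binary form is a product of linear forms.\<close>

lemma linear_factor_in_prime:
  assumes I: "graded_prime I" "unit P \<notin> I 0"
    and p: "p \<noteq> 0" "degree p \<le> N" "form d x y N (coeff p) \<in> I (N * d)"
  shows "y \<in> I d \<or> (\<exists>r. x - scl P r y \<in> I d)"
  using p
proof (induction N arbitrary: p)
  case 0
  have id: "subspace (I 0)" using I(1) graded_idealD(1) by (auto simp: graded_prime_def)
  have "coeff p 0 \<noteq> 0" using 0 by (metis degree_0_id le_zero_eq leading_coeff_neq_0)
  then have "unit P \<in> I 0" using subspace_scale[OF id, of _ "inverse (coeff p 0)"] 0(3) by fastforce
  then show ?case using I(2) by blast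
next
  case (Suc N)
  have prime: "u \<in> I d \<or> v \<in> I (N * d)" if "u \<in> deg d" "v \<in> deg (N * d)" "mul d (N * d) u v \<in> I (Suc N * d)" for u v
    using I(1) that unfolding graded_prime_def by auto
  show ?case
  proof (cases "coeff p (Suc N) = 0")
    case True
    then have deg: "degree p \<le> N"
      using Suc.prems(2) by (metis Suc.prems(1) le_Suc_eq leading_coeff_0_iff)
    have "mul d (N * d) y (form d x y N (coeff p)) \<in> I (Suc N * d)"
      using Suc.prems(3) form_mul_y[where c = "coeff p", OF True] by simp
    then show ?thesis using prime[OF y form_closed] Suc.IH[OF Suc.prems(1) deg] by blast
  next
    case False
    then have degp: "degree p = Suc N" using Suc.prems(2) le_degree[OF False] by simp
    then obtain r where "poly p r = 0" using alg_closed_imp_poly_has_root[of p] by auto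
    then obtain q where q: "p = [:- r, 1:] * q" using poly_eq_0_iff_dvd by (metis dvdE)
    have q0: "q \<noteq> 0" using q Suc.prems(1) by auto
    have "degree ([:- r, 1:] * q) = degree [:- r, 1:] + degree q" using q0 by (intro degree_mult_eq) auto
    then have degq: "degree q = N" unfolding q[symmetric] degp by simp
    let ?F = "form d x y N (coeff q)"
    \<comment> \<open>The product with the linear polynomial is
      \<open>pCons 0 q - smult r q\<close>. By the Horner shape of \<open>form\<close>, the first
      term becomes multiplication by \<open>x\<close>; the second lacks the top power and becomes
      multiplication by \<open>y\<close>.\<close>
    have "form d x y (Suc N) (coeff p) = form d x y (Suc N) (\<lambda>i. coeff (pCons 0 q) i + (- r) * coeff q i)"
      unfolding q by (intro form_cong) simp
    also have "\<dots> = form d x y (Suc N) (coeff (pCons 0 q)) + scl P (- r) (form d x y (Suc N) (coeff q))"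
      by (simp only: form_add form_scl)
    also have "form d x y (Suc N) (coeff (pCons 0 q)) = mul d (N * d) x ?F" by simp
    also have "form d x y (Suc N) (coeff q) = mul d (N * d) y ?F"
      using degq by (intro form_mul_y) (simp add: coeff_eq_0)
    also have "mul d (N * d) x ?F + scl P (- r) (mul d (N * d) y ?F) = mul d (N * d) (x - scl P r y) ?F"
      using mul_add_left[OF x subspace_scale[OF subspace_comps y, of "- r"] form_closed]
        mul_scl_left[OF y, of ?F "N * d" "- r"] form_closed[of N "coeff q"] by simp
    finally have "mul d (N * d) (x - scl P r y) ?F \<in> I (Suc N * d)" using Suc.prems(3) by simp
    moreover have "x - scl P r y \<in> deg d"
      using x y by (intro subspace_diff[OF subspace_comps] subspace_scale[OF subspace_comps])
    ultimately show ?thesis using prime[OF _ form_closed] Suc.IH[OF q0] degq by blast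
  qed
qed

end

section \<open>Vanishing forms from slow growth\<close>

lemma deg_basis: "\<exists>B. finite B \<and> deg d \<subseteq> span B \<and> card B = dim (deg d)"
proof -
  obtain B where B: "B \<subseteq> deg d" "independent B" "deg d \<subseteq> span B" "card B = dim (deg d)"
    by (rule basis_exists)
  obtain B' where "finite B'" "deg d = span B'" using locally_finite by blast
  then show ?thesis using independent_span_bound[of B' B] B by auto
qed

text \<open>Otherwise, for positive \<open>d\<close>, the degrees \<open>N * d\<close> with
  \<open>M \<le> N < 2 * M\<close> would contribute at least \<open>M * M\<close> dimensions in
  arities of order \<open>M\<close>, which is quadratic growth.\<close>

lemma dim_deg_multiple_le: "\<exists>N. dim (deg (N * d)) \<le> N"
proof (cases "d = 0")
  case True
  then show ?thesis by auto
next
  case d: False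
  show ?thesis
  proof (rule ccontr)
    assume "\<not> ?thesis"
    then have big: "N \<le> dim (deg (N * d))" for N by (meson linear)
    obtain K where K: "\<And>m. m \<ge> K \<Longrightarrow> (\<Sum>i\<le>m. dim (comps P i)) ^ 4 \<le> m ^ 5"
      using GKdim_one_growth[OF gk_one] by blast
    \<comment> \<open>Comparing \<open>(M * M) ^ 4\<close> with \<open>((2 * d + 1) * M) ^ 5\<close>
      leaves \<open>M ^ 3 \<le> (2 * d + 1) ^ 5\<close>, which this choice excludes.\<close>
    define M where "M = K + (2 * d + 1) ^ 5 + 1"
    define m where "m = 2 * M * d + 1"
    have inj: "inj_on (\<lambda>N. Suc (N * d)) {M..<2 * M}" using d by (auto simp: inj_on_def)
    have "M * M = (\<Sum>N\<in>{M..<2 * M}. M)" by simp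
    also have "\<dots> \<le> (\<Sum>N\<in>{M..<2 * M}. dim (deg (N * d)))"
    proof (intro sum_mono)
      fix N assume "N \<in> {M..<2 * M}"
      then show "M \<le> dim (deg (N * d))" using big[of N] by auto
    qed
    also have "\<dots> = (\<Sum>i\<in>(\<lambda>N. Suc (N * d)) ` {M..<2 * M}. dim (comps P i))"
      by (simp add: sum.reindex[OF inj])
    also have "\<dots> \<le> (\<Sum>i\<le>m. dim (comps P i))"
    proof (intro sum_mono2)
      have "Suc (N * d) \<le> m" if "N < 2 * M" for N
        using mult_le_mono1[of N "2 * M" d] that unfolding m_def by linarith
      then show "(\<lambda>N. Suc (N * d)) ` {M..<2 * M} \<subseteq> {..m}" by auto
    qed auto
    finally have "(M * M) ^ 4 \<le> (\<Sum>i\<le>m. dim (comps P i)) ^ 4" by (rule power_mono) simp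
    also have "\<dots> \<le> m ^ 5"
    proof (rule K)
      have "K \<le> M * 1" by (simp add: M_def)
      also have "\<dots> \<le> M * d" using d by (intro mult_le_mono2) simp
      finally show "K \<le> m" by (simp add: m_def)
    qed
    also have "\<dots> \<le> ((2 * d + 1) * M) ^ 5"
      by (intro power_mono) (auto simp: m_def M_def algebra_simps)
    also have "\<dots> = (2 * d + 1) ^ 5 * M ^ 5" by (rule power_mult_distrib)
    also have "(M * M) ^ 4 = M ^ 3 * M ^ 5" by (simp add: power_mult_distrib flip: power_add)
    finally have "M ^ 3 * M ^ 5 \<le> (2 * d + 1) ^ 5 * M ^ 5" .
    moreover have "0 < M ^ 5" by (simp add: M_def)
    ultimately have "M ^ 3 \<le> (2 * d + 1) ^ 5" using mult_le_cancel2 by blast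
    also have "\<dots> < M" by (simp add: M_def)
    also have "M \<le> M ^ 3" by (rule self_le_power) (simp_all add: M_def)
    finally show False by simp
  qed
qed

text \<open>For a suitable \<open>N\<close>, the \<open>N + 1\<close> monomials of degree
  \<open>N\<close> in \<open>x\<close> and \<open>y\<close> lie in a space of dimension at most
  \<open>N\<close>. Their linear relation is packed into the polynomial \<open>p\<close>.\<close>

lemma vanishing_form:
  assumes "x \<in> deg d" "y \<in> deg d"
  shows "\<exists>N p. p \<noteq> 0 \<and> degree p \<le> N \<and> form d x y N (coeff p) = 0"
proof -
  obtain N where N: "dim (deg (N * d)) \<le> N" using dim_deg_multiple_le by blast
  obtain B where B: "finite B" "deg (N * d) \<subseteq> span B" "card B = dim (deg (N * d))"
    using deg_basis by blast
  let ?f = "\<lambda>j. form d x y N (\<lambda>i. if i = j then 1 else 0)"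
  have "?f ` {..<Suc N} \<subseteq> span B" using form_closed[OF assms] B(2) by blast
  then obtain c where c: "\<exists>i<Suc N. c i \<noteq> 0" "(\<Sum>i<Suc N. scl P (c i) (?f i)) = 0"
    using finite_family_dependent[of B ?f "Suc N"] B N by auto
  define p where "p = (\<Sum>i\<le>N. monom (c i) i)"
  have coeff_p: "coeff p i = c i" if "i \<le> N" for i
    using that by (simp add: p_def coeff_sum)
  have "degree p \<le> N"
    unfolding p_def by (intro degree_sum_le) (auto intro: order_trans[OF degree_monom_le])
  moreover have "p \<noteq> 0" using c(1) coeff_p by (metis coeff_0 less_Suc_eq_le)
  moreover have "form d x y N (coeff p) = form d x y N c"
    by (rule form_cong[OF assms]) (rule coeff_p)
  then have "form d x y N (coeff p) = 0" using c(2) form_eq_sum[OF assms, of N c] by simp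
  ultimately show ?thesis by blast
qed

lemma one_dimensional_mod_prime:
  assumes I: "graded_prime I" "unit P \<notin> I 0" and x: "x \<in> deg d" and y: "y \<in> deg d" "y \<notin> I d"
  shows "\<exists>r. x - scl P r y \<in> I d"
proof -
  obtain N p where p: "p \<noteq> 0" "degree p \<le> N" "form d x y N (coeff p) = 0"
    using vanishing_form[OF x y(1)] by blast
  have "form d x y N (coeff p) \<in> I (N * d)"
    using p(3) I(1) subspace_0 graded_idealD(1) by (auto simp: graded_prime_def)
  then show ?thesis using linear_factor_in_prime[OF x y(1) I p(1,2)] y(2) by blast
qed

end

section \<open>Characters\<close>

text \<open>An elementary numerical semigroup argument. The period is obtained as the least positive
  difference of two members, which provides the consecutive multiples \<open>a\<close> and
  \<open>a + w\<close> used to represent all large multiples.\<close>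

lemma additive_nat_set_period:
  fixes S :: "nat set"
  assumes add: "\<And>m n. m \<in> S \<Longrightarrow> n \<in> S \<Longrightarrow> m + n \<in> S" and zero: "0 \<in> S" and pos: "e \<in> S" "e \<ge> 1"
  shows "\<exists>w\<ge>1. (\<forall>s\<in>S. w dvd s) \<and> (\<exists>K. \<forall>n\<ge>K. w dvd n \<longrightarrow> n \<in> S)"
proof -
  define D where "D w \<longleftrightarrow> w \<ge> 1 \<and> (\<exists>a\<in>S. a + w \<in> S)" for w
  have "D e" unfolding D_def using zero pos by (auto intro!: bexI[of _ 0])
  define w where "w = (LEAST w. D w)"
  have "D w" unfolding w_def by (rule LeastI) fact
  then obtain a where w: "w \<ge> 1" and a: "a \<in> S" "a + w \<in> S" by (auto simp: D_def)
  have mult: "k * s \<in> S" if "s \<in> S" for k s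
    using that zero add by (induction k) auto
  have dvd: "w dvd s" if s: "s \<in> S" for s
  proof (rule ccontr)
    assume "\<not> w dvd s"
    then have m: "s mod w \<ge> 1" "s mod w < w" using w by (auto simp: dvd_eq_mod_eq_0)
    let ?q = "s div w"
    \<comment> \<open>Shows that a nonzero remainder \<open>s mod w\<close> would be a smaller
      difference of two members of \<open>S\<close>.\<close>
    have "?q * (a + w) + s mod w = ?q * a + s"
      using div_mult_mod_eq[of s w] by (simp add: distrib_left)
    then have "?q * (a + w) + s mod w \<in> S" using mult[OF a(1)] add s by auto
    then have "D (s mod w)" unfolding D_def using m mult[OF a(2)] by blast
    then show False using not_less_Least[of "s mod w" D] m by (simp add: w_def)
  qed
  obtain k where k: "a = w * k" using dvd[OF a(1)] by blast
  \<comment> \<open>With \<open>j \<ge> k * k\<close> the quotient of \<open>j\<close> by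
    \<open>k\<close> is at least \<open>k\<close> and thus exceeds the remainder, so that enough
    summands \<open>a\<close> can be exchanged for \<open>a + w\<close>.\<close>
  have "n \<in> S" if n: "n \<ge> w * (k * k)" "w dvd n" for n
  proof -
    obtain j where j: "n = w * j" using n(2) by blast
    have jk: "j \<ge> k * k" using n(1) j w by simp
    show ?thesis
    proof (cases "k = 0")
      case True
      then show ?thesis using mult[OF a(2), of j] k j by (simp add: mult.commute)
    next
      case False
      let ?q = "j div k" and ?r = "j mod k"
      have "k * k div k \<le> ?q" using jk by (rule div_le_mono)
      then have "k \<le> ?q" using False by simp
      then have qr: "?r \<le> ?q" using False mod_less_divisor[of k j] by linarith
      have "j = ?q * k + ?r" by simp
      also have "\<dots> = (?q - ?r) * k + ?r * (k + 1)"
        using qr by (simp add: diff_mult_distrib distrib_left)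
      finally have "n = w * ((?q - ?r) * k + ?r * (k + 1))" using j by simp
      also have "\<dots> = (?q - ?r) * a + ?r * (a + w)"
        unfolding k by (simp only: distrib_left distrib_right mult_1_right mult_1 ac_simps)
      finally have "n = (?q - ?r) * a + ?r * (a + w)" .
      then show ?thesis using add[OF mult[OF a(1)] mult[OF a(2)]] by simp
    qed
  qed
  then show ?thesis using w dvd by blast
qed

context gk_one_operad
begin

text \<open>Compatibility with permutations is not demanded; \<open>character_twist\<close> derives
  it. The last clause excludes functionals living in degree 0 only, which do not correspond to any
  of the summands sought.\<close>

definition character :: "(nat \<Rightarrow> 'a \<Rightarrow> 'k) \<Rightarrow> bool" where
  "character \<chi> \<longleftrightarrow>
    (\<forall>d. \<forall>x\<in>deg d. \<forall>y\<in>deg d. \<chi> d (x + y) = \<chi> d x + \<chi> d y) \<and>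
    (\<forall>d c. \<forall>x\<in>deg d. \<chi> d (scl P c x) = c * \<chi> d x) \<and>
    (\<forall>a b. \<forall>x\<in>deg a. \<forall>y\<in>deg b. \<chi> (a + b) (mul a b x y) = \<chi> a x * \<chi> b y) \<and>
    \<chi> 0 (unit P) = 1 \<and> (\<exists>d\<ge>1. \<exists>x\<in>deg d. \<chi> d x \<noteq> 0)"

lemma characterD:
  assumes "character \<chi>"
  shows "\<lbrakk>x \<in> deg d; y \<in> deg d\<rbrakk> \<Longrightarrow> \<chi> d (x + y) = \<chi> d x + \<chi> d y"
    and "x \<in> deg d \<Longrightarrow> \<chi> d (scl P c x) = c * \<chi> d x"
    and "\<lbrakk>x \<in> deg a; y \<in> deg b\<rbrakk> \<Longrightarrow> \<chi> (a + b) (mul a b x y) = \<chi> a x * \<chi> b y"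
    and "\<chi> 0 (unit P) = 1"
    and "\<exists>d\<ge>1. \<exists>x\<in>deg d. \<chi> d x \<noteq> 0"
  using assms unfolding character_def by blast+

lemma character_zero: "character \<chi> \<Longrightarrow> \<chi> d 0 = 0"
  using characterD(2)[of \<chi> 0 d 0] subspace_0[OF subspace_comps] by simp

lemma character_diff: "\<lbrakk>character \<chi>; x \<in> deg d; y \<in> deg d\<rbrakk> \<Longrightarrow> \<chi> d (x - y) = \<chi> d x - \<chi> d y"
  using characterD(1)[of \<chi> x d "- y"] characterD(2)[of \<chi> y d "- 1"] subspace_neg[OF subspace_comps]
  by simp

lemma character_pw: "\<lbrakk>character \<chi>; x \<in> deg d\<rbrakk> \<Longrightarrow> \<chi> (N * d) (pw d x N) = \<chi> d x ^ N"
  by (induction N) (simp_all add: characterD(3,4) pw_closed)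

lemma character_form:
  assumes "character \<chi>" "x \<in> deg d" "y \<in> deg d" "\<chi> d y = 1"
  shows "\<chi> (N * d) (form d x y N c) = (\<Sum>i\<le>N. c i * \<chi> d x ^ i)"
proof (induction N arbitrary: c)
  case 0
  then show ?case using characterD(2)[OF assms(1) unit_deg] characterD(4)[OF assms(1)] by simp
next
  case (Suc N)
  have f: "form d x y N (\<lambda>i. c (Suc i)) \<in> deg (N * d)" by (rule form_closed[OF assms(2,3)])
  have p: "pw d y (Suc N) \<in> deg (d + N * d)" using pw_closed[OF assms(3), of "Suc N"] by simp
  have "\<chi> (Suc N * d) (form d x y (Suc N) c) =
      \<chi> (d + N * d) (scl P (c 0) (pw d y (Suc N))) + \<chi> (d + N * d) (mul d (N * d) x (form d x y N (\<lambda>i. c (Suc i))))"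
    using characterD(1)[OF assms(1) subspace_scale[OF subspace_comps p] mul_closed[OF assms(2) f]] by simp
  also have "\<chi> (d + N * d) (scl P (c 0) (pw d y (Suc N))) = c 0"
    using characterD(2)[OF assms(1) p] character_pw[OF assms(1,3), of "Suc N"] assms(4) by simp
  also have "\<chi> (d + N * d) (mul d (N * d) x (form d x y N (\<lambda>i. c (Suc i)))) =
      \<chi> d x * (\<Sum>i\<le>N. c (Suc i) * \<chi> d x ^ i)"
    using characterD(3)[OF assms(1,2) f] Suc by simp
  finally show ?case
    by (simp only: sum.atMost_Suc_shift) (simp add: sum_distrib_left mult.left_commute)
qed

text \<open>In a product, \<open>twist\<close> may be moved from one factor to the other, so the
  ratio of \<open>\<chi>\<close> before and after twisting is the same everywhere. It squares to 1
  because \<open>twist\<close> is an involution.\<close>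

lemma character_twist:
  assumes \<chi>: "character \<chi>"
  shows "\<exists>\<epsilon>. (\<epsilon> = 1 \<or> \<epsilon> = - 1) \<and> (\<forall>d\<ge>1. \<forall>x\<in>deg d. \<chi> d (twist d x) = \<epsilon> * \<chi> d x)"
proof -
  obtain e b where b: "e \<ge> 1" "b \<in> deg e" "\<chi> e b \<noteq> 0" using characterD(5)[OF \<chi>] by blast
  define \<epsilon> where "\<epsilon> = \<chi> e (twist e b) / \<chi> e b"
  have \<epsilon>: "\<chi> d (twist d x) = \<epsilon> * \<chi> d x" if "d \<ge> 1" "x \<in> deg d" for d x
  proof -
    have "\<chi> d (twist d x) * \<chi> e b = \<chi> d x * \<chi> e (twist e b)"
      using characterD(3)[OF \<chi> twist_closed[OF that(2)] b(2)] characterD(3)[OF \<chi> that(2) twist_closed[OF b(2)]]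
        mul_twist_left[OF that(2) b(2) that(1)] mul_twist_right[OF that(2) b(2,1)] by simp
    then show ?thesis using b(3) by (simp add: \<epsilon>_def field_simps)
  qed
  have "\<epsilon> * \<epsilon> * \<chi> e b = \<chi> e b"
    using \<epsilon>[OF b(1) twist_closed[OF b(2)]] \<epsilon>[OF b(1,2)] twist_twist[OF b(2)] by simp
  then have "(\<epsilon> - 1) * (\<epsilon> + 1) = 0" using b(3) by (simp add: algebra_simps)
  then have "\<epsilon> = 1 \<or> \<epsilon> = - 1" by (auto simp: eq_neg_iff_add_eq_0)
  then show ?thesis using \<epsilon> by blast
qed

lemma character_period:
  assumes \<chi>: "character \<chi>"
  shows "\<exists>w\<ge>1. (\<forall>d. \<forall>x\<in>deg d. \<chi> d x \<noteq> 0 \<longrightarrow> w dvd d) \<and> (\<exists>K. \<forall>d\<ge>K. w dvd d \<longrightarrow> (\<exists>x\<in>deg d. \<chi> d x \<noteq> 0))"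
proof -
  let ?S = "{d. \<exists>x\<in>deg d. \<chi> d x \<noteq> 0}"
  obtain e where e: "e \<in> ?S" "e \<ge> 1" using characterD(5)[OF \<chi>] by blast
  have add: "m + n \<in> ?S" if m: "m \<in> ?S" and n: "n \<in> ?S" for m n
  proof -
    obtain x y where "x \<in> deg m" "\<chi> m x \<noteq> 0" "y \<in> deg n" "\<chi> n y \<noteq> 0" using m n by blast
    then have "mul m n x y \<in> deg (m + n)" "\<chi> (m + n) (mul m n x y) \<noteq> 0"
      by (simp_all add: mul_closed characterD(3)[OF \<chi>])
    then show ?thesis by blast
  qed
  have "0 \<in> ?S" using unit_deg characterD(4)[OF \<chi>] by force
  from additive_nat_set_period[OF add this e] show ?thesis by blast
qed

text \<open>
  Modulo a proper prime ideal each degree is at most one-dimensional and the degrees that occur are, up to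
  finitely many, the multiples of some \<open>w\<close>. The fraction \<open>p / q\<close> of degree \<open>w\<close> trivialises all of these lines.
\<close>

lemma character_of_graded_prime:
  assumes I: "graded_prime I" and b: "b \<in> deg e" "b \<notin> I e" "e \<ge> 1"
  shows "\<exists>\<chi>. character \<chi> \<and> (\<forall>d. \<forall>x\<in>deg d. \<chi> d x = 0 \<longleftrightarrow> x \<in> I d)"
proof -
  have id: "graded_ideal I"
    and prime: "\<And>a b x y. \<lbrakk>x \<in> deg a; y \<in> deg b; mul a b x y \<in> I (a + b)\<rbrakk> \<Longrightarrow> x \<in> I a \<or> y \<in> I b"
    using I unfolding graded_prime_def by blast+
  note ID = graded_idealD[OF id]
  have unit: "unit P \<notin> I 0" using unit_notin_proper_ideal[OF id b(1,2)] .
  let ?S = "{d. \<exists>x\<in>deg d. x \<notin> I d}"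
  have add: "m + n \<in> ?S" if m: "m \<in> ?S" and n: "n \<in> ?S" for m n
  proof -
    obtain x y where "x \<in> deg m" "x \<notin> I m" "y \<in> deg n" "y \<notin> I n" using m n by blast
    then have "mul m n x y \<in> deg (m + n)" "mul m n x y \<notin> I (m + n)"
      using prime by (auto simp: mul_closed)
    then show ?thesis by blast
  qed
  have "0 \<in> ?S" "e \<in> ?S" using unit_deg unit b by auto
  from additive_nat_set_period[OF add this b(3)]
  obtain w K where w: "w \<ge> 1" "\<And>d. d \<in> ?S \<Longrightarrow> w dvd d" "\<And>d. d \<ge> K \<Longrightarrow> w dvd d \<Longrightarrow> d \<in> ?S" by blast
  \<comment> \<open>A multiple of \<open>w\<close> beyond \<open>K\<close>, so that both
    \<open>a\<close> and \<open>a + w\<close> are degrees in which the quotient is nonzero.\<close>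
  define a where "a = w * K"
  have "K \<le> a" using w(1) by (simp add: a_def)
  moreover have "w dvd a" "w dvd a + w" by (simp_all add: a_def)
  ultimately have "a \<in> ?S" "a + w \<in> ?S" using w(3)[of a] w(3)[of "a + w"] by simp_all
  then obtain q p where q: "q \<in> deg a" "q \<notin> I a" and p: "p \<in> deg (a + w)" "p \<notin> I (a + w)" by blast
  \<comment> \<open>For degree \<open>d = k * w\<close> the value is the scalar \<open>c\<close>
    with \<open>x = c * (p / q) ^ k\<close> modulo \<open>I\<close>, after clearing denominators. It
    is unique since the powers of \<open>p\<close> avoid \<open>I\<close>.\<close>
  define \<chi> where "\<chi> d x = (if w dvd d then THE c. mul d (d div w * a) x (pw a q (d div w))
      - scl P c (pw (a + w) p (d div w)) \<in> I (d + d div w * a) else 0)" for d x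
  have qk: "pw a q k \<in> deg (k * a)" "pw a q k \<notin> I (k * a)" for k
    using pw_closed[OF q(1)] pw_notin_prime[OF I unit q] by auto
  have pk: "pw (a + w) p k \<in> deg (k * w + k * a)" "pw (a + w) p k \<notin> I (k * w + k * a)" for k
    using pw_closed[OF p(1), of k] pw_notin_prime[OF I unit p, of k] by (simp_all add: distrib_left add.commute)
  have \<chi>_eq: "\<chi> (k * w) x = c \<longleftrightarrow> mul (k * w) (k * a) x (pw a q k) - scl P c (pw (a + w) p k) \<in> I (k * w + k * a)"
    if x: "x \<in> deg (k * w)" for k x c
  proof -
    let ?R = "\<lambda>c. mul (k * w) (k * a) x (pw a q k) - scl P c (pw (a + w) p k) \<in> I (k * w + k * a)"
    have "\<exists>c. ?R c"
      using one_dimensional_mod_prime[OF I unit mul_closed[OF x qk(1)] pk] .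
    moreover have "c = c'" if "?R c" "?R c'" for c c'
    proof (rule ccontr)
      assume "c \<noteq> c'"
      have "scl P (c' - c) (pw (a + w) p k) \<in> I (k * w + k * a)"
        using subspace_diff[OF ID(1) that] by (simp add: scale_left_diff_distrib)
      then have "scl P (inverse (c' - c)) (scl P (c' - c) (pw (a + w) p k)) \<in> I (k * w + k * a)"
        by (rule subspace_scale[OF ID(1)])
      then show False using \<open>c \<noteq> c'\<close> pk(2) by simp
    qed
    ultimately have ex1: "\<exists>!c. ?R c" by blast
    have "\<chi> (k * w) x = (THE c. ?R c)" using w(1) by (simp add: \<chi>_def)
    then show ?thesis using theI'[OF ex1] ex1 by metis
  qed
  have \<chi>_rel: "mul (k * w) (k * a) x (pw a q k) - scl P (\<chi> (k * w) x) (pw (a + w) p k) \<in> I (k * w + k * a)"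
    if "x \<in> deg (k * w)" for k x
    using \<chi>_eq[OF that] by blast
  have ker: "\<chi> d x = 0 \<longleftrightarrow> x \<in> I d" if x: "x \<in> deg d" for d x
  proof (cases "w dvd d")
    case True
    then obtain k where k: "d = k * w" by (metis dvd_def mult.commute)
    then have "\<chi> d x = 0 \<longleftrightarrow> mul (k * w) (k * a) x (pw a q k) \<in> I (k * w + k * a)"
      using \<chi>_eq[of x k 0] x by simp
    also have "\<dots> \<longleftrightarrow> x \<in> I d" using prime[of x d "pw a q k" "k * a"] ID(4)[OF _ qk(1)] qk x k by blast
    finally show ?thesis .
  next
    case False
    then show ?thesis using w(2) x by (auto simp: \<chi>_def)
  qed
  have "character \<chi>"
    unfolding character_def
  proof (intro conjI allI ballI)
    fix d x y c assume x: "x \<in> deg d" and y: "y \<in> deg d"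
    show "\<chi> d (x + y) = \<chi> d x + \<chi> d y"
    proof (cases "w dvd d")
      case True
      then obtain k where k: "d = k * w" by (metis dvd_def mult.commute)
      have "mul (k * w) (k * a) (x + y) (pw a q k) - scl P (\<chi> d x + \<chi> d y) (pw (a + w) p k) \<in> I (k * w + k * a)"
        using subspace_add[OF ID(1) \<chi>_rel[of x k] \<chi>_rel[of y k]] x y k qk(1)[of k]
        by (simp add: mul_add_left scale_left_distrib algebra_simps)
      then show ?thesis using \<chi>_eq[of "x + y" k] subspace_add[OF subspace_comps x y] k by simp
    qed (simp add: \<chi>_def)
  next
    fix d c x assume x: "x \<in> deg d"
    show "\<chi> d (scl P c x) = c * \<chi> d x"
    proof (cases "w dvd d")
      case True
      then obtain k where k: "d = k * w" by (metis dvd_def mult.commute)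
      have "mul (k * w) (k * a) (scl P c x) (pw a q k) - scl P (c * \<chi> d x) (pw (a + w) p k) \<in> I (k * w + k * a)"
        using subspace_scale[OF ID(1) \<chi>_rel[of x k], of c] x k qk(1)[of k]
        by (simp add: mul_scl_left scale_right_diff_distrib)
      then show ?thesis using \<chi>_eq[of "scl P c x" k] subspace_scale[OF subspace_comps x] k by simp
    qed (simp add: \<chi>_def)
  next
    fix d e x y assume x: "x \<in> deg d" and y: "y \<in> deg e"
    show "\<chi> (d + e) (mul d e x y) = \<chi> d x * \<chi> e y"
    proof (cases "w dvd d \<and> w dvd e")
      case False
      then have "x \<in> I d \<or> y \<in> I e" using w(2) x y by blast
      then show ?thesis using ker[OF mul_closed[OF x y]] ker[OF x] ker[OF y] ID(4,5) x y by auto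
    next
      case True
      then obtain k l where k: "d = k * w" and l: "e = l * w" by (metis dvd_def mult.commute)
      let ?c = "\<chi> d x" and ?c' = "\<chi> e y"
      let ?xq = "mul d (k * a) x (pw a q k)" and ?yq = "mul e (l * a) y (pw a q l)"
      let ?pk = "pw (a + w) p k" and ?pl = "pw (a + w) p l"
      let ?m = "mul (d + k * a) (e + l * a)" and ?J = "I (d + k * a + (e + l * a))"
      have xq: "?xq \<in> deg (d + k * a)" and yq: "?yq \<in> deg (e + l * a)"
        using x y qk by (auto intro: mul_closed)
      have pkl: "?pk \<in> deg (d + k * a)" "?pl \<in> deg (e + l * a)" using pk k l by auto
      have "?m (?xq - scl P ?c ?pk) ?yq \<in> ?J"
        using \<chi>_rel[of x k] x k by (intro ID(4) yq) simp
      moreover have "?m (scl P ?c ?pk) (?yq - scl P ?c' ?pl) \<in> ?J"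
        using \<chi>_rel[of y l] y l pkl by (intro ID(5) subspace_scale[OF subspace_comps]) auto
      ultimately have "?m (?xq - scl P ?c ?pk) ?yq + ?m (scl P ?c ?pk) (?yq - scl P ?c' ?pl) \<in> ?J"
        by (rule subspace_add[OF ID(1)])
      also have "?m (?xq - scl P ?c ?pk) ?yq + ?m (scl P ?c ?pk) (?yq - scl P ?c' ?pl) =
          ?m ?xq ?yq - scl P (?c * ?c') (?m ?pk ?pl)"
      proof -
        have s: "scl P ?c ?pk \<in> deg (d + k * a)" "scl P ?c' ?pl \<in> deg (e + l * a)"
          using pkl by (auto intro: subspace_scale[OF subspace_comps])
        have "?m ?xq ?yq = ?m (?xq - scl P ?c ?pk) ?yq + ?m (scl P ?c ?pk) ?yq"
          using mul_add_left[OF subspace_diff[OF subspace_comps xq s(1)] s(1) yq] by simp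
        moreover have "?m (scl P ?c ?pk) (?yq - scl P ?c' ?pl) = ?m (scl P ?c ?pk) ?yq - scl P (?c * ?c') (?m ?pk ?pl)"
          using mul_diff_right[OF s(1) yq s(2)] mul_scl_left[OF pkl(1) s(2)] mul_scl_right[OF pkl] by simp
        ultimately show ?thesis by simp
      qed
      also have "?m ?pk ?pl = pw (a + w) p (k + l)"
        using pw_add[OF p(1), of k l] k l by (simp add: distrib_left add.commute)
      also have "?m ?xq ?yq = mul (d + e) (k * a + l * a) (mul d e x y) (mul (k * a) (l * a) (pw a q k) (pw a q l))"
        by (rule mul_swap[OF x qk(1) y qk(1)])
      also have "mul (k * a) (l * a) (pw a q k) (pw a q l) = pw a q (k + l)" by (rule pw_add[OF q(1)])
      finally have "mul (d + e) (k * a + l * a) (mul d e x y) (pw a q (k + l))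
          - scl P (?c * ?c') (pw (a + w) p (k + l)) \<in> ?J" .
      moreover have "d + k * a + (e + l * a) = (k + l) * w + (k + l) * a" "d + e = (k + l) * w"
        "k * a + l * a = (k + l) * a" using k l by (simp_all add: algebra_simps)
      moreover have "mul d e x y \<in> deg ((k + l) * w)" using mul_closed[OF x y] \<open>d + e = (k + l) * w\<close> by simp
      ultimately show ?thesis using \<chi>_eq[of "mul d e x y" "k + l" "?c * ?c'"] by simp
    qed
  next
    have "mul 0 (0 * a) (unit P) (pw a q 0) - scl P 1 (pw (a + w) p 0) \<in> I (0 * w + 0 * a)"
      using subspace_0[OF ID(1)] mul_unit_left[OF unit_deg] by simp
    then show "\<chi> 0 (unit P) = 1" using \<chi>_eq[of "unit P" 0 1] unit_deg by simp
  next
    show "\<exists>d\<ge>1. \<exists>x\<in>deg d. \<chi> d x \<noteq> 0" using b ker by blast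
  qed
  then show ?thesis using ker by blast
qed

text \<open>A prime avoiding \<open>x\<close> alone might have its quotient in degree 0. By
  torsionfreeness some \<open>p\<close> of positive degree has nonzero product with
  \<open>x\<close>, and a prime avoiding the product avoids both factors.\<close>

lemma character_separates:
  assumes x: "x \<in> deg d" "x \<noteq> 0"
  shows "\<exists>\<chi>. character \<chi> \<and> \<chi> d x \<noteq> 0"
proof -
  obtain k p where k: "k \<ge> 1" "p \<in> deg k" "mul k d p x \<noteq> 0"
    using left_cancel_zero[OF x(1), of 1] x(2) by blast
  obtain I where I: "graded_prime I" "mul k d p x \<notin> I (k + d)"
    using graded_prime_separates[OF mul_closed[OF k(2) x(1)] k(3)] by blast
  have id: "graded_ideal I" using I(1) by (simp add: graded_prime_def)
  have "p \<notin> I k" "x \<notin> I d" using graded_idealD(4,5)[OF id] k x I(2) by blast+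
  then show ?thesis using character_of_graded_prime[OF I(1) k(2) _ k(1)] x(1) by blast
qed

end

section \<open>Finiteness of the set of characters\<close>

lemma finite_image_factor:
  assumes "finite (F ` X)" "\<And>x y. x \<in> X \<Longrightarrow> y \<in> X \<Longrightarrow> F x = F y \<Longrightarrow> K x = K y"
  shows "finite (K ` X)"
proof -
  have "K x = K (inv_into X F (F x))" if "x \<in> X" for x
    using that assms(2)[OF that inv_into_into[of "F x" F X]] by (simp add: f_inv_into_f)
  then have "K ` X \<subseteq> (\<lambda>f. K (inv_into X F f)) ` (F ` X)" by blast
  then show ?thesis using assms(1) finite_subset by blast
qed

lemma finite_power_roots:
  fixes p :: "'a::field poly"
  assumes "p \<noteq> 0" "n \<ge> 1"
  shows "finite {t. poly p (t ^ n) = 0}"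
proof -
  have "degree (monom (1::'a) n) > 0" using assms(2) by (simp add: degree_monom_eq)
  then have "pcompose p (monom 1 n) \<noteq> 0" using assms(1) by (simp add: pcompose_eq_0_iff)
  then have "finite {t. poly (pcompose p (monom 1 n)) t = 0}" by (rule poly_roots_finite)
  then show ?thesis by (simp add: poly_pcompose poly_monom)
qed

context gk_one_operad
begin

text \<open>Finite generation restated in degrees. Generators of arity 0 are dropped, as they vanish
  in a reduced operad.\<close>

lemma graded_generators:
  obtains G where "finite G" "\<And>d x. (d, x) \<in> G \<Longrightarrow> x \<in> deg d"
    "\<And>B. \<lbrakk>\<And>d. subspace (B d); \<And>d. B d \<subseteq> deg d; \<And>d x. x \<in> B d \<Longrightarrow> twist d x \<in> B d; unit P \<in> B 0;
      \<And>a b x y. x \<in> B a \<Longrightarrow> y \<in> B b \<Longrightarrow> mul a b x y \<in> B (a + b); \<And>d x. (d, x) \<in> G \<Longrightarrow> x \<in> B d\<rbrakk>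
      \<Longrightarrow> \<forall>d. B d = deg d"
proof -
  obtain G where G: "finite G" "\<forall>(n, x)\<in>G. x \<in> comps P n"
    "\<And>A. suboperad P A \<Longrightarrow> (\<forall>(n, x)\<in>G. x \<in> A n) \<Longrightarrow> A = comps P"
    using finitely_generated unfolding finitely_generated_operad_def by blast
  define G' where "G' = (\<lambda>(n, x). (n - 1, x)) ` {(n, x)\<in>G. n \<noteq> 0}"
  have "finite G'" unfolding G'_def using G(1) by (auto intro: finite_subset[OF _ G(1)])
  moreover have "x \<in> deg d" if "(d, x) \<in> G'" for d x
    using that G(2) by (auto simp: G'_def)
  moreover have "\<forall>d. B d = deg d"
    if B: "\<And>d. subspace (B d)" "\<And>d. B d \<subseteq> deg d" "\<And>d x. x \<in> B d \<Longrightarrow> twist d x \<in> B d" "unit P \<in> B 0"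
      "\<And>a b x y. x \<in> B a \<Longrightarrow> y \<in> B b \<Longrightarrow> mul a b x y \<in> B (a + b)" "\<And>d x. (d, x) \<in> G' \<Longrightarrow> x \<in> B d" for B
  proof -
    let ?A = "\<lambda>n. case n of 0 \<Rightarrow> {0} | Suc d \<Rightarrow> B d"
    have sub: "subspace (?A n)" for n using B(1) by (cases n) auto
    have "suboperad P ?A"
      unfolding suboperad_def S_submodule_def
    proof (intro conjI allI ballI impI)
      fix n
      show "subspace (?A n)" by (rule sub)
      show "?A n \<subseteq> comps P n" using B(2) reduced by (cases n) auto
      show "act P n x s \<in> ?A n" if x: "x \<in> ?A n" and s: "s permutes {1..n}" for x s
      proof (cases n)
        case 0
        then show ?thesis using x s act_zero[of s 0] by simp
      next
        case (Suc d)
        then show ?thesis using act_eq_twist[of s d x] B(2)[of d] B(3) x s by auto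
      qed
    next
      show "unit P \<in> ?A 1" using B(4) by (simp add: One_nat_def)
    next
      fix m n i x y
      assume x: "x \<in> ?A m" and y: "y \<in> ?A n" and i: "1 \<le> i \<and> i \<le> m"
      obtain a where a: "m = Suc a" using i by (cases m) auto
      have x': "x \<in> B a" "x \<in> deg a" using x a B(2) by auto
      show "pcomp P m n i x y \<in> ?A (m + n - 1)"
      proof (cases n)
        case 0
        then have "pcomp P m n i x y = 0" using y x' i a by (simp add: pcomp_zero_right)
        then show ?thesis using subspace_0[OF sub] by simp
      next
        case (Suc b)
        then have y': "y \<in> B b" "y \<in> deg b" using y B(2) by auto
        show ?thesis using pc_eq_mul[OF x'(2) y'(2)] B(5)[OF x'(1) y'(1)] i a Suc by simp
      qed
    qed
    moreover have "x \<in> ?A n" if "(n, x) \<in> G" for n x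
    proof (cases n)
      case 0
      then show ?thesis using that G(2) reduced by auto
    next
      case (Suc d)
      then have "(d, x) \<in> G'" using that by (force simp: G'_def)
      then show ?thesis using B(6) Suc by simp
    qed
    ultimately have "?A = comps P" by (intro G(3)) auto
    then show ?thesis by (metis nat.case(2))
  qed
  ultimately show thesis by (rule that)
qed

text \<open>An invariant of a character that does not change under rescaling by
  \<open>l ^ d\<close>; restriction to \<open>deg d\<close> makes equality of kernels
  meaningful.\<close>

definition kernel :: "(nat \<Rightarrow> 'a \<Rightarrow> 'k) \<Rightarrow> nat \<Rightarrow> 'a set" where
  "kernel \<chi> d = {x \<in> deg d. \<chi> d x = 0}"

lemma character_rescale:
  assumes \<chi>: "character \<chi>" and l: "l \<noteq> 0"
  shows "character (\<lambda>d x. l ^ d * \<chi> d x)" "kernel (\<lambda>d x. l ^ d * \<chi> d x) = kernel \<chi>"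
proof -
  show "character (\<lambda>d x. l ^ d * \<chi> d x)"
    using characterD[OF \<chi>] l unfolding character_def by (auto simp: algebra_simps power_add)
  show "kernel (\<lambda>d x. l ^ d * \<chi> d x) = kernel \<chi>"
    using l by (auto simp: kernel_def fun_eq_iff)
qed

text \<open>The powers \<open>x ^ e\<close> and \<open>y ^ d\<close> have the same degree and
  satisfy a vanishing binary form. Under every normalised character it becomes the same polynomial
  equation for the \<open>e\<close>-th power of the value at \<open>x\<close>.\<close>

lemma finite_normalised_values:
  assumes y: "y \<in> deg e" "e \<ge> 1" and x: "x \<in> deg d"
  shows "finite {\<chi> d x | \<chi>. character \<chi> \<and> \<chi> e y = 1}"
proof -
  let ?x = "pw d x e" and ?y = "pw e y d"
  have mem: "?x \<in> deg (e * d)" "?y \<in> deg (e * d)"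
    using pw_closed[OF x, of e] pw_closed[OF y(1), of d] by (simp_all add: mult.commute)
  obtain N p where p: "p \<noteq> 0" "degree p \<le> N" "form (e * d) ?x ?y N (coeff p) = 0"
    using vanishing_form[OF mem] by blast
  have "poly p (\<chi> d x ^ e) = 0" if \<chi>: "character \<chi>" "\<chi> e y = 1" for \<chi>
  proof -
    have vx: "\<chi> (e * d) ?x = \<chi> d x ^ e" by (rule character_pw[OF \<chi>(1) x])
    have vy: "\<chi> (e * d) ?y = 1" using character_pw[OF \<chi>(1) y(1), of d] \<chi>(2) by (simp add: mult.commute)
    have "poly p (\<chi> d x ^ e) = (\<Sum>i\<le>N. coeff p i * (\<chi> d x ^ e) ^ i)"
      unfolding poly_altdef using p(2) by (intro sum.mono_neutral_left) (auto simp: coeff_eq_0)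
    also have "\<dots> = \<chi> (N * (e * d)) (form (e * d) ?x ?y N (coeff p))"
      using character_form[OF \<chi>(1) mem vy, of N "coeff p"] by (simp only: vx)
    also have "\<dots> = 0" by (simp add: p(3) character_zero[OF \<chi>(1)])
    finally show ?thesis .
  qed
  then have "{\<chi> d x | \<chi>. character \<chi> \<and> \<chi> e y = 1} \<subseteq> {t. poly p (t ^ e) = 0}" by blast
  then show ?thesis using finite_power_roots[OF p(1) y(2)] finite_subset by blast
qed

text \<open>Every character is nonzero on some generator of positive degree and can be rescaled, by
  extracting a root, to take the value 1 there. It then has finitely many possible values on all
  generators, and these together with its sign determine it.\<close>

lemma finite_kernels: "finite (kernel ` {\<chi>. character \<chi>})"
proof -
  obtain G where G: "finite G" "\<And>d x. (d, x) \<in> G \<Longrightarrow> x \<in> deg d"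
    and gen: "\<And>B. \<lbrakk>\<And>d. subspace (B d); \<And>d. B d \<subseteq> deg d; \<And>d x. x \<in> B d \<Longrightarrow> twist d x \<in> B d; unit P \<in> B 0;
      \<And>a b x y. x \<in> B a \<Longrightarrow> y \<in> B b \<Longrightarrow> mul a b x y \<in> B (a + b); \<And>d x. (d, x) \<in> G \<Longrightarrow> x \<in> B d\<rbrakk>
      \<Longrightarrow> \<forall>d. B d = deg d"
    by (rule graded_generators) blast
  define sgn where "sgn \<chi> = (SOME \<epsilon>. (\<epsilon> = 1 \<or> \<epsilon> = - 1) \<and> (\<forall>d\<ge>1. \<forall>x\<in>deg d. \<chi> d (twist d x) = \<epsilon> * \<chi> d x))"
    for \<chi> :: "nat \<Rightarrow> 'a \<Rightarrow> 'k"
  have sgn: "sgn \<chi> \<in> {1, - 1}" "\<And>d x. \<lbrakk>d \<ge> 1; x \<in> deg d\<rbrakk> \<Longrightarrow> \<chi> d (twist d x) = sgn \<chi> * \<chi> d x"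
    if "character \<chi>" for \<chi>
    using someI_ex[OF character_twist[OF that], folded sgn_def] by auto
  define N where "N g = {\<chi>. character \<chi> \<and> \<chi> (fst g) (snd g) = 1}" for g
  have fin: "finite (kernel ` N g)" if g: "g \<in> G" "fst g \<ge> 1" for g
  proof -
    \<comment> \<open>The sign is recorded because generation also uses permutations, and two
      characters agree on twisted elements only if their signs agree.\<close>
    define F where "F \<chi> = (sgn \<chi>, restrict (\<lambda>h. \<chi> (fst h) (snd h)) G)" for \<chi> :: "nat \<Rightarrow> 'a \<Rightarrow> 'k"
    let ?T = "\<lambda>h. {\<chi> (fst h) (snd h) | \<chi>. character \<chi> \<and> \<chi> (fst g) (snd g) = 1}"
    have "F \<chi> \<in> {1, - 1} \<times> (\<Pi>\<^sub>E h\<in>G. ?T h)" if "\<chi> \<in> N g" for \<chi>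
      using that sgn(1)[of \<chi>] unfolding F_def N_def by (auto simp: PiE_iff)
    then have "F ` N g \<subseteq> {1, - 1} \<times> (\<Pi>\<^sub>E h\<in>G. ?T h)" by blast
    moreover have "finite ({1, - 1 :: 'k} \<times> (\<Pi>\<^sub>E h\<in>G. ?T h))"
    proof (intro finite_SigmaI finite_PiE G(1))
      show "finite (?T h)" if "h \<in> G" for h
        using finite_normalised_values[of "snd g" "fst g" "snd h" "fst h"] G(2)[of "fst g" "snd g"]
          G(2)[of "fst h" "snd h"] g that by simp
    qed simp
    ultimately have "finite (F ` N g)" by (rule finite_subset)
    then show ?thesis
    proof (rule finite_image_factor)
      fix \<chi> \<psi> assume "\<chi> \<in> N g" "\<psi> \<in> N g" and eq: "F \<chi> = F \<psi>"
      then have \<chi>: "character \<chi>" and \<psi>: "character \<psi>" by (auto simp: N_def)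
      have sgn_eq: "sgn \<chi> = sgn \<psi>" using eq by (simp add: F_def)
      have val_eq: "\<chi> d x = \<psi> d x" if "(d, x) \<in> G" for d x
      proof -
        have "restrict (\<lambda>h. \<chi> (fst h) (snd h)) G (d, x) = restrict (\<lambda>h. \<psi> (fst h) (snd h)) G (d, x)"
          using eq by (simp only: F_def prod.inject)
        then show ?thesis using that by simp
      qed
      let ?B = "\<lambda>d. {x \<in> deg d. \<chi> d x = \<psi> d x}"
      have "\<forall>d. ?B d = deg d"
      proof (rule gen)
        show "subspace (?B d)" for d
          using subspace_comps[of "Suc d"] characterD(1,2)[OF \<chi>] characterD(1,2)[OF \<psi>]
            character_zero[OF \<chi>] character_zero[OF \<psi>] by (auto simp: subspace_def)
        show "twist d x \<in> ?B d" if "x \<in> ?B d" for d x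
          using that sgn(2)[OF \<chi>, of d x] sgn(2)[OF \<psi>, of d x] sgn_eq twist_closed[of x d]
          by (cases "d = 0") (auto simp: twist_0)
        show "unit P \<in> ?B 0" using unit_deg characterD(4)[OF \<chi>] characterD(4)[OF \<psi>] by simp
        show "mul a b x y \<in> ?B (a + b)" if "x \<in> ?B a" "y \<in> ?B b" for a b x y
          using that mul_closed[of x a y b] characterD(3)[OF \<chi>, of x a y b] characterD(3)[OF \<psi>, of x a y b] by simp
        show "x \<in> ?B d" if "(d, x) \<in> G" for d x using that G(2) val_eq by blast
      qed blast
      then have "\<chi> d x = \<psi> d x" if "x \<in> deg d" for d x using that by blast
      then show "kernel \<chi> = kernel \<psi>" by (auto simp: kernel_def fun_eq_iff)
    qed
  qed
  have "kernel \<chi> \<in> (\<Union>g\<in>{g \<in> G. fst g \<ge> 1}. kernel ` N g)" if \<chi>: "character \<chi>" for \<chi>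
  proof -
    have "\<exists>(d, x)\<in>G. d \<ge> 1 \<and> \<chi> d x \<noteq> 0"
    proof (rule ccontr)
      assume none: "\<not> ?thesis"
      \<comment> \<open>If all generators of positive degree were in the kernel, so would be
        everything of positive degree; degree 0 is left unrestricted to admit the unit.\<close>
      let ?B = "\<lambda>d. {x \<in> deg d. d \<ge> 1 \<longrightarrow> \<chi> d x = 0}"
      have "\<forall>d. ?B d = deg d"
      proof (rule gen)
        show "subspace (?B d)" for d
          using subspace_comps[of "Suc d"] characterD(1,2)[OF \<chi>] character_zero[OF \<chi>] by (auto simp: subspace_def)
        show "twist d x \<in> ?B d" if "x \<in> ?B d" for d x
          using that sgn(2)[OF \<chi>, of d x] twist_closed[of x d] by auto
        show "mul a b x y \<in> ?B (a + b)" if "x \<in> ?B a" "y \<in> ?B b" for a b x y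
          using that mul_closed[of x a y b] characterD(3)[OF \<chi>, of x a y b] by (cases "a = 0") auto
        show "x \<in> ?B d" if "(d, x) \<in> G" for d x using that G(2) none by auto
      qed (use unit_deg in auto)
      then show False using characterD(5)[OF \<chi>] by blast
    qed
    then obtain d x where g: "(d, x) \<in> G" "d \<ge> 1" "\<chi> d x \<noteq> 0" by blast
    obtain l where l: "l ^ d = inverse (\<chi> d x)" using nth_root_exists[of d] g(2) by auto
    have l0: "l \<noteq> 0" using l g(2,3) by (auto simp: power_0_left)
    have "l ^ d * \<chi> d x = 1" unfolding l using g(3) by simp
    then have "(\<lambda>d x. l ^ d * \<chi> d x) \<in> N (d, x)"
      unfolding N_def fst_conv snd_conv using character_rescale(1)[OF \<chi> l0] by blast
    then have "kernel (\<lambda>d x. l ^ d * \<chi> d x) \<in> kernel ` N (d, x)" by (rule imageI)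
    then have "kernel \<chi> \<in> kernel ` N (d, x)" unfolding character_rescale(2)[OF \<chi> l0] .
    moreover have "(d, x) \<in> {g \<in> G. fst g \<ge> 1}" using g by simp
    ultimately show ?thesis by (rule UN_I[rotated])
  qed
  then have "kernel ` {\<chi>. character \<chi>} \<subseteq> (\<Union>g\<in>{g \<in> G. fst g \<ge> 1}. kernel ` N g)" by blast
  moreover have "finite (\<Union>g\<in>{g \<in> G. fst g \<ge> 1}. kernel ` N g)" using G(1) fin by auto
  ultimately show ?thesis by (rule finite_subset)
qed

text \<open>Given \<open>x\<close> killed by \<open>\<chi>\<close> alone and \<open>b\<close> of
  positive degree not killed by \<open>\<chi>\<close>, the combination of \<open>x ^ e\<close> and
  \<open>b ^ d\<close> killed by \<open>\<psi>\<close> has a nonzero coefficient at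
  \<open>b ^ d\<close>, and so is not killed by \<open>\<chi>\<close>.\<close>

lemma kernel_incomparable:
  assumes \<chi>: "character \<chi>" and \<psi>: "character \<psi>" and sub: "\<And>d. kernel \<psi> d \<subseteq> kernel \<chi> d"
  shows "kernel \<psi> = kernel \<chi>"
proof (rule ccontr)
  assume "kernel \<psi> \<noteq> kernel \<chi>"
  then obtain d x where x: "x \<in> deg d" "\<chi> d x = 0" "\<psi> d x \<noteq> 0"
    using sub by (fastforce simp: fun_eq_iff set_eq_iff kernel_def)
  obtain e b where b: "e \<ge> 1" "b \<in> deg e" "\<chi> e b \<noteq> 0" using characterD(5)[OF \<chi>] by blast
  let ?x = "pw d x e" and ?b = "pw e b d"
  have mem: "?x \<in> deg (e * d)" "?b \<in> deg (e * d)"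
    using pw_closed[OF x(1), of e] pw_closed[OF b(2), of d] by (simp_all add: mult.commute)
  let ?z = "scl P (\<psi> e b ^ d) ?x - scl P (\<psi> d x ^ e) ?b"
  have val: "\<phi> (e * d) ?z = \<psi> e b ^ d * \<phi> d x ^ e - \<psi> d x ^ e * \<phi> e b ^ d" if \<phi>: "character \<phi>" for \<phi>
    using mem character_pw[OF \<phi> x(1), of e] character_pw[OF \<phi> b(2), of d]
    by (simp add: character_diff[OF \<phi>] subspace_scale[OF subspace_comps] characterD(2)[OF \<phi>] mult.commute)
  have "?z \<in> kernel \<psi> (e * d)"
    unfolding kernel_def using val[OF \<psi>] mem
    by (simp add: subspace_diff[OF subspace_comps] subspace_scale[OF subspace_comps])
  then have "\<chi> (e * d) ?z = 0" using sub by (auto simp: kernel_def)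
  then show False using val[OF \<chi>] x b by (simp add: power_0_left)
qed

text \<open>One character is chosen for each kernel; incomparability of the kernels gives the
  pairwise separation.\<close>

lemma character_family:
  "\<exists>(r::nat) X. (\<forall>i<r. character (X i)) \<and>
    (\<forall>d. \<forall>x\<in>deg d. (\<forall>i<r. X i d x = 0) \<longrightarrow> x = 0) \<and>
    (\<forall>i<r. \<forall>j<r. i \<noteq> j \<longrightarrow> (\<exists>d. \<exists>x\<in>deg d. X j d x = 0 \<and> X i d x \<noteq> 0))"
proof -
  let ?K = "kernel ` {\<chi>. character \<chi>}"
  obtain h where h: "bij_betw h {0..<card ?K} ?K"
    using ex_bij_betw_nat_finite[OF finite_kernels] by blast
  define X where "X i = (SOME \<chi>. character \<chi> \<and> kernel \<chi> = h i)" for i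
  have X: "character (X i)" "kernel (X i) = h i" if "i < card ?K" for i
  proof -
    have "h i \<in> ?K" using bij_betwE[OF h] that by simp
    then have "\<exists>\<chi>. character \<chi> \<and> kernel \<chi> = h i" by auto
    from someI_ex[OF this] show "character (X i)" "kernel (X i) = h i" by (auto simp: X_def)
  qed
  have "x = 0" if x: "x \<in> deg d" "\<And>i. i < card ?K \<Longrightarrow> X i d x = 0" for d x
  proof (rule ccontr)
    assume "x \<noteq> 0"
    then obtain \<chi> where \<chi>: "character \<chi>" "\<chi> d x \<noteq> 0" using character_separates[OF x(1)] by blast
    have "kernel \<chi> \<in> h ` {0..<card ?K}" using h \<chi>(1) by (simp add: bij_betw_def)
    then obtain i where i: "i < card ?K" "h i = kernel \<chi>" by auto
    have "x \<in> kernel (X i) d" using x i by (simp add: kernel_def)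
    then show False using X(2)[OF i(1)] i(2) \<chi>(2) by (simp add: kernel_def)
  qed
  moreover have "\<exists>d. \<exists>x\<in>deg d. X j d x = 0 \<and> X i d x \<noteq> 0" if ij: "i < card ?K" "j < card ?K" "i \<noteq> j" for i j
  proof (rule ccontr)
    assume "\<not> ?thesis"
    then have "kernel (X j) d \<subseteq> kernel (X i) d" for d by (auto simp: kernel_def)
    then have "kernel (X j) = kernel (X i)" using kernel_incomparable X(1) ij by blast
    then show False using X(2) ij bij_betw_imp_inj_on[OF h] by (auto simp: inj_on_def)
  qed
  ultimately show ?thesis using X(1) by blast
qed

text \<open>The product of elements separating \<open>\<chi>\<close> from the single members of
  \<open>F\<close> works for all of them.\<close>

lemma isolating_element:
  assumes \<chi>: "character \<chi>" and X: "finite F" "\<And>\<psi>. \<psi> \<in> F \<Longrightarrow> character \<psi>"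
    and sep: "\<And>\<psi>. \<psi> \<in> F \<Longrightarrow> \<exists>d. \<exists>x\<in>deg d. \<psi> d x = 0 \<and> \<chi> d x \<noteq> 0"
  shows "\<exists>d. \<exists>x\<in>deg d. \<chi> d x \<noteq> 0 \<and> (\<forall>\<psi>\<in>F. \<psi> d x = 0)"
  using X sep
proof (induction F rule: finite_induct)
  case empty
  show ?case using unit_deg characterD(4)[OF \<chi>] by force
next
  case (insert \<psi> F)
  obtain d x where x: "x \<in> deg d" "\<chi> d x \<noteq> 0" "\<forall>\<phi>\<in>F. \<phi> d x = 0" using insert by auto
  obtain e y where y: "y \<in> deg e" "\<chi> e y \<noteq> 0" "\<psi> e y = 0" using insert.prems(2)[of \<psi>] by auto
  have val: "\<phi> (d + e) (mul d e x y) = \<phi> d x * \<phi> e y" if "character \<phi>" for \<phi>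
    by (rule characterD(3)[OF that x(1) y(1)])
  have "\<chi> (d + e) (mul d e x y) \<noteq> 0" using val[OF \<chi>] x y by simp
  moreover have "\<forall>\<phi>\<in>insert \<psi> F. \<phi> (d + e) (mul d e x y) = 0"
  proof
    fix \<phi> assume \<phi>: "\<phi> \<in> insert \<psi> F"
    have "\<phi> d x * \<phi> e y = 0" using \<phi> x(3) y(3) by auto
    then show "\<phi> (d + e) (mul d e x y) = 0" using val[OF insert.prems(1)[OF \<phi>]] by simp
  qed
  ultimately show ?case using mul_closed[OF x(1) y(1)] by blast
qed

text \<open>A fixed isolating element is multiplied by elements of large degree on which
  \<open>\<chi>\<close> is nonzero; the product remains isolating.\<close>

lemma character_isolated_in_large_degrees:
  assumes \<chi>: "character \<chi>" and F: "finite F" "\<And>\<psi>. \<psi> \<in> F \<Longrightarrow> character \<psi>"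
    and sep: "\<And>\<psi>. \<psi> \<in> F \<Longrightarrow> \<exists>d. \<exists>x\<in>deg d. \<psi> d x = 0 \<and> \<chi> d x \<noteq> 0"
  shows "\<exists>w\<ge>1. (\<forall>d. \<forall>x\<in>deg d. \<chi> d x \<noteq> 0 \<longrightarrow> w dvd d) \<and>
    (\<exists>K. \<forall>d\<ge>K. w dvd d \<longrightarrow> (\<exists>x\<in>deg d. \<chi> d x \<noteq> 0 \<and> (\<forall>\<psi>\<in>F. \<psi> d x = 0)))"
proof -
  obtain D y where y: "y \<in> deg D" "\<chi> D y \<noteq> 0" "\<forall>\<psi>\<in>F. \<psi> D y = 0"
    using isolating_element[OF \<chi> F sep] by blast
  obtain w K where w: "w \<ge> 1" "\<And>d x. x \<in> deg d \<Longrightarrow> \<chi> d x \<noteq> 0 \<Longrightarrow> w dvd d"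
    "\<And>d. d \<ge> K \<Longrightarrow> w dvd d \<Longrightarrow> \<exists>x\<in>deg d. \<chi> d x \<noteq> 0"
    using character_period[OF \<chi>] by blast
  have "\<exists>x\<in>deg d. \<chi> d x \<noteq> 0 \<and> (\<forall>\<psi>\<in>F. \<psi> d x = 0)" if d: "d \<ge> D + K" "w dvd d" for d
  proof -
    have "w dvd d - D" "d - D \<ge> K" using d w(2)[OF y(1,2)] by (auto simp: dvd_diff_nat)
    then obtain z where z: "z \<in> deg (d - D)" "\<chi> (d - D) z \<noteq> 0" using w(3) by blast
    have D: "D + (d - D) = d" using d by simp
    have val: "\<phi> d (mul D (d - D) y z) = \<phi> D y * \<phi> (d - D) z" if "character \<phi>" for \<phi>
      using characterD(3)[OF that y(1) z(1)] D by simp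
    have "mul D (d - D) y z \<in> deg d" using mul_closed[OF y(1) z(1)] D by simp
    moreover have "\<psi> d (mul D (d - D) y z) = 0" if "\<psi> \<in> F" for \<psi>
      using val[OF F(2)[OF that]] y(3) that by simp
    moreover have "\<chi> d (mul D (d - D) y z) \<noteq> 0" using val[OF \<chi>] y(2) z(2) by simp
    ultimately show ?thesis by blast
  qed
  then show ?thesis using w(1,2) by blast
qed

end

section \<open>Operads with one-dimensional components and their direct sums\<close>

lemma cong_Suc_1_iff_dvd: "[Suc d = 1] (mod w) \<longleftrightarrow> w dvd d" for d w :: nat
  by (simp add: cong_altdef_nat)

lemma comps_Com_operad:
  "comps (Com_operad w :: ('k::field, 'k) operad_data) 0 = {0}"
  "comps (Com_operad w :: ('k::field, 'k) operad_data) (Suc d) = (if w dvd d then UNIV else {0})"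
  by (simp_all add: Com_operad_def cong_Suc_1_iff_dvd)

lemma comps_Ope_operad:
  "comps (Ope_operad w :: ('k::field, 'k) operad_data) 0 = {0}"
  "comps (Ope_operad w :: ('k::field, 'k) operad_data) (Suc d) = (if w dvd d then UNIV else {0})"
  by (simp_all add: Ope_operad_def cong_Suc_1_iff_dvd)

lemma pcomp_closed_periodic:
  fixes x y :: "'k::field"
  assumes "x \<in> C m" "y \<in> C n" "C 0 = {0}" "\<And>d. C (Suc d) = (if w dvd d then UNIV else {0})"
  shows "x * y \<in> C (m + n - 1)"
proof (cases "x * y = 0")
  case True
  have "0 \<in> C k" for k using assms(3,4) by (cases k) auto
  then show ?thesis unfolding True .
next
  case False
  then obtain a b where "m = Suc a" "w dvd a" "n = Suc b" "w dvd b"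
    using assms by (cases m; cases n) (auto split: if_splits)
  then show ?thesis using assms(4)[of "a + b"] by (simp add: dvd_add)
qed

lemma operad_Com: "operad (Com_operad w :: ('k::field, 'k) operad_data)"
proof -
  let ?P = "Com_operad w :: ('k, 'k) operad_data"
  have ops: "scl ?P = (*)" "act ?P n x s = x" "pcomp ?P m n i x y = x * y" "unit ?P = 1" for m n i x y s
    by (simp_all add: Com_operad_def)
  interpret vector_space "scl ?P" by unfold_locales (simp_all add: ops algebra_simps)
  have sub: "subspace (comps ?P n)" for n
    by (cases n) (simp_all add: comps_Com_operad)
  show ?thesis
    by unfold_locales
      (use sub pcomp_closed_periodic[of _ "comps ?P" _ _ _ w] in
        \<open>simp_all add: ops comps_Com_operad distrib_left distrib_right mult.commute mult.left_commute One_nat_def\<close>)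
qed

lemma operad_Ope:
  assumes "even w"
  shows "operad (Ope_operad w :: ('k::field, 'k) operad_data)"
proof -
  let ?P = "Ope_operad w :: ('k, 'k) operad_data"
  have ops: "scl ?P = (*)" "act ?P n x s = of_int (sign s) * x" "pcomp ?P m n i x y = x * y" "unit ?P = 1"
    for m n i x y s by (simp_all add: Ope_operad_def)
  interpret vector_space "scl ?P" by unfold_locales (simp_all add: ops algebra_simps)
  have sub: "subspace (comps ?P n)" for n
    by (cases n) (simp_all add: comps_Ope_operad)
  \<comment> \<open>With even \<open>w\<close>, a nonzero \<open>y\<close> has odd arity, and moving
    a block of odd length rigidly does not change the sign of \<open>s\<close>.\<close>
  have outer: "of_int (sign s) * x * y = of_int (sign (outer_perm n i s)) * (x * y)"
    if y: "y \<in> comps ?P n" and i: "1 \<le> i" "i \<le> m" and s: "s permutes {1..m}" for x y :: 'k and m n i s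
  proof (cases "y = 0")
    case False
    then obtain b where "n = Suc b" "even b"
      using y assms by (cases n) (auto simp: comps_Ope_operad split: if_splits)
    then show ?thesis using sign_outer_perm[OF s i, of b] by simp
  qed simp
  show ?thesis
  proof unfold_locales
    fix n :: nat and x s t
    assume "x \<in> comps ?P n" "s permutes {1..n}" "t permutes {1..n}"
    then show "act ?P n x (s \<circ> t) = act ?P n (act ?P n x s) t"
      using sign_compose[of s t] permutes_imp_permutation[of "{1..n}"] by (simp only: ops) (simp add: ac_simps)
  next
    fix m n i :: nat and x y t
    assume "1 \<le> i" "i \<le> m" "t permutes {1..n}"
    then show "pcomp ?P m n i x (act ?P n y t) = act ?P (m + n - 1) (pcomp ?P m n i x y) (inner_perm n i t)"
      using sign_inner_perm[of t n i m] by (simp only: ops) (simp add: ac_simps)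
  next
    fix m n i :: nat and x y s
    assume "y \<in> comps ?P n" "1 \<le> i" "i \<le> m" "s permutes {1..m}"
    then show "pcomp ?P m n i (act ?P m x s) y = act ?P (m + n - 1) (pcomp ?P m n (s i) x y) (outer_perm n i s)"
      unfolding ops by (rule outer)
  next
    fix n :: nat and x s assume "x \<in> comps ?P n"
    then show "act ?P n x s \<in> comps ?P n"
      by (cases n) (auto simp: ops comps_Ope_operad split: if_splits)
  next
    show "unit ?P \<in> comps ?P 1" by (simp add: ops comps_Ope_operad One_nat_def)
  next
    fix m n i :: nat and x y assume "x \<in> comps ?P m" "y \<in> comps ?P n"
    then show "pcomp ?P m n i x y \<in> comps ?P (m + n - 1)"
      unfolding ops by (rule pcomp_closed_periodic[where C = "comps ?P" and w = w]) (simp_all add: comps_Ope_operad)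
  qed (simp_all only: sub, simp_all add: ops distrib_left distrib_right mult.commute mult.left_commute)
qed

lemma operad_direct_sum:
  fixes Q :: "'i \<Rightarrow> ('k::field, 'a::ab_group_add) operad_data"
  assumes "\<And>i. operad (Q i)"
  shows "operad (direct_sum_operad I Q)"
proof -
  interpret Q: operad "Q i" for i by fact
  let ?D = "direct_sum_operad I Q"
  have ops: "scl ?D = (\<lambda>c x i. scl (Q i) c (x i))"
    "act ?D n x s = (\<lambda>i. if i \<in> I then act (Q i) n (x i) s else 0)"
    "pcomp ?D m n j x y = (\<lambda>i. if i \<in> I then pcomp (Q i) m n j (x i) (y i) else 0)"
    "unit ?D = (\<lambda>i. if i \<in> I then unit (Q i) else 0)" for m n j x y s
    by (simp_all add: direct_sum_operad_def)
  have comps: "x \<in> comps ?D n \<longleftrightarrow> (\<forall>i. if i \<in> I then x i \<in> comps (Q i) n else x i = 0)" for x n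
    by (auto simp: direct_sum_operad_def)
  have compsD: "x i \<in> comps (Q i) n" if "x \<in> comps ?D n" "i \<in> I" for x n i
    using that by (auto simp: comps dest: spec[of _ i])
  have compsD0: "x i = 0" if "x \<in> comps ?D n" "i \<notin> I" for x n i
    using that by (auto simp: comps dest: spec[of _ i])
  interpret vector_space "scl ?D"
    by unfold_locales (auto simp: ops fun_eq_iff Q.scale_right_distrib Q.scale_left_distrib)
  have sub: "subspace (comps ?D n)" for n
    unfolding subspace_def
  proof (intro conjI ballI allI)
    show "0 \<in> comps ?D n" using Q.subspace_0[OF Q.subspace_comps] by (simp add: comps)
    show "x + y \<in> comps ?D n" if "x \<in> comps ?D n" "y \<in> comps ?D n" for x y
      unfolding comps using Q.subspace_add[OF Q.subspace_comps compsD[OF that(1)] compsD[OF that(2)]]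
        compsD0[OF that(1)] compsD0[OF that(2)] by simp
    show "scl ?D c x \<in> comps ?D n" if "x \<in> comps ?D n" for c x
      unfolding comps ops using Q.subspace_scale[OF Q.subspace_comps compsD[OF that]] compsD0[OF that] by simp
  qed
  show ?thesis
  proof unfold_locales
    show "subspace (comps ?D n)" for n by (rule sub)
    fix n :: nat and x s assume x: "x \<in> comps ?D n" and s: "s permutes {1..n}"
    show "act ?D n x s \<in> comps ?D n" using Q.act_closed[OF compsD[OF x] s] by (simp add: comps ops)
    show "act ?D n (x + y) s = act ?D n x s + act ?D n y s" if "y \<in> comps ?D n" for y
      using Q.act_add[OF compsD[OF x] compsD[OF that] s] by (auto simp: ops fun_eq_iff)
    show "act ?D n (scl ?D c x) s = scl ?D c (act ?D n x s)" for c
      using Q.act_scl[OF compsD[OF x] s] by (auto simp: ops fun_eq_iff)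
    show "act ?D n x (s \<circ> t) = act ?D n (act ?D n x s) t" if "t permutes {1..n}" for t
      using Q.act_comp[OF compsD[OF x] s that] by (simp add: ops fun_eq_iff comp_def)
  next
    show "act ?D n x id = x" if "x \<in> comps ?D n" for n x
      using Q.act_id[OF compsD[OF that]] compsD0[OF that] by (auto simp: ops fun_eq_iff id_def)
  next
    fix m n i :: nat and x y assume x: "x \<in> comps ?D m" and y: "y \<in> comps ?D n" and i: "1 \<le> i" "i \<le> m"
    show "pcomp ?D m n i x y \<in> comps ?D (m + n - 1)"
      using Q.pcomp_closed[OF compsD[OF x] compsD[OF y] i] by (simp add: comps ops)
    show "pcomp ?D m n i (x + x') y = pcomp ?D m n i x y + pcomp ?D m n i x' y" if "x' \<in> comps ?D m" for x'
      using Q.pcomp_add_left[OF compsD[OF x] compsD[OF that] compsD[OF y] i] by (auto simp: ops fun_eq_iff)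
    show "pcomp ?D m n i x (y + y') = pcomp ?D m n i x y + pcomp ?D m n i x y'" if "y' \<in> comps ?D n" for y'
      using Q.pcomp_add_right[OF compsD[OF x] compsD[OF y] compsD[OF that] i] by (auto simp: ops fun_eq_iff)
    show "pcomp ?D m n i (scl ?D c x) y = scl ?D c (pcomp ?D m n i x y)" for c
      using Q.pcomp_scl_left[OF compsD[OF x] compsD[OF y] i] by (auto simp: ops fun_eq_iff)
    show "pcomp ?D m n i x (scl ?D c y) = scl ?D c (pcomp ?D m n i x y)" for c
      using Q.pcomp_scl_right[OF compsD[OF x] compsD[OF y] i] by (auto simp: ops fun_eq_iff)
    show "pcomp ?D m n i x (act ?D n y t) = act ?D (m + n - 1) (pcomp ?D m n i x y) (inner_perm n i t)"
      if "t permutes {1..n}" for t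
      using Q.equivariance_right[OF compsD[OF x] compsD[OF y] i that] by (auto simp: ops fun_eq_iff)
    show "pcomp ?D m n i (act ?D m x s) y = act ?D (m + n - 1) (pcomp ?D m n (s i) x y) (outer_perm n i s)"
      if "s permutes {1..m}" for s
      using Q.equivariance_left[OF compsD[OF x] compsD[OF y] i that] by (auto simp: ops fun_eq_iff)
  next
    show "unit ?D \<in> comps ?D 1" using Q.unit_closed by (simp add: comps ops)
    show "pcomp ?D 1 n 1 (unit ?D) x = x" if "x \<in> comps ?D n" for n x
      using Q.unit_left[OF compsD[OF that]] compsD0[OF that] by (auto simp: ops fun_eq_iff)
    show "pcomp ?D n 1 i x (unit ?D) = x" if "x \<in> comps ?D n" "1 \<le> i" "i \<le> n" for n i x
      using Q.unit_right[OF compsD[OF that(1)] that(2,3)] compsD0[OF that(1)] by (auto simp: ops fun_eq_iff)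
  next
    fix l m n i k j :: nat and x y z
    assume x: "x \<in> comps ?D l" and y: "y \<in> comps ?D m" and z: "z \<in> comps ?D n" and i: "1 \<le> i"
    show "pcomp ?D (l + m - 1) n (i - 1 + j) (pcomp ?D l m i x y) z = pcomp ?D l (m + n - 1) i x (pcomp ?D m n j y z)"
      if "i \<le> l" "1 \<le> j" "j \<le> m"
      using Q.assoc_sequential[OF compsD[OF x] compsD[OF y] compsD[OF z] i that] by (auto simp: ops fun_eq_iff)
    show "pcomp ?D (l + m - 1) n (k - 1 + m) (pcomp ?D l m i x y) z = pcomp ?D (l + n - 1) m i (pcomp ?D l n k x z) y"
      if "i < k" "k \<le> l"
      using Q.assoc_parallel[OF compsD[OF x] compsD[OF y] compsD[OF z] i that] by (auto simp: ops fun_eq_iff)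
  qed
qed

text \<open>Both families under one name, selected by the scalar by which transpositions act. In
  characteristic 2 the two scalars coincide and \<open>Com_operad\<close> is taken.\<close>

definition periodic_operad :: "nat \<Rightarrow> 'k \<Rightarrow> ('k::field, 'k) operad_data" where
  "periodic_operad w \<epsilon> = (if \<epsilon> = 1 then Com_operad w else Ope_operad w)"

lemma periodic_operad_simps:
  "scl (periodic_operad w \<epsilon>) = (*)"
  "comps (periodic_operad w \<epsilon>) 0 = {0}"
  "comps (periodic_operad w \<epsilon>) (Suc d) = (if w dvd d then UNIV else {0})"
  "pcomp (periodic_operad w \<epsilon>) m n i x y = x * y"
  "unit (periodic_operad w \<epsilon>) = 1"
  unfolding periodic_operad_def
  by (cases "\<epsilon> = 1"; simp add: comps_Com_operad comps_Ope_operad; simp add: Com_operad_def Ope_operad_def)+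

lemma periodic_operad_act:
  assumes "\<epsilon> = 1 \<or> \<epsilon> = - 1"
  shows "act (periodic_operad w \<epsilon>) n x s = (if sign s = 1 then x else \<epsilon> * x)"
  using assms by (cases s rule: sign_cases) (auto simp: periodic_operad_def Com_operad_def Ope_operad_def)

lemma operad_periodic: "\<epsilon> = 1 \<or> even w \<Longrightarrow> operad (periodic_operad w \<epsilon>)"
  by (auto simp: periodic_operad_def operad_Com operad_Ope)

section \<open>The model direct sums and their torsionfreeness\<close>

locale periodic_sum =
  fixes r :: nat and w :: "nat \<Rightarrow> nat" and \<epsilon> :: "nat \<Rightarrow> 'k::field"
  assumes w_pos: "w i \<ge> 1" and sgn: "\<epsilon> i = 1 \<or> \<epsilon> i = - 1" and even_w: "\<epsilon> i = 1 \<or> even (w i)"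
begin

definition D :: "('k, nat \<Rightarrow> 'k) operad_data" where
  "D = direct_sum_operad {..<r} (\<lambda>i. periodic_operad (w i) (\<epsilon> i))"

lemma scl_D: "scl D c x = (\<lambda>i. c * x i)"
  by (simp add: D_def direct_sum_operad_def periodic_operad_simps)

lemma mem_comps_D_0: "x \<in> comps D 0 \<longleftrightarrow> x = 0"
  by (auto simp: D_def direct_sum_operad_def periodic_operad_simps fun_eq_iff)

lemma mem_comps_D_Suc: "x \<in> comps D (Suc d) \<longleftrightarrow> (\<forall>i. i < r \<and> w i dvd d \<or> x i = 0)"
  unfolding D_def direct_sum_operad_def periodic_operad_simps operad_data.simps
  by (auto split: if_splits)

lemma act_D: "act D n x s = (\<lambda>i. if i < r then if sign s = 1 then x i else \<epsilon> i * x i else 0)"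
  by (auto simp: D_def direct_sum_operad_def periodic_operad_act[OF sgn] fun_eq_iff)

lemma pcomp_D: "pcomp D m n j x y = (\<lambda>i. if i < r then x i * y i else 0)"
  by (auto simp: D_def direct_sum_operad_def periodic_operad_simps fun_eq_iff)

lemma unit_D: "unit D = (\<lambda>i. if i < r then 1 else 0)"
  by (auto simp: D_def direct_sum_operad_def periodic_operad_simps fun_eq_iff)

definition basis_vector :: "nat \<Rightarrow> nat \<Rightarrow> 'k" where
  "basis_vector i = (\<lambda>j. if j = i then 1 else 0)"

lemma basis_vector_mem: "i < r \<Longrightarrow> w i dvd d \<Longrightarrow> basis_vector i \<in> comps D (Suc d)"
  by (simp add: mem_comps_D_Suc basis_vector_def)

sublocale D: operad D
  unfolding D_def by (intro operad_direct_sum operad_periodic even_w)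

sublocale D: reduced_lf_operad D
proof unfold_locales
  show "comps D 0 = {0}" using mem_comps_D_0 by auto
  show "\<exists>B. finite B \<and> comps D n = D.span B" for n
  proof (cases n)
    case 0
    then show ?thesis using mem_comps_D_0 by (intro exI[of _ "{}"]) auto
  next
    case (Suc d)
    let ?J = "{i. i < r \<and> w i dvd d}"
    have "x \<in> D.span (basis_vector ` ?J)" if x: "x \<in> comps D n" for x
    proof -
      have "x = (\<Sum>i\<in>?J. scl D (x i) (basis_vector i))"
        using x unfolding Suc mem_comps_D_Suc
        by (auto simp: fun_eq_iff sum_fun_apply scl_D basis_vector_def if_distrib[of "(*) _"] cong: if_cong)
      also have "\<dots> \<in> D.span (basis_vector ` ?J)"
        by (intro D.span_sum D.span_scale D.span_base) auto
      finally show ?thesis .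
    qed
    moreover have "D.span (basis_vector ` ?J) \<subseteq> comps D n"
      unfolding Suc by (intro D.span_minimal D.subspace_comps) (auto intro: basis_vector_mem)
    ultimately show ?thesis by (intro exI[of _ "basis_vector ` ?J"]) auto
  qed
qed

lemma left_torsionfree_D: "left_torsionfree D"
  unfolding left_torsionfree_def
proof
  fix m
  have "x = 0" if x: "x \<in> left_torsion D m" for x
  proof (rule ccontr)
    assume "x \<noteq> 0"
    then obtain i where i: "x i \<noteq> 0" by (auto simp: fun_eq_iff)
    have xm: "x \<in> comps D m" using x by (simp add: left_torsion_def)
    then obtain d where d: "m = Suc d" using i mem_comps_D_0 by (cases m) auto
    have ir: "i < r" using xm i unfolding d mem_comps_D_Suc by blast
    obtain n0 where n0: "\<And>n. n \<ge> n0 \<Longrightarrow> coll_comp D (\<lambda>k. if k \<ge> n then comps D k else {0})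
        (\<lambda>k. if k = m then D.span {x} else {0}) = zero_coll"
      using x unfolding left_torsion_def eventually_sequentially by blast
    \<comment> \<open>An arity beyond the bound \<open>n0\<close> in which summand \<open>i\<close>
      is nonzero, so that its basis vector detects the coordinate \<open>x i\<close>.\<close>
    define k where "k = Suc (w i * n0)"
    have k: "k \<ge> n0" using w_pos[of i] by (simp add: k_def trans_le_add2 le_SucI)
    have p: "basis_vector i \<in> comps D k" unfolding k_def by (rule basis_vector_mem[OF ir]) simp
    let ?X = "\<lambda>N. {pcomp D m' n' j u v | m' n' j u v. u \<in> (if n0 \<le> m' then comps D m' else {0}) \<and>
      v \<in> (if n' = m then D.span {x} else {0}) \<and> 1 \<le> j \<and> j \<le> m' \<and> N = m' + n' - 1}"
    have "pcomp D k m 1 (basis_vector i) x \<in> ?X (k + m - 1)"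
      using p k D.span_base[of x "{x}"] unfolding k_def
      by (intro CollectI exI[of _ k] exI[of _ m] exI[of _ "1::nat"] exI[of _ "basis_vector i"] exI[of _ x])
        (auto simp: k_def)
    then have "pcomp D k m 1 (basis_vector i) x \<in> S_submodule_generated D ?X (k + m - 1)"
      unfolding S_submodule_generated_def by blast
    then have "pcomp D k m 1 (basis_vector i) x = 0"
      using fun_cong[OF n0[OF order_refl], of "k + m - 1"] unfolding coll_comp_def by simp
    then have "pcomp D k m 1 (basis_vector i) x i = 0" by simp
    then show False using i ir by (simp add: pcomp_D basis_vector_def)
  qed
  moreover have "0 \<in> left_torsion D m"
  proof -
    have "coll_comp D (\<lambda>k. if k \<ge> n then comps D k else {0}) (\<lambda>k. if k = m then D.span {0} else {0}) = zero_coll" for n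
      unfolding coll_comp_def
    proof (rule S_submodule_generated_zero[OF D.vector_space_axioms D.S_submodule_zero], rule subsetI, elim CollectE exE conjE)
      fix N z m' n' j u v
      assume "z = pcomp D m' n' j u v" "v \<in> (if n' = m then D.span {0} else {0})"
      then show "z \<in> {0}" by (auto simp: pcomp_D fun_eq_iff split: if_splits)
    qed
    then show ?thesis unfolding left_torsion_def using D.subspace_0[OF D.subspace_comps] by simp
  qed
  ultimately show "left_torsion D m = {0}" by auto
qed

end

section \<open>Saturation and the classification\<close>

context gk_one_operad
begin

lemma character_sum:
  assumes "character \<chi>" "finite S" "\<And>i. i \<in> S \<Longrightarrow> f i \<in> deg d"
  shows "\<chi> d (sum f S) = (\<Sum>i\<in>S. \<chi> d (f i))"
  using assms(2,3)
proof (induction S rule: finite_induct)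
  case empty
  then show ?case by (simp add: character_zero[OF assms(1)])
next
  case (insert i S)
  have "sum f S \<in> deg d" by (rule subspace_sum[OF subspace_comps]) (use insert in simp)
  then show ?case using insert by (simp add: characterD(1)[OF assms(1)])
qed

text \<open>The coordinates of \<open>\<phi>\<close> are the chosen characters. Injectivity is their
  joint separation of points; equality in large arities comes from isolating elements.\<close>

lemma embedding_into_periodic_sum:
  "\<exists>r w (\<epsilon> :: nat \<Rightarrow> 'k) \<phi> W. periodic_sum w \<epsilon> \<and> operad_inj_hom P (periodic_sum.D r w \<epsilon>) \<phi> \<and>
    (\<forall>n\<ge>W. \<phi> n ` comps P n = comps (periodic_sum.D r w \<epsilon>) n)"
proof -
  obtain r :: nat and X where fam: "\<forall>i<r. character (X i)"
    "\<forall>d. \<forall>x\<in>deg d. (\<forall>i<r. X i d x = 0) \<longrightarrow> x = 0"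
    "\<forall>i<r. \<forall>j<r. i \<noteq> j \<longrightarrow> (\<exists>d. \<exists>x\<in>deg d. X j d x = 0 \<and> X i d x \<noteq> 0)"
    using character_family by (elim exE conjE)
  have X: "\<And>i. i < r \<Longrightarrow> character (X i)"
    and inj: "\<And>d x. \<lbrakk>x \<in> deg d; \<And>i. i < r \<Longrightarrow> X i d x = 0\<rbrakk> \<Longrightarrow> x = 0"
    and sep: "\<And>i j. \<lbrakk>i < r; j < r; i \<noteq> j\<rbrakk> \<Longrightarrow> \<exists>d. \<exists>x\<in>deg d. X j d x = 0 \<and> X i d x \<noteq> 0"
    using fam by simp_all
  \<comment> \<open>The locale \<open>periodic_sum\<close> constrains the parameters at all indices,
    so \<open>\<epsilon>\<close> gets the default 1 beyond \<open>r\<close>; likewise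
    \<open>w\<close> is chosen positive everywhere.\<close>
  have "\<exists>\<epsilon>. \<forall>i. (\<epsilon> i = 1 \<or> \<epsilon> i = - 1) \<and> (i < r \<longrightarrow> (\<forall>d\<ge>1. \<forall>x\<in>deg d. X i d (twist d x) = \<epsilon> i * X i d x)) \<and>
      (\<not> i < r \<longrightarrow> \<epsilon> i = 1)"
    using character_twist[OF X] by (intro choice) blast
  then obtain \<epsilon> where \<epsilon>: "\<And>i. \<epsilon> i = 1 \<or> \<epsilon> i = - 1" "\<And>i. \<not> i < r \<Longrightarrow> \<epsilon> i = 1"
    "\<And>i d x. \<lbrakk>i < r; d \<ge> 1; x \<in> deg d\<rbrakk> \<Longrightarrow> X i d (twist d x) = \<epsilon> i * X i d x"
    by blast
  define period where "period i v \<longleftrightarrow> (\<forall>d. \<forall>x\<in>deg d. X i d x \<noteq> 0 \<longrightarrow> v dvd d)" for i v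
  define isolated where "isolated i v K \<longleftrightarrow> (\<forall>d\<ge>K. v dvd d \<longrightarrow>
    (\<exists>x\<in>deg d. X i d x \<noteq> 0 \<and> (\<forall>\<psi>\<in>X ` ({..<r} - {i}). \<psi> d x = 0)))" for i v K
  have period_ex: "\<exists>v\<ge>1. period i v \<and> (\<exists>K. isolated i v K)" if i: "i < r" for i
    unfolding period_def isolated_def
  proof (rule character_isolated_in_large_degrees[OF X[OF i]])
    fix \<psi> assume "\<psi> \<in> X ` ({..<r} - {i})"
    then obtain j where j: "\<psi> = X j" "j < r" "i \<noteq> j" by auto
    show "character \<psi>" unfolding j(1) by (rule X[OF j(2)])
    show "\<exists>d. \<exists>x\<in>deg d. \<psi> d x = 0 \<and> X i d x \<noteq> 0" unfolding j(1) by (rule sep[OF i j(2,3)])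
  qed simp
  have "\<exists>v K. v \<ge> 1 \<and> (i < r \<longrightarrow> period i v \<and> isolated i v K)" for i
    using period_ex[of i] by (cases "i < r") auto
  then obtain w K where wK: "\<And>i. w i \<ge> 1" "\<And>i. i < r \<Longrightarrow> period i (w i)" "\<And>i. i < r \<Longrightarrow> isolated i (w i) (K i)"
    by metis
  have w: "\<And>i. w i \<ge> 1" "\<And>i d x. \<lbrakk>i < r; x \<in> deg d; X i d x \<noteq> 0\<rbrakk> \<Longrightarrow> w i dvd d"
    using wK(1) wK(2)[unfolded period_def] by blast+
  have K: "\<And>i d. \<lbrakk>i < r; d \<ge> K i; w i dvd d\<rbrakk>
      \<Longrightarrow> \<exists>x\<in>deg d. X i d x \<noteq> 0 \<and> (\<forall>\<psi>\<in>X ` ({..<r} - {i}). \<psi> d x = 0)"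
    using wK(3) by (simp only: isolated_def)
  have even_w: "\<epsilon> i = 1 \<or> even (w i)" for i
  proof (rule ccontr)
    assume "\<not> ?thesis"
    then have e: "\<epsilon> i \<noteq> 1" and odd: "odd (w i)" by auto
    have i: "i < r" using e \<epsilon>(2) by blast
    \<comment> \<open>An odd degree, large enough for the character to be nonzero there. Since
      \<open>twist\<close> is trivial in odd degrees, the sign of the character must be 1.\<close>
    define d where "d = w i * (2 * K i + 1)"
    have "2 * K i + 1 \<le> w i * (2 * K i + 1)" using mult_le_mono1[OF w(1)[of i], of "2 * K i + 1"] by simp
    then have Kd: "2 * K i + 1 \<le> d" by (simp only: d_def)
    have "K i \<le> 2 * K i + 1" by simp
    then have "K i \<le> d" using Kd by (rule le_trans)
    moreover have "1 \<le> d" using le_trans[OF le_add2 Kd] .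
    moreover have "odd d" "w i dvd d" using odd by (simp_all add: d_def)
    ultimately have d: "odd d" "d \<ge> K i" "d \<ge> 1" "w i dvd d" by blast+
    obtain x where x: "x \<in> deg d" "X i d x \<noteq> 0" using K[OF i d(2,4)] by blast
    then show False using \<epsilon>(3)[OF i d(3) x(1)] twist_odd[OF x(1) d(1)] e by simp
  qed
  interpret S: periodic_sum r w \<epsilon>
    by unfold_locales (use w(1) \<epsilon>(1) even_w in auto)
  define \<phi> where "\<phi> n x = (\<lambda>i. if i < r then case n of 0 \<Rightarrow> 0 | Suc d \<Rightarrow> X i d x else 0)" for n x
  have \<phi>0: "\<phi> 0 x = 0" for x by (simp add: \<phi>_def fun_eq_iff)
  have \<phi>S: "\<phi> (Suc d) x = (\<lambda>i. if i < r then X i d x else 0)" for d x by (auto simp: \<phi>_def fun_eq_iff)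
  have \<phi>_zero: "\<phi> n 0 = 0" for n
    by (cases n) (auto simp: \<phi>0 \<phi>S fun_eq_iff character_zero[OF X])
  have hom: "operad_hom P S.D \<phi>"
    unfolding operad_hom_def
  proof (intro conjI allI ballI impI)
    fix n x assume x: "x \<in> comps P n"
    show "\<phi> n x \<in> comps S.D n"
    proof (cases n)
      case 0
      then show ?thesis by (simp add: \<phi>0 S.mem_comps_D_0)
    next
      case (Suc d)
      then show ?thesis using w(2)[of _ x d] x by (auto simp: \<phi>S S.mem_comps_D_Suc)
    qed
    show "\<phi> n (x + y) = \<phi> n x + \<phi> n y" if "y \<in> comps P n" for y
      using x that by (cases n) (auto simp: \<phi>0 \<phi>S fun_eq_iff characterD(1)[OF X])
    show "\<phi> n (scl P c x) = scl S.D c (\<phi> n x)" for c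
      using x by (cases n) (auto simp: \<phi>0 \<phi>S fun_eq_iff characterD(2)[OF X] S.scl_D)
    show "\<phi> n (act P n x s) = act S.D n (\<phi> n x) s" if s: "s permutes {1..n}" for s
    proof (cases n)
      case 0
      then show ?thesis by (simp add: \<phi>0 S.act_D fun_eq_iff)
    next
      case (Suc d)
      \<comment> \<open>The sign rule for characters holds in positive degrees only; in arity 1
        there is no odd permutation.\<close>
      have d: "d \<ge> 1" if "sign s \<noteq> 1"
      proof (rule ccontr)
        assume "\<not> d \<ge> 1"
        then have "d = 0" by (cases d) auto
        then have "s permutes {1}" using s Suc by (simp add: One_nat_def)
        then show False using that by (simp add: permutes_sing)
      qed
      show ?thesis
        unfolding Suc \<phi>S S.act_D act_eq_twist[OF s[unfolded Suc] x[unfolded Suc]]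
        using \<epsilon>(3)[OF _ d] x Suc by (auto simp: fun_eq_iff)
    qed
  next
    fix m n i x y
    assume x: "x \<in> comps P m" and y: "y \<in> comps P n" and i: "1 \<le> i \<and> i \<le> m"
    obtain a where a: "m = Suc a" using i by (cases m) auto
    show "\<phi> (m + n - 1) (pcomp P m n i x y) = pcomp S.D m n i (\<phi> m x) (\<phi> n y)"
    proof (cases n)
      case 0
      then have "y = 0" using y reduced by simp
      then have "pcomp P m n i x y = 0" using x i by (simp add: pcomp_zero_right)
      then show ?thesis by (simp add: \<phi>_zero \<phi>0 0 S.pcomp_D fun_eq_iff)
    next
      case (Suc b)
      have "pcomp P m n i x y = mul a b x y" using pc_eq_mul[of x a y b i] x y i a Suc by simp
      then show ?thesis
        using x y a Suc by (auto simp: \<phi>S S.pcomp_D fun_eq_iff characterD(3)[OF X])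
    qed
  next
    show "\<phi> 1 (unit P) = unit S.D"
      by (auto simp: One_nat_def \<phi>S S.unit_D fun_eq_iff characterD(4)[OF X])
  qed
  have inj_on: "inj_on (\<phi> n) (comps P n)" for n
  proof (rule inj_onI)
    fix x y assume x: "x \<in> comps P n" and y: "y \<in> comps P n" and eq: "\<phi> n x = \<phi> n y"
    show "x = y"
    proof (cases n)
      case 0
      then show ?thesis using x y reduced by auto
    next
      case (Suc d)
      have "X i d x = X i d y" if "i < r" for i
        using fun_cong[OF eq[unfolded Suc \<phi>S], of i] that by simp
      then have "x - y = 0"
        using x y unfolding Suc by (intro inj[of _ d] subspace_diff[OF subspace_comps]) (simp_all add: character_diff[OF X])
      then show ?thesis by simp
    qed
  qed
  \<comment> \<open>The sum bounds each threshold \<open>K i\<close>, and \<open>Suc\<close>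
    converts degrees into arities.\<close>
  define W where "W = Suc (\<Sum>i<r. K i)"
  have "\<phi> n ` comps P n = comps S.D n" if n: "n \<ge> W" for n
  proof
    show "\<phi> n ` comps P n \<subseteq> comps S.D n" using hom by (auto simp: operad_hom_def)
    show "comps S.D n \<subseteq> \<phi> n ` comps P n"
    proof
      fix q assume q: "q \<in> comps S.D n"
      obtain d where d: "n = Suc d" "d \<ge> (\<Sum>i<r. K i)" using n unfolding W_def by (cases n) auto
      let ?J = "{i. i < r \<and> w i dvd d}"
      have "\<exists>z. z \<in> deg d \<and> X i d z \<noteq> 0 \<and> (\<forall>j<r. j \<noteq> i \<longrightarrow> X j d z = 0)" if "i \<in> ?J" for i
      proof -
        have "K i \<le> (\<Sum>i<r. K i)" using that by (intro member_le_sum) auto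
        then show ?thesis using K[of i d] that d(2) by fastforce
      qed
      then obtain z where z: "\<And>i. i \<in> ?J \<Longrightarrow> z i \<in> deg d \<and> X i d (z i) \<noteq> 0 \<and> (\<forall>j<r. j \<noteq> i \<longrightarrow> X j d (z i) = 0)"
        by metis
      \<comment> \<open>Interpolation: each \<open>z i\<close> is nonzero under exactly one of the
        characters, so its coefficient adjusts one coordinate of \<open>q\<close>
        independently.\<close>
      define x where "x = (\<Sum>i\<in>?J. scl P (q i / X i d (z i)) (z i))"
      have zs: "scl P c (z i) \<in> deg d" if "i \<in> ?J" for i c
        using z[OF that] by (intro subspace_scale[OF subspace_comps]) blast
      have x: "x \<in> deg d" unfolding x_def by (rule subspace_sum[OF subspace_comps]) (rule zs)
      have "X j d x = q j" if j: "j < r" for j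
      proof -
        have "X j d x = (\<Sum>i\<in>?J. X j d (scl P (q i / X i d (z i)) (z i)))"
          unfolding x_def using zs by (intro character_sum X j) auto
        also have "\<dots> = (\<Sum>i\<in>?J. if i = j then q j else 0)"
          using z j by (intro sum.cong refl) (auto simp: characterD(2)[OF X[OF j]])
        also have "\<dots> = (if j \<in> ?J then q j else 0)" by simp
        also have "\<dots> = q j" using q j unfolding d S.mem_comps_D_Suc by auto
        finally show ?thesis .
      qed
      moreover have "q j = 0" if "\<not> j < r" for j using q that unfolding d S.mem_comps_D_Suc by blast
      ultimately have "\<phi> n x = q" unfolding d \<phi>S by (auto simp: fun_eq_iff)
      then show "q \<in> \<phi> n ` comps P n" using x d by blast
    qed
  qed
  then show ?thesis
    using S.periodic_sum_axioms hom inj_on unfolding operad_inj_hom_def by blast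
qed

end

text \<open>Saturation extends the inverse of \<open>\<phi>\<close> in large arities to a
  homomorphism \<open>g\<close> from \<open>D\<close> to \<open>P\<close>, but does not say that
  \<open>g\<close> is inverse to \<open>\<phi>\<close> in small arities. Composition with basis
  vectors of large arity shows that it is a right inverse, which gives surjectivity.\<close>

lemma (in periodic_sum) iso_if_saturated:
  fixes P :: "('k, 'a::ab_group_add) operad_data"
  assumes sat: "saturated_operad P" and hom: "operad_inj_hom P D \<phi>"
    and large: "\<And>n. n \<ge> W \<Longrightarrow> \<phi> n ` comps P n = comps D n"
    and P: "operad P"
  shows "operad_iso P D \<phi>"
proof -
  interpret P: operad P by fact
  have \<phi>: "\<And>n x. x \<in> comps P n \<Longrightarrow> \<phi> n x \<in> comps D n"
    "\<And>n x y. x \<in> comps P n \<Longrightarrow> y \<in> comps P n \<Longrightarrow> \<phi> n (x + y) = \<phi> n x + \<phi> n y"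
    "\<And>n c x. x \<in> comps P n \<Longrightarrow> \<phi> n (scl P c x) = scl D c (\<phi> n x)"
    "\<And>n s x. x \<in> comps P n \<Longrightarrow> s permutes {1..n} \<Longrightarrow> \<phi> n (act P n x s) = act D n (\<phi> n x) s"
    "\<And>m n i x y. x \<in> comps P m \<Longrightarrow> y \<in> comps P n \<Longrightarrow> 1 \<le> i \<Longrightarrow> i \<le> m \<Longrightarrow>
      \<phi> (m + n - 1) (pcomp P m n i x y) = pcomp D m n i (\<phi> m x) (\<phi> n y)"
    "\<phi> 1 (unit P) = unit D"
    "\<And>n. inj_on (\<phi> n) (comps P n)"
    using hom unfolding operad_inj_hom_def operad_hom_def by blast+
  \<comment> \<open>Saturation refers to truncations at 2 or more.\<close>
  define V where "V = max W 2"
  define f where "f n = inv_into (comps P n) (\<phi> n)" for n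
  have f\<phi>: "f n (\<phi> n x) = x" if "x \<in> comps P n" for n x
    unfolding f_def using \<phi>(7) that by (rule inv_into_f_f)
  let ?tD = "truncated_operad V D" and ?tP = "truncated_operad V P"
  have tr: "scl ?tD = scl D" "act ?tD = act D" "pcomp ?tD = pcomp D" "unit ?tD = unit D"
    "scl ?tP = scl P" "act ?tP = act P" "pcomp ?tP = pcomp P" "unit ?tP = unit P"
    by (simp_all add: truncated_operad_def)
  have comps_tD: "comps ?tD n = (if n = 1 then D.span {unit D} else if n < V then {0} else comps D n)"
    and comps_tP: "comps ?tP n = (if n = 1 then P.span {unit P} else if n < V then {0} else comps P n)" for n
    by (simp_all add: truncated_operad_def)
  have span_P: "P.span {unit P} \<subseteq> comps P 1"
    using P.unit_closed by (intro P.span_minimal P.subspace_comps) simp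
  have tP_sub: "comps ?tP n \<subseteq> comps P n" for n
    using span_P P.subspace_0[OF P.subspace_comps] by (auto simp: comps_tP)
  have \<phi>0: "\<phi> n 0 = 0" for n
    using \<phi>(3)[of 0 n 0] P.subspace_0[OF P.subspace_comps] by simp
  have image: "\<phi> n ` comps ?tP n = comps ?tD n" for n
  proof -
    consider "n = 1" | "n \<noteq> 1" "n < V" | "n \<noteq> 1" "\<not> n < V" by blast
    then show ?thesis
    proof cases
      case 1
      have "\<phi> 1 (scl P c (unit P)) = scl D c (unit D)" for c
        using \<phi>(3)[OF P.unit_closed] \<phi>(6) by simp
      then show ?thesis
        using 1 by (simp add: comps_tP comps_tD P.span_singleton D.span_singleton image_image)
    next
      case 2
      then show ?thesis by (simp add: comps_tP comps_tD \<phi>0)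
    next
      case 3
      then have "W \<le> n" by (simp add: V_def)
      then show ?thesis using 3 large[of n] by (simp add: comps_tP comps_tD)
    qed
  qed
  have bij: "bij_betw (f n) (comps ?tD n) (comps ?tP n)" for n
  proof -
    have "bij_betw (\<phi> n) (comps ?tP n) (comps ?tD n)"
      unfolding bij_betw_def using inj_on_subset[OF \<phi>(7) tP_sub] image by blast
    moreover have "f n (\<phi> n x) = x" if "x \<in> comps ?tP n" for x using f\<phi> tP_sub that by blast
    ultimately show ?thesis
      by (intro bij_betw_byWitness[where f' = "\<phi> n"]) (auto simp: image[symmetric])
  qed
  have pre: "\<exists>x\<in>comps P n. x \<in> comps ?tP n \<and> u = \<phi> n x" if "u \<in> comps ?tD n" for n u
    using that tP_sub unfolding image[symmetric] by blast
  have "operad_iso ?tD ?tP f"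
    unfolding operad_iso_def operad_hom_def tr
  proof (intro conjI allI ballI impI bij)
    fix n u assume u: "u \<in> comps ?tD n"
    obtain x where x: "x \<in> comps P n" "u = \<phi> n x" "x \<in> comps ?tP n" using pre[OF u] by blast
    show "f n u \<in> comps ?tP n" using x f\<phi> by simp
    show "f n (u + v) = f n u + f n v" if v: "v \<in> comps ?tD n" for v
    proof -
      obtain y where y: "y \<in> comps P n" "v = \<phi> n y" using pre[OF v] by blast
      show ?thesis
        using x y f\<phi>[OF P.subspace_add[OF P.subspace_comps x(1) y(1)]] by (simp add: f\<phi> \<phi>(2))
    qed
    show "f n (scl D c u) = scl P c (f n u)" for c
      using x f\<phi>[OF P.subspace_scale[OF P.subspace_comps x(1)], of c] by (simp add: f\<phi> \<phi>(3))
    show "f n (act D n u s) = act P n (f n u) s" if s: "s permutes {1..n}" for s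
      using x f\<phi>[OF P.act_closed[OF x(1) s]] by (simp add: f\<phi> \<phi>(4) s)
  next
    fix m n i u v
    assume u: "u \<in> comps ?tD m" and v: "v \<in> comps ?tD n" and i: "1 \<le> i \<and> i \<le> m"
    obtain x where x: "x \<in> comps P m" "u = \<phi> m x" using pre[OF u] by blast
    obtain y where y: "y \<in> comps P n" "v = \<phi> n y" using pre[OF v] by blast
    have i': "1 \<le> i" "i \<le> m" using i by auto
    have "f (m + n - 1) (\<phi> (m + n - 1) (pcomp P m n i x y)) = pcomp P m n i x y"
      by (rule f\<phi>[OF P.pcomp_closed[OF x(1) y(1) i']])
    then show "f (m + n - 1) (pcomp D m n i u v) = pcomp P m n i (f m u) (f n v)"
      unfolding \<phi>(5)[OF x(1) y(1) i'] using x y by (simp add: f\<phi>)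
  next
    show "f 1 (unit D) = unit P" using f\<phi>[OF P.unit_closed] \<phi>(6) by simp
  qed
  moreover have "2 \<le> V" by (simp add: V_def)
  ultimately obtain g where g: "operad_inj_hom D P g" and gf: "\<And>n x. x \<in> comps ?tD n \<Longrightarrow> g n x = f n x"
    using sat D.reduced_lf_operad_axioms left_torsionfree_D unfolding saturated_operad_def by blast
  have g_mem: "g n y \<in> comps P n" if "y \<in> comps D n" for n y
    using g that by (auto simp: operad_inj_hom_def operad_hom_def)
  have g_pcomp: "g (m + n - 1) (pcomp D m n i x y) = pcomp P m n i (g m x) (g n y)"
    if "x \<in> comps D m" "y \<in> comps D n" "1 \<le> i" "i \<le> m" for m n i x y
    using g that by (auto simp: operad_inj_hom_def operad_hom_def)
  have \<phi>g_large: "\<phi> n (g n y) = y" if "n \<ge> V" "y \<in> comps D n" for n y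
  proof -
    have "2 \<le> V" by (simp add: V_def)
    then have y: "y \<in> comps ?tD n" using that by (simp add: comps_tD)
    obtain x where "x \<in> comps P n" "y = \<phi> n x" using pre[OF y] by blast
    then show ?thesis using gf[OF y] f\<phi> by simp
  qed
  have \<phi>g: "\<phi> n (g n y) = y" if y: "y \<in> comps D n" for n y
  proof (cases n)
    case 0
    then show ?thesis using y \<phi>(1)[OF g_mem[OF y]] mem_comps_D_0 by simp
  next
    case (Suc d)
    have gy: "\<phi> n (g n y) \<in> comps D n" by (rule \<phi>(1)[OF g_mem[OF y]])
    have "\<phi> n (g n y) i = y i" for i
    proof (cases "i < r")
      case False
      then show ?thesis using y gy unfolding Suc mem_comps_D_Suc by metis
    next
      case i: True
      \<comment> \<open>The basis vector of summand \<open>i\<close> in this arity is fixed by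
        \<open>\<phi>\<close> after \<open>g\<close>, and composing with it moves \<open>y\<close>
        into the range where the identity is known, keeping the coordinate \<open>i\<close>.\<close>
      let ?k = "Suc (w i * V)"
      have z: "basis_vector i \<in> comps D ?k" by (rule basis_vector_mem[OF i]) simp
      have "1 * V \<le> w i * V" using w_pos[of i] by (rule mult_le_mono1)
      then have "?k \<ge> V" by linarith
      then have k: "?k \<ge> V" "n + ?k - 1 \<ge> V" using Suc by simp_all
      have n1: "1 \<le> n" using Suc by simp
      have "pcomp D n ?k 1 y (basis_vector i) = \<phi> (n + ?k - 1) (g (n + ?k - 1) (pcomp D n ?k 1 y (basis_vector i)))"
        by (rule \<phi>g_large[OF k(2) D.pcomp_closed[OF y z _ n1], symmetric]) simp
      also have "\<dots> = pcomp D n ?k 1 (\<phi> n (g n y)) (\<phi> ?k (g ?k (basis_vector i)))"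
        using g_pcomp[OF y z _ n1] \<phi>(5)[OF g_mem[OF y] g_mem[OF z] _ n1] by simp
      also have "\<phi> ?k (g ?k (basis_vector i)) = basis_vector i" by (rule \<phi>g_large[OF k(1) z])
      finally have "pcomp D n ?k 1 y (basis_vector i) i = pcomp D n ?k 1 (\<phi> n (g n y)) (basis_vector i) i"
        by simp
      then show ?thesis using i by (simp add: pcomp_D basis_vector_def)
    qed
    then show ?thesis by (rule ext)
  qed
  have "bij_betw (\<phi> n) (comps P n) (comps D n)" for n
  proof (rule bij_betw_imageI[OF \<phi>(7)])
    show "\<phi> n ` comps P n = comps D n"
    proof
      show "comps D n \<subseteq> \<phi> n ` comps P n" using \<phi>g g_mem by (metis image_eqI subsetI)
    qed (use \<phi>(1) in blast)
  qed
  then show ?thesis using hom unfolding operad_iso_def operad_inj_hom_def by blast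
qed

theorem theorem0p4:
  fixes P :: "('k::alg_closed_field, 'a::ab_group_add) operad_data"
  assumes "reduced_lf_operad P"
    and "finitely_generated_operad P"
    and "semiprime_operad P"
    and "saturated_operad P"
    and "GKdim P = 1"
  shows "\<exists>(r::nat) (Q :: nat \<Rightarrow> ('k, 'k) operad_data).
    (\<forall>i<r. \<exists>w\<ge>1. Q i = Com_operad w \<or> Q i = Ope_operad (2 * w)) \<and>
    isomorphic_operads P (direct_sum_operad {..<r} Q)"
proof -
  interpret reduced_lf_operad P by fact
  have tf: "left_torsionfree P" using assms(4) by (simp add: saturated_operad_def)
  interpret gk_one_operad P
    by unfold_locales (use tf adjacent_transpositions_agree[OF assms(5) tf assms(2)] assms in auto)
  obtain r w \<epsilon> \<phi> W where S: "periodic_sum w (\<epsilon> :: nat \<Rightarrow> 'k)"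
    and hom: "operad_inj_hom P (periodic_sum.D r w \<epsilon>) \<phi>"
    and large: "\<And>n. n \<ge> W \<Longrightarrow> \<phi> n ` comps P n = comps (periodic_sum.D r w \<epsilon>) n"
    using embedding_into_periodic_sum by blast
  interpret S: periodic_sum r w \<epsilon> by (rule S)
  have "operad_iso P S.D \<phi>"
    by (rule S.iso_if_saturated[OF assms(4) hom large operad_axioms])
  then have "isomorphic_operads P (direct_sum_operad {..<r} (\<lambda>i. periodic_operad (w i) (\<epsilon> i)))"
    unfolding isomorphic_operads_def S.D_def by blast
  moreover have "\<forall>i<r. \<exists>v\<ge>1. periodic_operad (w i) (\<epsilon> i) = Com_operad v \<or> periodic_operad (w i) (\<epsilon> i) = Ope_operad (2 * v)"
  proof (intro allI impI, goal_cases)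
    case (1 i)
    show ?case
    proof (cases "\<epsilon> i = 1")
      case True
      then show ?thesis using S.w_pos by (auto simp: periodic_operad_def)
    next
      case False
      then obtain v where v: "w i = 2 * v" using S.even_w[of i] by (auto elim: evenE)
      then have "v \<ge> 1" using S.w_pos[of i] by (cases v) auto
      then show ?thesis using v False by (auto simp: periodic_operad_def)
    qed
  qed
  ultimately show ?thesis by (intro exI conjI)
qed

end
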